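(* Let $X$ be a closed manifold of real dimension $2m$. Suppose that for every $n\ge 0$ the delocalized equivariant cohomology $H^*(X^n,S_n)$ is $\mathbb{Z}$-graded in such a way that, as $\mathbb{Z}$-graded vector spaces, $$H^*(X^n,S_n)\;\cong\;\bigoplus_{\sum_{l} lN_l=n}\ \bigotimes_{l=1}^n S^{N_l}\bigl(H^*(X)[m(l-1)]\bigr),$$ the sum being over all sequences $(N_1,N_2,\dots)$ of non-negative integers with $\sum_l lN_l=n$. Let $P_t(X^n,S_n)=\sum_d t^d\dim H^d(X^n,S_n)$ be the Poincaré polynomial with respect to this grading. Then, as formal power series in $q$, $$\sum_{n\ge 0}P_t(X^n,S_n)\,q^n=\prod_{l\ge 1}\frac{\prod_{d\ \mathrm{odd}}(1+t^dq^l)^{b_{d-m(l-1)}(X)}}{\prod_{d\ \mathrm{even}}(1-t^dq^l)^{b_{d-m(l-1)}(X)}}.$$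
   Context: For a finite group $G$ acting on a manifold $M$, $M^g$ denotes the fixed point set of $g\in G$, $Z_g$ the centralizer of $g$, $G_*$ the set of conjugacy classes, and the delocalized equivariant cohomology is $H^*(M,G)=\bigl(\bigoplus_{g\in G}H^*(M^g)\bigr)^G\cong\bigoplus_{[g]\in G_*}H^*(M^g)^{Z_g}$. The symmetric group $S_n$ acts on $X^n$ by permuting factors ($X^0$ is a point). Cohomology has real or complex coefficients; $b_d(X)=\dim H^d(X)$, with $b_d(X)=0$ for $d<0$. For a graded vector space $V$ and an integer $r$, $V[r]$ is the graded vector space with $V[r]_d=V_{d-r}$. For a $\mathbb{Z}$-graded vector space $V$, $S^N(V)$ is the $N$-th graded symmetric product: the degree-$N$ part of the quotient of the tensor algebra $T^*(V)$ by the ideal generated by $v\otimes w-(-1)^{pq}w\otimes v$ for $v\in V_p$, $w\in V_q$; the class of $v_1\otimes\cdots\otimes v_N$ has degree $\sum_i\deg v_i$. Conjugacy classes of $S_n$ correspond to cycle types $(N_1,N_2,\dots)$, where $N_l$ is the number of $l$-cycles. When $m$ is even, the grading in question is the one obtained by shifting the degrees of each summand $H^*((X^n)^g)^{Z_g}$ up by half the real codimension of $(X^n)^g$ in $X^n$, i.e. by $m\sum_l N_l(l-1)$ for $g$ of cycle type $(N_l)$. *)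

theory Defs
  imports
    "HOL-Analysis.Analysis"
    "HOL-Homology.Homology"
    "HOL-Algebra.Sym_Groups"
    "HOL-Algebra.Algebraic_Closure_Type"
    "HOL-Computational_Algebra.Formal_Laurent_Series"
begin

section \<open>Vector spaces\<close>

text \<open>
  A vector space over a field type \<open>'k\<close> is a record of type \<open>('k, 'v) module\<close>, the scalar ring being
  \<open>ring_of_type_algebra :: 'k ring\<close>. The fields \<open>mult\<close> and \<open>one\<close> are meaningful only for
  the algebras below and are left undefined otherwise.

  Restricting \<open>'k\<close> to the class \<^class>\<open>real_normed_field\<close> amounts to real or complex coefficients:
  by the Gelfand-Mazur theorem these are, up to isomorphism, its only instances.
\<close>

definition vspan :: "('k::field, 'v, 'm) module_scheme \<Rightarrow> 'v set \<Rightarrow> 'v set" where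
  "vspan V S = \<Inter>{W. submodule W (ring_of_type_algebra :: 'k ring) V \<and> S \<subseteq> W}"

definition vbasis :: "('k::field, 'v, 'm) module_scheme \<Rightarrow> 'v set \<Rightarrow> bool" where
  "vbasis V B \<longleftrightarrow>
     B \<subseteq> carrier V \<and> vspan V B = carrier V \<and> (\<forall>b\<in>B. b \<notin> vspan V (B - {b}))"

text \<open>As usual for \<^const>\<open>card\<close>, the dimension is \<open>0\<close> for infinite-dimensional spaces.\<close>

definition vdim :: "('k::field, 'v, 'm) module_scheme \<Rightarrow> nat" where
  "vdim V = card (SOME B. vbasis V B)"

definition linear_iso ::
  "('k::field, 'v, 'm) module_scheme \<Rightarrow> ('k, 'w, 'n) module_scheme \<Rightarrow> ('v \<Rightarrow> 'w) \<Rightarrow> bool" where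
  "linear_iso V W \<phi> \<longleftrightarrow> bij_betw \<phi> (carrier V) (carrier W) \<and>
     (\<forall>u\<in>carrier V. \<forall>v\<in>carrier V. \<phi> (u \<oplus>\<^bsub>V\<^esub> v) = \<phi> u \<oplus>\<^bsub>W\<^esub> \<phi> v) \<and>
     (\<forall>c. \<forall>v\<in>carrier V. \<phi> (c \<odot>\<^bsub>V\<^esub> v) = c \<odot>\<^bsub>W\<^esub> \<phi> v)"

text \<open>
  Quotient of a vector space by a subspace, or of an algebra by a two-sided ideal; on the ring
  fields it agrees with \<^const>\<open>FactRing\<close>. The summand \<open>I\<close> in the scalar multiplication only
  matters for \<open>c = 0\<close>.
\<close>

definition quot :: "('k::field, 'v, 'm) module_scheme \<Rightarrow> 'v set \<Rightarrow> ('k, 'v set) module" where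
  "quot A I = \<lparr>carrier = a_rcosets\<^bsub>A\<^esub> I, mult = rcoset_mult A I, one = I +>\<^bsub>A\<^esub> \<one>\<^bsub>A\<^esub>,
     zero = I, add = set_add A, smult = (\<lambda>c C. I <+>\<^bsub>A\<^esub> ((\<lambda>v. c \<odot>\<^bsub>A\<^esub> v) ` C))\<rparr>"

definition direct_sum ::
  "'i set \<Rightarrow> ('i \<Rightarrow> ('k::field, 'v, 'm) module_scheme) \<Rightarrow> ('k, 'i \<Rightarrow> 'v) module" where
  "direct_sum I V =
     \<lparr>carrier = {f \<in> (\<Pi>\<^sub>E i\<in>I. carrier (V i)). finite {i \<in> I. f i \<noteq> \<zero>\<^bsub>V i\<^esub>}},
      mult = undefined, one = undefined,
      zero = (\<lambda>i\<in>I. \<zero>\<^bsub>V i\<^esub>),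
      add = (\<lambda>f g. \<lambda>i\<in>I. f i \<oplus>\<^bsub>V i\<^esub> g i),
      smult = (\<lambda>c f. \<lambda>i\<in>I. c \<odot>\<^bsub>V i\<^esub> f i)\<rparr>"

definition free_space :: "'s set \<Rightarrow> ('k::field, 's \<Rightarrow>\<^sub>0 'k) module" where
  "free_space S = \<lparr>carrier = {f. Poly_Mapping.keys f \<subseteq> S}, mult = undefined, one = undefined,
     zero = 0, add = (+), smult = (\<lambda>c. Poly_Mapping.map ((*) c))\<rparr>"

section \<open>Graded vector spaces\<close>

record ('k, 'v) graded_module = "('k, 'v) module" +
  degpart :: "int \<Rightarrow> 'v set"

text \<open>\<open>V\<close> is the internal direct sum of the subspaces \<open>D d\<close>.\<close>

definition is_grading :: "('k::field, 'v, 'm) module_scheme \<Rightarrow> (int \<Rightarrow> 'v set) \<Rightarrow> bool" where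
  "is_grading V D \<longleftrightarrow>
     (\<forall>d. submodule (D d) (ring_of_type_algebra :: 'k ring) V) \<and>
     (\<forall>v\<in>carrier V. \<exists>!f. (\<forall>d. f d \<in> D d) \<and> finite {d. f d \<noteq> \<zero>\<^bsub>V\<^esub>} \<and>
        v = finsum V f {d. f d \<noteq> \<zero>\<^bsub>V\<^esub>})"

definition with_grading ::
  "('k::field, 'v) module \<Rightarrow> (int \<Rightarrow> 'v set) \<Rightarrow> ('k, 'v) graded_module" where
  "with_grading V D = module.extend V (graded_module.fields D)"

definition graded_isomorphic ::
  "('k::field, 'v) graded_module \<Rightarrow> ('k, 'w) graded_module \<Rightarrow> bool" where
  "graded_isomorphic V W \<longleftrightarrow>
     (\<exists>\<phi>. linear_iso V W \<phi> \<and> (\<forall>d. \<phi> ` degpart V d = degpart W d))"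

definition graded_dim :: "('k::field, 'v) graded_module \<Rightarrow> int \<Rightarrow> nat" where
  "graded_dim V d = vdim (V\<lparr>carrier := degpart V d\<rparr>)"

text \<open>The variable \<open>t\<close> is the generator of the field of formal Laurent series over \<open>\<rat>\<close>.\<close>

definition poincare_polynomial :: "('k::field, 'v) graded_module \<Rightarrow> rat fls" where
  "poincare_polynomial V =
     (\<Sum>d | graded_dim V d \<noteq> 0. of_nat (graded_dim V d) * fls_X_intpow d)"

definition shift :: "('k::field, 'v) graded_module \<Rightarrow> int \<Rightarrow> ('k, 'v) graded_module" where
  "shift V r = V\<lparr>degpart := (\<lambda>d. degpart V (d - r))\<rparr>"

definition graded_direct_sum ::
  "'i set \<Rightarrow> ('i \<Rightarrow> ('k::field, 'v) graded_module) \<Rightarrow> ('k, 'i \<Rightarrow> 'v) graded_module" where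
  "graded_direct_sum I V = with_grading (direct_sum I V)
     (\<lambda>d. {f \<in> carrier (direct_sum I V). \<forall>i\<in>I. f i \<in> degpart (V i) d})"

subsection \<open>Tensor products of finite families\<close>

definition tensor_relations ::
  "'i set \<Rightarrow> ('i \<Rightarrow> ('k::field, 'v) graded_module) \<Rightarrow> (('i \<Rightarrow> 'v) \<Rightarrow>\<^sub>0 'k) set" where
  "tensor_relations I V =
     {Poly_Mapping.single (x(i := v \<oplus>\<^bsub>V i\<^esub> w)) 1
        - Poly_Mapping.single (x(i := v)) 1 - Poly_Mapping.single (x(i := w)) 1 | x i v w.
        x \<in> (\<Pi>\<^sub>E i\<in>I. carrier (V i)) \<and> i \<in> I \<and> v \<in> carrier (V i) \<and> w \<in> carrier (V i)} \<union>
     {Poly_Mapping.single (x(i := c \<odot>\<^bsub>V i\<^esub> v)) 1 - Poly_Mapping.single (x(i := v)) c | x i c v.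
        x \<in> (\<Pi>\<^sub>E i\<in>I. carrier (V i)) \<and> i \<in> I \<and> v \<in> carrier (V i)}"

definition tensor_space ::
  "'i set \<Rightarrow> ('i \<Rightarrow> ('k::field, 'v) graded_module) \<Rightarrow> ('k, (('i \<Rightarrow> 'v) \<Rightarrow>\<^sub>0 'k) set) module" where
  "tensor_space I V =
     (let F = free_space (\<Pi>\<^sub>E i\<in>I. carrier (V i)) in quot F (vspan F (tensor_relations I V)))"

definition pure_tensor ::
  "'i set \<Rightarrow> ('i \<Rightarrow> ('k::field, 'v) graded_module) \<Rightarrow> ('i \<Rightarrow> 'v) \<Rightarrow> (('i \<Rightarrow> 'v) \<Rightarrow>\<^sub>0 'k) set" where
  "pure_tensor I V x =
     (let F = free_space (\<Pi>\<^sub>E i\<in>I. carrier (V i))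
      in vspan F (tensor_relations I V) +>\<^bsub>F\<^esub> Poly_Mapping.single x 1)"

definition graded_tensor ::
  "'i set \<Rightarrow> ('i \<Rightarrow> ('k::field, 'v) graded_module)
     \<Rightarrow> ('k, (('i \<Rightarrow> 'v) \<Rightarrow>\<^sub>0 'k) set) graded_module" where
  "graded_tensor I V = with_grading (tensor_space I V)
     (\<lambda>d. vspan (tensor_space I V)
        {pure_tensor I V x | x \<delta>. x \<in> (\<Pi>\<^sub>E i\<in>I. carrier (V i)) \<and>
           (\<forall>i\<in>I. x i \<in> degpart (V i) (\<delta> i)) \<and> (\<Sum>i\<in>I. \<delta> i) = d})"

subsection \<open>Tensor algebra and graded symmetric powers\<close>

text \<open>The free associative unital algebra on the set \<open>S\<close>: words multiply by concatenation.\<close>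

definition free_algebra :: "'s set \<Rightarrow> ('k::field, 's list \<Rightarrow>\<^sub>0 'k) module" where
  "free_algebra S = (free_space (lists S))
     \<lparr>mult := (\<lambda>f g. \<Sum>u\<in>Poly_Mapping.keys f. \<Sum>v\<in>Poly_Mapping.keys g.
        Poly_Mapping.single (u @ v) (Poly_Mapping.lookup f u * Poly_Mapping.lookup g v)),
      one := Poly_Mapping.single [] 1\<rparr>"

text \<open>
  The tensor algebra of \<open>V\<close> is the free algebra on the set of vectors of \<open>V\<close> modulo the ideal
  making the inclusion of \<open>V\<close> linear; \<open>tensor_word V [v\<^sub>1, \<dots>, v\<^sub>N]\<close> is \<open>v\<^sub>1 \<otimes> \<dots> \<otimes> v\<^sub>N\<close>.
\<close>

definition linearity_ideal ::
  "('k::field, 'v, 'm) module_scheme \<Rightarrow> ('v list \<Rightarrow>\<^sub>0 'k) set" where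
  "linearity_ideal V = genideal (free_algebra (carrier V) :: ('k, 'v list \<Rightarrow>\<^sub>0 'k) module)
     ({Poly_Mapping.single [v \<oplus>\<^bsub>V\<^esub> w] 1
         - Poly_Mapping.single [v] 1 - Poly_Mapping.single [w] 1 | v w.
         v \<in> carrier V \<and> w \<in> carrier V} \<union>
      {Poly_Mapping.single [c \<odot>\<^bsub>V\<^esub> v] 1 - Poly_Mapping.single [v] c | c v. v \<in> carrier V})"

definition tensor_algebra ::
  "('k::field, 'v, 'm) module_scheme \<Rightarrow> ('k, ('v list \<Rightarrow>\<^sub>0 'k) set) module" where
  "tensor_algebra V = quot (free_algebra (carrier V)) (linearity_ideal V)"

definition tensor_word ::
  "('k::field, 'v, 'm) module_scheme \<Rightarrow> 'v list \<Rightarrow> ('v list \<Rightarrow>\<^sub>0 'k) set" where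
  "tensor_word V vs =
     linearity_ideal V +>\<^bsub>free_algebra (carrier V) :: ('k, 'v list \<Rightarrow>\<^sub>0 'k) module\<^esub>
       Poly_Mapping.single vs 1"

definition commutation_ideal ::
  "('k::field, 'v) graded_module \<Rightarrow> ('v list \<Rightarrow>\<^sub>0 'k) set set" where
  "commutation_ideal V = genideal (tensor_algebra V)
     {(tensor_word V [v] \<otimes>\<^bsub>tensor_algebra V\<^esub> tensor_word V [w])
        \<ominus>\<^bsub>tensor_algebra V\<^esub>
        (((-1) powi (p * q)) \<odot>\<^bsub>tensor_algebra V\<^esub>
           (tensor_word V [w] \<otimes>\<^bsub>tensor_algebra V\<^esub> tensor_word V [v])) | p q v w.
        v \<in> degpart V p \<and> w \<in> degpart V q}"

definition symmetric_algebra ::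
  "('k::field, 'v) graded_module \<Rightarrow> ('k, ('v list \<Rightarrow>\<^sub>0 'k) set set) module" where
  "symmetric_algebra V = quot (tensor_algebra V) (commutation_ideal V)"

definition symmetric_word ::
  "('k::field, 'v) graded_module \<Rightarrow> 'v list \<Rightarrow> ('v list \<Rightarrow>\<^sub>0 'k) set set" where
  "symmetric_word V vs = commutation_ideal V +>\<^bsub>tensor_algebra V\<^esub> tensor_word V vs"

definition symmetric_power ::
  "nat \<Rightarrow> ('k::field, 'v) graded_module \<Rightarrow> ('k, ('v list \<Rightarrow>\<^sub>0 'k) set set) graded_module" where
  "symmetric_power N V = with_grading
     ((symmetric_algebra V)\<lparr>carrier := vspan (symmetric_algebra V)
        {symmetric_word V vs | vs. vs \<in> lists (carrier V) \<and> length vs = N}\<rparr>)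
     (\<lambda>d. vspan (symmetric_algebra V)
        {symmetric_word V vs | vs ds. length vs = N \<and>
           list_all2 (\<lambda>e v. v \<in> degpart V e) ds vs \<and> sum_list ds = d})"

section \<open>Singular cohomology\<close>

text \<open>
  The \<open>p\<close>-cochains are the additive maps from singular \<open>p\<close>-chains with integer coefficients to \<open>'k\<close>.
\<close>

definition cochain_space :: "nat \<Rightarrow> 'a topology \<Rightarrow> ('k::field, 'a chain \<Rightarrow> 'k) module" where
  "cochain_space p Y =
     \<lparr>carrier = hom (chain_group p Y) (add_monoid (ring_of_type_algebra :: 'k ring))
        \<inter> extensional (singular_chain_set p Y),
      mult = undefined, one = undefined,
      zero = (\<lambda>c\<in>singular_chain_set p Y. 0),
      add = (\<lambda>u v. \<lambda>c\<in>singular_chain_set p Y. u c + v c),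
      smult = (\<lambda>a u. \<lambda>c\<in>singular_chain_set p Y. a * u c)\<rparr>"

definition coboundary ::
  "nat \<Rightarrow> 'a topology \<Rightarrow> ('a chain \<Rightarrow> 'k::field) \<Rightarrow> 'a chain \<Rightarrow> 'k" where
  "coboundary p Y u = (\<lambda>c\<in>singular_chain_set (Suc p) Y. u (chain_boundary (Suc p) c))"

definition cocycles :: "nat \<Rightarrow> 'a topology \<Rightarrow> ('a chain \<Rightarrow> 'k::field) set" where
  "cocycles p Y =
     {u \<in> carrier (cochain_space p Y). coboundary p Y u = \<zero>\<^bsub>cochain_space (Suc p) Y\<^esub>}"

definition coboundaries :: "nat \<Rightarrow> 'a topology \<Rightarrow> ('a chain \<Rightarrow> 'k::field) set" where
  "coboundaries p Y = (case p of 0 \<Rightarrow> {\<zero>\<^bsub>cochain_space 0 Y\<^esub>}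
     | Suc r \<Rightarrow> coboundary r Y ` carrier (cochain_space r Y))"

definition cohomology :: "nat \<Rightarrow> 'a topology \<Rightarrow> ('k::field, ('a chain \<Rightarrow> 'k) set) module" where
  "cohomology p Y = quot ((cochain_space p Y)\<lparr>carrier := cocycles p Y\<rparr>) (coboundaries p Y)"

definition total_cohomology ::
  "'a topology \<Rightarrow> ('k::field, nat \<Rightarrow> ('a chain \<Rightarrow> 'k) set) module" where
  "total_cohomology Y = direct_sum UNIV (\<lambda>p. cohomology p Y)"

definition graded_cohomology ::
  "'a topology \<Rightarrow> ('k::field, nat \<Rightarrow> ('a chain \<Rightarrow> 'k) set) graded_module" where
  "graded_cohomology Y = with_grading (total_cohomology Y)
     (\<lambda>d. {\<alpha> \<in> carrier (total_cohomology Y). \<forall>p. int p \<noteq> d \<longrightarrow> \<alpha> p = \<zero>\<^bsub>cohomology p Y\<^esub>})"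

definition betti :: "'k::field itself \<Rightarrow> 'a topology \<Rightarrow> int \<Rightarrow> nat" where
  "betti _ Y d =
     (if d < 0 then 0 else vdim (cohomology (nat d) Y :: ('k, ('a chain \<Rightarrow> 'k) set) module))"

text \<open>The map \<open>f\<^sup>* [u] = [u \<circ> f\<^sub>#]\<close> from the cohomology of the target of \<open>f\<close> to that of its source \<open>Y\<close>.\<close>

definition pullback ::
  "'a topology \<Rightarrow> ('a \<Rightarrow> 'b) \<Rightarrow> (nat \<Rightarrow> ('b chain \<Rightarrow> 'k::field) set)
     \<Rightarrow> nat \<Rightarrow> ('a chain \<Rightarrow> 'k) set" where
  "pullback Y f \<alpha> p = coboundaries p Y <+>\<^bsub>cochain_space p Y :: ('k, 'a chain \<Rightarrow> 'k) module\<^esub>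
     ((\<lambda>u. \<lambda>c\<in>singular_chain_set p Y. u (chain_map p f c)) ` \<alpha> p)"

section \<open>Delocalized equivariant cohomology\<close>

definition fixed_space :: "'a topology \<Rightarrow> ('g \<Rightarrow> 'a \<Rightarrow> 'a) \<Rightarrow> 'g \<Rightarrow> 'a topology" where
  "fixed_space M act g = subtopology M {x \<in> topspace M. act g x = x}"

text \<open>
  The element \<open>h\<close> maps the summand \<open>H\<^sup>*(M\<^sup>g)\<close> to \<open>H\<^sup>*(M\<^sup>g\<^sup>')\<close>, \<open>g' = h g h\<^sup>-\<^sup>1\<close>, by pulling back along
  \<open>h\<^sup>-\<^sup>1\<close>, which maps \<open>M\<^sup>g\<^sup>'\<close> to \<open>M\<^sup>g\<close>.
\<close>

definition delocalized_action ::
  "('g, 'n) monoid_scheme \<Rightarrow> ('g \<Rightarrow> 'a \<Rightarrow> 'a) \<Rightarrow> 'a topology \<Rightarrow> 'g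
     \<Rightarrow> ('g \<Rightarrow> nat \<Rightarrow> ('a chain \<Rightarrow> 'k::field) set) \<Rightarrow> 'g \<Rightarrow> nat \<Rightarrow> ('a chain \<Rightarrow> 'k) set" where
  "delocalized_action G act M h \<alpha> = (\<lambda>g\<in>carrier G.
     pullback (fixed_space M act g) (act (inv\<^bsub>G\<^esub> h)) (\<alpha> (inv\<^bsub>G\<^esub> h \<otimes>\<^bsub>G\<^esub> g \<otimes>\<^bsub>G\<^esub> h)))"

definition delocalized_cohomology ::
  "('g, 'n) monoid_scheme \<Rightarrow> ('g \<Rightarrow> 'a \<Rightarrow> 'a) \<Rightarrow> 'a topology
     \<Rightarrow> ('k::field, 'g \<Rightarrow> nat \<Rightarrow> ('a chain \<Rightarrow> 'k) set) module" where
  "delocalized_cohomology G act M =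
     (let T = direct_sum (carrier G) (\<lambda>g. total_cohomology (fixed_space M act g))
      in T\<lparr>carrier := {\<alpha> \<in> carrier T. \<forall>h\<in>carrier G. delocalized_action G act M h \<alpha> = \<alpha>}\<rparr>)"

definition power_space :: "'a topology \<Rightarrow> nat \<Rightarrow> (nat \<Rightarrow> 'a) topology" where
  "power_space Y n = product_topology (\<lambda>_. Y) {1..n}"

definition permute_factors :: "(nat \<Rightarrow> nat) \<Rightarrow> (nat \<Rightarrow> 'a) \<Rightarrow> nat \<Rightarrow> 'a" where
  "permute_factors \<sigma> x = x \<circ> inv' \<sigma>"

definition symmetric_delocalized_cohomology ::
  "'a topology \<Rightarrow> nat
     \<Rightarrow> ('k::field, (nat \<Rightarrow> nat) \<Rightarrow> nat \<Rightarrow> ((nat \<Rightarrow> 'a) chain \<Rightarrow> 'k) set) module" where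
  "symmetric_delocalized_cohomology Y n =
     delocalized_cohomology (sym_group n) permute_factors (power_space Y n)"

text \<open>Sequences \<open>(N\<^sub>1, N\<^sub>2, \<dots>)\<close> are functions on \<open>nat\<close> vanishing at \<open>0\<close>.\<close>

definition cycle_types :: "nat \<Rightarrow> (nat \<Rightarrow> nat) set" where
  "cycle_types n = {N. N 0 = 0 \<and> finite {l. N l \<noteq> 0} \<and> (\<Sum>l | N l \<noteq> 0. l * N l) = n}"

definition symmetric_product_sum ::
  "nat \<Rightarrow> ('k::field, 'v) graded_module \<Rightarrow> nat
     \<Rightarrow> ('k, (nat \<Rightarrow> nat) \<Rightarrow> ((nat \<Rightarrow> ('v list \<Rightarrow>\<^sub>0 'k) set set) \<Rightarrow>\<^sub>0 'k) set) graded_module" where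
  "symmetric_product_sum m V n = graded_direct_sum (cycle_types n)
     (\<lambda>N. graded_tensor {1..n}
        (\<lambda>l. symmetric_power (N l) (shift V (int m * (int l - 1)))))"

text \<open>No smooth structure is assumed, and neither connectedness nor nonemptiness.\<close>

definition closed_manifold :: "nat \<Rightarrow> 'a topology \<Rightarrow> bool" where
  "closed_manifold k Y \<longleftrightarrow> Hausdorff_space Y \<and> second_countable Y \<and> compact_space Y \<and>
     (\<forall>x\<in>topspace Y. \<exists>U W. openin Y U \<and> x \<in> U \<and> openin (Euclidean_space k) W \<and>
        subtopology Y U homeomorphic_space subtopology (Euclidean_space k) W)"

definition monomial_tq :: "int \<Rightarrow> nat \<Rightarrow> rat fls fps" where
  "monomial_tq d l = fps_const (fls_X_intpow d) * fps_X ^ l"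

text \<open>
  The degree \<open>d\<close> ranges over all integers, \<open>b\<close> being \<open>0\<close> at negative arguments.
  Factors with exponent \<open>0\<close> are omitted, so that both products are finite when
  only finitely many nonzero Betti numbers.
\<close>

definition product_factor :: "(int \<Rightarrow> nat) \<Rightarrow> nat \<Rightarrow> nat \<Rightarrow> rat fls fps" where
  "product_factor b m l =
     (let e = (\<lambda>d. b (d - int m * (int l - 1))) in
      (\<Prod>d | odd d \<and> e d \<noteq> 0. (1 + monomial_tq d l) ^ e d) /
      (\<Prod>d | even d \<and> e d \<noteq> 0. (1 - monomial_tq d l) ^ e d))"

end

theory Submission
  imports Defs
begin

text \<open>
  The Poincare polynomial only depends on the graded isomorphism class, so it may be computed on
  the right-hand side of the hypothesis, that is, from a homogeneous basis of \<open>H\<^sup>*(M)\<close>. Let \<open>I\<close>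
  index such a basis and let \<open>dg i\<close> be the degree of its \<open>i\<close>-th element. The shift by \<open>m (l - 1)\<close> turns
  the degrees into \<open>dg i + m (l - 1)\<close>. The power \<open>S\<^sup>N\<close> has the monomials of length \<open>N\<close> as a basis,
  where a basis element of odd degree may occur at most once, and a tensor product has the products
  of basis elements as a basis. Hence the \<open>n\<close>-th Poincare polynomial is the sum, over all cycle types
  \<open>(N\<^sub>l)\<close> of \<open>n\<close>, of the products over \<open>l\<close> of the generating polynomials of the monomials of
  length \<open>N\<^sub>l\<close>. Weighting \<open>N\<^sub>l\<close> by \<open>q\<close> to the power \<open>l N\<^sub>l\<close>, this sum over cycle types is what one gets by
  expanding an infinite product over \<open>l\<close> (\<open>has_prod_cycle_types\<close>), and its \<open>l\<close>-th factor, the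
  generating series of all monomials, is a product with one factor for each basis element: a
  geometric series if the degree is even, and a binomial \<open>1 + t\<^sup>d q\<^sup>l\<close> if it is odd
  (\<open>monomial_series_product\<close>).

  Two ingredients are not formal. The first is that the monomials are linearly independent in the
  symmetric power, which is defined by generators and relations. Every basis produced below
  therefore comes with its dual coordinate functionals, and these are constructed by the universal
  property of the quotient. For a monomial \<open>\<mu>\<close> the functional sends a word to the sum, over all
  arrangements of \<open>\<mu>\<close>, of the corresponding product of coordinates, each with its Koszul sign
  (\<open>monomial_functional\<close>); it respects the relations and is dual to the sorted monomials, which span
  because two adjacent letters commute up to sign (\<open>homogeneous_coordinates_symmetric_power\<close>).

  The second is that \<open>H\<^sup>*(M)\<close> is finite-dimensional, without which there is no finite basis to count.
  For a topological manifold this is shown with singular chains. Say that an inclusion \<open>A \<subseteq> B\<close> has finite rank if its image in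
  rational homology is finite-dimensional. By a Mayer-Vietoris argument for maps
  (\<open>rank_le_Mayer_Vietoris\<close>) finite rank passes to unions after shrinking. In Euclidean space every
  inclusion of a compact set into an open set has finite rank, since a finite union of
  boxes fits in between, and the property is inherited by finite unions of charts
  (\<open>closed_manifold_finite_rank\<close>). A cocycle with values in a field of characteristic zero is
  determined, up to coboundaries, by its values on finitely many cycles that generate the
  rational homology (\<open>cohomology_coordinates\<close>).
\<close>

section \<open>Linear algebra over carrier sets\<close>

abbreviation vectorspace :: "('k::field, 'v, 'm) module_scheme \<Rightarrow> bool" where
  "vectorspace V \<equiv> Module.module (ring_of_type_algebra :: 'k ring) V"

abbreviation subspace_of :: "'v set \<Rightarrow> ('k::field, 'v, 'm) module_scheme \<Rightarrow> bool" where
  "subspace_of W V \<equiv> submodule W (ring_of_type_algebra :: 'k ring) V"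

lemma type_algebra_simps [simp]:
  "carrier (ring_of_type_algebra :: 'k::field ring) = UNIV"
  "\<zero>\<^bsub>ring_of_type_algebra\<^esub> = (0::'k)" "\<one>\<^bsub>ring_of_type_algebra\<^esub> = (1::'k)"
  "a \<oplus>\<^bsub>ring_of_type_algebra\<^esub> b = (a + b :: 'k)" "a \<otimes>\<^bsub>ring_of_type_algebra\<^esub> b = a * b"
  by (simp_all add: ring_of_type_algebra_def)

lemma vectorspaceI:
  fixes V :: "('k::field, 'v, 'm) module_scheme"
  assumes "\<And>x y. x \<in> carrier V \<Longrightarrow> y \<in> carrier V \<Longrightarrow> x \<oplus>\<^bsub>V\<^esub> y \<in> carrier V"
    and "\<zero>\<^bsub>V\<^esub> \<in> carrier V"
    and "\<And>x y z. x \<in> carrier V \<Longrightarrow> y \<in> carrier V \<Longrightarrow> z \<in> carrier V \<Longrightarrow>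
           (x \<oplus>\<^bsub>V\<^esub> y) \<oplus>\<^bsub>V\<^esub> z = x \<oplus>\<^bsub>V\<^esub> (y \<oplus>\<^bsub>V\<^esub> z)"
    and "\<And>x y. x \<in> carrier V \<Longrightarrow> y \<in> carrier V \<Longrightarrow> x \<oplus>\<^bsub>V\<^esub> y = y \<oplus>\<^bsub>V\<^esub> x"
    and "\<And>x. x \<in> carrier V \<Longrightarrow> \<zero>\<^bsub>V\<^esub> \<oplus>\<^bsub>V\<^esub> x = x"
    and "\<And>(a::'k) x. x \<in> carrier V \<Longrightarrow> a \<odot>\<^bsub>V\<^esub> x \<in> carrier V"
    and "\<And>(a::'k) b x. x \<in> carrier V \<Longrightarrow> (a + b) \<odot>\<^bsub>V\<^esub> x = a \<odot>\<^bsub>V\<^esub> x \<oplus>\<^bsub>V\<^esub> b \<odot>\<^bsub>V\<^esub> x"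
    and "\<And>(a::'k) x y. x \<in> carrier V \<Longrightarrow> y \<in> carrier V \<Longrightarrow>
           a \<odot>\<^bsub>V\<^esub> (x \<oplus>\<^bsub>V\<^esub> y) = a \<odot>\<^bsub>V\<^esub> x \<oplus>\<^bsub>V\<^esub> a \<odot>\<^bsub>V\<^esub> y"
    and "\<And>(a::'k) b x. x \<in> carrier V \<Longrightarrow> (a * b) \<odot>\<^bsub>V\<^esub> x = a \<odot>\<^bsub>V\<^esub> (b \<odot>\<^bsub>V\<^esub> x)"
    and "\<And>x. x \<in> carrier V \<Longrightarrow> (1::'k) \<odot>\<^bsub>V\<^esub> x = x"
    and "\<And>x. x \<in> carrier V \<Longrightarrow> (0::'k) \<odot>\<^bsub>V\<^esub> x = \<zero>\<^bsub>V\<^esub>"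
  shows "vectorspace V"
proof (rule moduleI)
  show "cring (ring_of_type_algebra :: 'k ring)" ..
  have "\<exists>y\<in>carrier V. y \<oplus>\<^bsub>V\<^esub> x = \<zero>\<^bsub>V\<^esub>" if x: "x \<in> carrier V" for x
  proof
    have "(-1) \<odot>\<^bsub>V\<^esub> x \<oplus>\<^bsub>V\<^esub> x = (-1) \<odot>\<^bsub>V\<^esub> x \<oplus>\<^bsub>V\<^esub> (1::'k) \<odot>\<^bsub>V\<^esub> x"
      using assms(10) x by simp
    also have "\<dots> = ((-1) + 1 :: 'k) \<odot>\<^bsub>V\<^esub> x"
      using assms(7)[of x "-1" 1] x by simp
    finally show "(-1) \<odot>\<^bsub>V\<^esub> x \<oplus>\<^bsub>V\<^esub> x = \<zero>\<^bsub>V\<^esub>"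
      using assms(11) x by simp
  qed (use assms(6) x in blast)
  then show "abelian_group V"
    using assms by (intro abelian_groupI) auto
qed (use assms in auto)

lemma
  fixes V :: "('k::field, 'v, 'm) module_scheme"
  assumes "vectorspace V"
  shows vs_abelian_group: "abelian_group V"
    and vs_add_closed: "x \<in> carrier V \<Longrightarrow> y \<in> carrier V \<Longrightarrow> x \<oplus>\<^bsub>V\<^esub> y \<in> carrier V"
    and vs_zero_closed: "\<zero>\<^bsub>V\<^esub> \<in> carrier V"
    and vs_smult_closed: "x \<in> carrier V \<Longrightarrow> a \<odot>\<^bsub>V\<^esub> x \<in> carrier V"
    and vs_smult_add_left: "x \<in> carrier V \<Longrightarrow> (a + b) \<odot>\<^bsub>V\<^esub> x = a \<odot>\<^bsub>V\<^esub> x \<oplus>\<^bsub>V\<^esub> b \<odot>\<^bsub>V\<^esub> x"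
    and vs_smult_add_right: "x \<in> carrier V \<Longrightarrow> y \<in> carrier V \<Longrightarrow>
           a \<odot>\<^bsub>V\<^esub> (x \<oplus>\<^bsub>V\<^esub> y) = a \<odot>\<^bsub>V\<^esub> x \<oplus>\<^bsub>V\<^esub> a \<odot>\<^bsub>V\<^esub> y"
    and vs_smult_assoc: "x \<in> carrier V \<Longrightarrow> (a * b) \<odot>\<^bsub>V\<^esub> x = a \<odot>\<^bsub>V\<^esub> (b \<odot>\<^bsub>V\<^esub> x)"
    and vs_smult_one: "x \<in> carrier V \<Longrightarrow> 1 \<odot>\<^bsub>V\<^esub> x = x"
    and vs_smult_zero: "x \<in> carrier V \<Longrightarrow> 0 \<odot>\<^bsub>V\<^esub> x = \<zero>\<^bsub>V\<^esub>"
    and vs_smult_zero_right: "a \<odot>\<^bsub>V\<^esub> \<zero>\<^bsub>V\<^esub> = \<zero>\<^bsub>V\<^esub>"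
    and vs_minus: "x \<in> carrier V \<Longrightarrow> \<ominus>\<^bsub>V\<^esub> x = (-1) \<odot>\<^bsub>V\<^esub> x"
proof -
  interpret V: Module.module "ring_of_type_algebra :: 'k ring" V by (rule assms)
  show "abelian_group V" ..
  show "x \<in> carrier V \<Longrightarrow> y \<in> carrier V \<Longrightarrow> x \<oplus>\<^bsub>V\<^esub> y \<in> carrier V" by simp
  show "\<zero>\<^bsub>V\<^esub> \<in> carrier V" by simp
  show "x \<in> carrier V \<Longrightarrow> a \<odot>\<^bsub>V\<^esub> x \<in> carrier V" for a x by simp
  show l: "x \<in> carrier V \<Longrightarrow> (a + b) \<odot>\<^bsub>V\<^esub> x = a \<odot>\<^bsub>V\<^esub> x \<oplus>\<^bsub>V\<^esub> b \<odot>\<^bsub>V\<^esub> x" for a b x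
    using V.smult_l_distr[of a b x] by simp
  show "x \<in> carrier V \<Longrightarrow> y \<in> carrier V \<Longrightarrow> a \<odot>\<^bsub>V\<^esub> (x \<oplus>\<^bsub>V\<^esub> y) = a \<odot>\<^bsub>V\<^esub> x \<oplus>\<^bsub>V\<^esub> a \<odot>\<^bsub>V\<^esub> y"
    using V.smult_r_distr[of a x y] by simp
  show "x \<in> carrier V \<Longrightarrow> (a * b) \<odot>\<^bsub>V\<^esub> x = a \<odot>\<^bsub>V\<^esub> (b \<odot>\<^bsub>V\<^esub> x)"
    using V.smult_assoc1[of a b x] by simp
  show one: "x \<in> carrier V \<Longrightarrow> 1 \<odot>\<^bsub>V\<^esub> x = x" for x
    using V.smult_one[of x] by simp
  show zero: "x \<in> carrier V \<Longrightarrow> 0 \<odot>\<^bsub>V\<^esub> x = \<zero>\<^bsub>V\<^esub>" for x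
    using V.smult_l_null[of x] by simp
  show "a \<odot>\<^bsub>V\<^esub> \<zero>\<^bsub>V\<^esub> = \<zero>\<^bsub>V\<^esub>" using V.smult_r_null[of a] by simp
  show "\<ominus>\<^bsub>V\<^esub> x = (-1) \<odot>\<^bsub>V\<^esub> x" if x: "x \<in> carrier V"
  proof (rule V.minus_equality)
    show "(-1) \<odot>\<^bsub>V\<^esub> x \<oplus>\<^bsub>V\<^esub> x = \<zero>\<^bsub>V\<^esub>"
      using l[OF x, of "-1" 1] one[OF x] zero[OF x] by simp
  qed (use x in simp_all)
qed

lemma subspaceI:
  fixes V :: "('k::field, 'v, 'm) module_scheme"
  assumes V: "vectorspace V" and "W \<subseteq> carrier V" "\<zero>\<^bsub>V\<^esub> \<in> W"
    and "\<And>x y. x \<in> W \<Longrightarrow> y \<in> W \<Longrightarrow> x \<oplus>\<^bsub>V\<^esub> y \<in> W"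
    and sm: "\<And>a x. x \<in> W \<Longrightarrow> a \<odot>\<^bsub>V\<^esub> x \<in> W"
  shows "subspace_of W V"
proof -
  have "\<ominus>\<^bsub>V\<^esub> x \<in> W" if "x \<in> W" for x
    using vs_minus[OF V, of x] sm[of x "-1"] that assms(2) by auto
  then show ?thesis
    using assms
    by (simp add: submodule_def submodule_axioms_def subgroup_def a_inv_def[symmetric] subset_iff)
qed

lemma
  fixes V :: "('k::field, 'v, 'm) module_scheme"
  assumes "subspace_of W V"
  shows subspace_carrier: "W \<subseteq> carrier V" and subspace_zero: "\<zero>\<^bsub>V\<^esub> \<in> W"
    and subspace_plus: "x \<in> W \<Longrightarrow> y \<in> W \<Longrightarrow> x \<oplus>\<^bsub>V\<^esub> y \<in> W"
    and subspace_smult: "x \<in> W \<Longrightarrow> a \<odot>\<^bsub>V\<^esub> x \<in> W"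
  using assms by (auto simp: submodule_def submodule_axioms_def subgroup_def)

lemma subspace_cong:
  fixes V :: "('k::field, 'v, 'm) module_scheme" and V' :: "('k, 'v, 'n) module_scheme"
  assumes "carrier V = carrier V'" "add V = add V'" "zero V = zero V'" "smult V = smult V'"
  shows "subspace_of W V = subspace_of W V'"
  using assms by (simp add: submodule_def submodule_axioms_def subgroup_def m_inv_def)

lemma vectorspace_cong:
  fixes V :: "('k::field, 'v, 'm) module_scheme" and V' :: "('k, 'v, 'n) module_scheme"
  assumes eq: "carrier V = carrier V'" "add V = add V'" "zero V = zero V'" "smult V = smult V'"
    and V: "vectorspace V"
  shows "vectorspace V'"
proof -
  interpret V: abelian_group V using vs_abelian_group[OF V] .
  show ?thesis
    using V.a_closed V.zero_closed V.a_assoc V.a_comm V.l_zero vs_smult_closed[OF V]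
      vs_smult_add_left[OF V] vs_smult_add_right[OF V] vs_smult_assoc[OF V] vs_smult_one[OF V]
      vs_smult_zero[OF V]
    by (intro vectorspaceI) (auto simp: eq)
qed

lemma subspace_self: "vectorspace V \<Longrightarrow> subspace_of (carrier V) V"
  by (intro subspaceI) (auto simp: vs_smult_closed vs_add_closed vs_zero_closed)

lemma vectorspace_subspace:
  fixes V :: "('k::field, 'v, 'm) module_scheme"
  assumes V: "vectorspace V" and W: "subspace_of W V"
  shows "vectorspace (V\<lparr>carrier := W\<rparr>)"
proof -
  interpret V: abelian_group V using vs_abelian_group[OF V] .
  note W' = subspace_carrier[OF W, THEN subsetD]
  show ?thesis
    using V.a_assoc V.a_comm V.l_zero subspace_zero[OF W] subspace_plus[OF W] subspace_smult[OF W]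
      vs_smult_add_left[OF V] vs_smult_add_right[OF V] vs_smult_assoc[OF V] vs_smult_one[OF V]
      vs_smult_zero[OF V] W'
    by (intro vectorspaceI) auto
qed

lemma subspace_of_subspace:
  fixes V :: "('k::field, 'v, 'm) module_scheme"
  assumes V: "vectorspace V" and W: "subspace_of W V"
  shows "subspace_of U (V\<lparr>carrier := W\<rparr>) \<longleftrightarrow> subspace_of U V \<and> U \<subseteq> W"
proof
  assume U: "subspace_of U (V\<lparr>carrier := W\<rparr>)"
  show "subspace_of U V \<and> U \<subseteq> W"
    using subspace_carrier[OF U] subspace_zero[OF U] subspace_plus[OF U] subspace_smult[OF U]
      subspace_carrier[OF W]
    by (auto intro!: subspaceI[OF V])
next
  assume U: "subspace_of U V \<and> U \<subseteq> W"
  then have U1: "subspace_of U V" by blast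
  show "subspace_of U (V\<lparr>carrier := W\<rparr>)"
    using subspace_zero[OF U1] subspace_plus[OF U1] subspace_smult[OF U1] U
    by (auto intro!: subspaceI[OF vectorspace_subspace[OF V W]])
qed

subsection \<open>Spans\<close>

lemma subspace_vspan:
  fixes V :: "('k::field, 'v, 'm) module_scheme"
  assumes V: "vectorspace V" and S: "S \<subseteq> carrier V"
  shows "subspace_of (vspan V S) V"
proof (rule subspaceI[OF V])
  show "vspan V S \<subseteq> carrier V"
    unfolding vspan_def using subspace_self[OF V] S by blast
  show "\<zero>\<^bsub>V\<^esub> \<in> vspan V S"
    unfolding vspan_def by (blast dest: subspace_zero)
  show "x \<oplus>\<^bsub>V\<^esub> y \<in> vspan V S" if "x \<in> vspan V S" "y \<in> vspan V S" for x y
    using that unfolding vspan_def by (blast intro: subspace_plus)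
  show "a \<odot>\<^bsub>V\<^esub> x \<in> vspan V S" if "x \<in> vspan V S" for a x
    using that unfolding vspan_def by (blast intro: subspace_smult)
qed

lemma vspan_superset: "S \<subseteq> vspan V S"
  unfolding vspan_def by blast

lemma vspan_minimal: "subspace_of W V \<Longrightarrow> S \<subseteq> W \<Longrightarrow> vspan V S \<subseteq> W"
  unfolding vspan_def by blast

lemma vspan_mono: "S \<subseteq> T \<Longrightarrow> vspan V S \<subseteq> vspan V T"
  unfolding vspan_def by blast

lemma vspan_cong:
  fixes V :: "('k::field, 'v, 'm) module_scheme" and V' :: "('k, 'v, 'n) module_scheme"
  assumes "carrier V = carrier V'" "add V = add V'" "zero V = zero V'" "smult V = smult V'"
  shows "vspan V S = vspan V' S"
  unfolding vspan_def subspace_cong[OF assms] ..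

lemma vspan_in_subspace:
  assumes V: "vectorspace V" and W: "subspace_of W V" and S: "S \<subseteq> W"
  shows "vspan (V\<lparr>carrier := W\<rparr>) S = vspan V S"
proof -
  have "S \<subseteq> carrier V" using S subspace_carrier[OF W] by blast
  then have 1: "subspace_of (vspan V S) (V\<lparr>carrier := W\<rparr>)"
    unfolding subspace_of_subspace[OF V W] using subspace_vspan[OF V] vspan_minimal[OF W S] by simp
  have "S \<subseteq> carrier (V\<lparr>carrier := W\<rparr>)" using S by simp
  then have 2: "subspace_of (vspan (V\<lparr>carrier := W\<rparr>) S) V"
    using subspace_vspan[OF vectorspace_subspace[OF V W]] subspace_of_subspace[OF V W] by blast
  show ?thesis
    using vspan_minimal[OF 1 vspan_superset] vspan_minimal[OF 2 vspan_superset] by (rule subset_antisym)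
qed

subsection \<open>Linear maps and functionals\<close>

definition linear_map ::
  "('k::field, 'v, 'm) module_scheme \<Rightarrow> ('k, 'w, 'n) module_scheme \<Rightarrow> ('v \<Rightarrow> 'w) \<Rightarrow> bool" where
  "linear_map V W f \<longleftrightarrow> (\<forall>u\<in>carrier V. f u \<in> carrier W) \<and>
     (\<forall>u\<in>carrier V. \<forall>v\<in>carrier V. f (u \<oplus>\<^bsub>V\<^esub> v) = f u \<oplus>\<^bsub>W\<^esub> f v) \<and>
     (\<forall>a. \<forall>v\<in>carrier V. f (a \<odot>\<^bsub>V\<^esub> v) = a \<odot>\<^bsub>W\<^esub> f v)"

definition linear_functional :: "('k::field, 'v, 'm) module_scheme \<Rightarrow> ('v \<Rightarrow> 'k) \<Rightarrow> bool" where
  "linear_functional V f \<longleftrightarrow>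
     (\<forall>u\<in>carrier V. \<forall>v\<in>carrier V. f (u \<oplus>\<^bsub>V\<^esub> v) = f u + f v) \<and>
     (\<forall>a. \<forall>v\<in>carrier V. f (a \<odot>\<^bsub>V\<^esub> v) = a * f v)"

lemma
  assumes "linear_functional V f"
  shows functional_add: "u \<in> carrier V \<Longrightarrow> v \<in> carrier V \<Longrightarrow> f (u \<oplus>\<^bsub>V\<^esub> v) = f u + f v"
    and functional_smult: "v \<in> carrier V \<Longrightarrow> f (a \<odot>\<^bsub>V\<^esub> v) = a * f v"
  using assms by (auto simp: linear_functional_def)

lemma functional_zero: "vectorspace V \<Longrightarrow> linear_functional V f \<Longrightarrow> f \<zero>\<^bsub>V\<^esub> = 0"
  using functional_smult[of V f "\<zero>\<^bsub>V\<^esub>" 0] by (simp add: vs_zero_closed vs_smult_zero_right)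

lemma linear_map_zero:
  assumes "vectorspace V" "vectorspace W" "linear_map V W f"
  shows "f \<zero>\<^bsub>V\<^esub> = \<zero>\<^bsub>W\<^esub>"
proof -
  have z: "\<zero>\<^bsub>V\<^esub> \<in> carrier V" using vs_zero_closed[OF assms(1)] .
  then have "f (0 \<odot>\<^bsub>V\<^esub> \<zero>\<^bsub>V\<^esub>) = 0 \<odot>\<^bsub>W\<^esub> f \<zero>\<^bsub>V\<^esub>" "f \<zero>\<^bsub>V\<^esub> \<in> carrier W"
    using assms(3) unfolding linear_map_def by blast+
  then show ?thesis
    using vs_smult_zero[OF assms(2)] vs_smult_zero_right[OF assms(1)] by simp
qed

lemma subspace_vimage:
  assumes V: "vectorspace V" and W: "vectorspace W" and f: "linear_map V W f" and U: "subspace_of U W"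
  shows "subspace_of {v \<in> carrier V. f v \<in> U} V"
proof (rule subspaceI[OF V])
  show "\<zero>\<^bsub>V\<^esub> \<in> {v \<in> carrier V. f v \<in> U}"
    using linear_map_zero[OF V W f] subspace_zero[OF U] subspace_zero[OF subspace_self[OF V]] by simp
qed (use f subspace_plus[OF U] subspace_smult[OF U] subspace_plus[OF subspace_self[OF V]]
      subspace_smult[OF subspace_self[OF V]] in \<open>auto simp: linear_map_def\<close>)

lemma subspace_kernel:
  assumes V: "vectorspace V" and f: "linear_functional V f" and U: "subspace_of U V"
  shows "subspace_of {v \<in> U. f v = 0} V"
  by (rule subspaceI[OF V])
    (use functional_add[OF f] functional_smult[OF f] subspace_plus[OF U] subspace_smult[OF U]
      subspace_zero[OF U] subspace_carrier[OF U] functional_zero[OF V f] in \<open>auto simp: subset_iff\<close>)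

text \<open>
  Linear maps need only be checked on a spanning set: the vectors that \<open>f\<close> sends into \<open>U\<close> form a
  subspace.
\<close>

lemma linear_image_in_span:
  assumes V: "vectorspace V" and W: "vectorspace W" and f: "linear_map V W f"
    and v: "v \<in> vspan V S" and S: "\<And>s. s \<in> S \<Longrightarrow> f s \<in> U" "S \<subseteq> carrier V" and U: "subspace_of U W"
  shows "f v \<in> U"
  using vspan_minimal[OF subspace_vimage[OF V W f U], of S] v S by auto

lemma vectorspace_surj_image:
  fixes V :: "('k::field, 'v, 'm) module_scheme" and W :: "('k, 'w, 'n) module_scheme"
  assumes V: "vectorspace V"
    and f: "f ` carrier V = carrier W" "f \<zero>\<^bsub>V\<^esub> = \<zero>\<^bsub>W\<^esub>"
      "\<And>x y. x \<in> carrier V \<Longrightarrow> y \<in> carrier V \<Longrightarrow> f (x \<oplus>\<^bsub>V\<^esub> y) = f x \<oplus>\<^bsub>W\<^esub> f y"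
      "\<And>a x. x \<in> carrier V \<Longrightarrow> f (a \<odot>\<^bsub>V\<^esub> x) = a \<odot>\<^bsub>W\<^esub> f x"
  shows "vectorspace W"
proof -
  interpret V: abelian_group V using vs_abelian_group[OF V] .
  have lift: "(\<forall>x\<in>carrier W. P x) \<longleftrightarrow> (\<forall>x\<in>carrier V. P (f x))" for P
    unfolding f(1)[symmetric] by simp
  note s = f(3,4)[symmetric] f(2)[symmetric] vs_smult_closed[OF V]
  have fW: "x \<in> carrier V \<Longrightarrow> f x \<in> carrier W" for x using f(1) by blast
  have "\<forall>x\<in>carrier W. \<forall>y\<in>carrier W. x \<oplus>\<^bsub>W\<^esub> y \<in> carrier W"
    unfolding lift by (simp add: s fW)
  moreover have "\<forall>x\<in>carrier W. \<forall>y\<in>carrier W. \<forall>z\<in>carrier W.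
      (x \<oplus>\<^bsub>W\<^esub> y) \<oplus>\<^bsub>W\<^esub> z = x \<oplus>\<^bsub>W\<^esub> (y \<oplus>\<^bsub>W\<^esub> z)"
    unfolding lift by (simp add: s V.a_assoc)
  moreover have "\<forall>x\<in>carrier W. \<forall>y\<in>carrier W. x \<oplus>\<^bsub>W\<^esub> y = y \<oplus>\<^bsub>W\<^esub> x"
    unfolding lift by (simp add: s V.a_comm)
  moreover have "\<forall>x\<in>carrier W. \<zero>\<^bsub>W\<^esub> \<oplus>\<^bsub>W\<^esub> x = x"
    unfolding lift by (simp add: s)
  moreover have "\<forall>x\<in>carrier W. \<forall>a. a \<odot>\<^bsub>W\<^esub> x \<in> carrier W"
    unfolding lift by (simp add: s fW)
  moreover have "\<forall>x\<in>carrier W. \<forall>a b. (a + b) \<odot>\<^bsub>W\<^esub> x = a \<odot>\<^bsub>W\<^esub> x \<oplus>\<^bsub>W\<^esub> b \<odot>\<^bsub>W\<^esub> x"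
    unfolding lift by (simp add: s vs_smult_add_left[OF V])
  moreover have "\<forall>x\<in>carrier W. \<forall>y\<in>carrier W. \<forall>a. a \<odot>\<^bsub>W\<^esub> (x \<oplus>\<^bsub>W\<^esub> y) = a \<odot>\<^bsub>W\<^esub> x \<oplus>\<^bsub>W\<^esub> a \<odot>\<^bsub>W\<^esub> y"
    unfolding lift by (simp add: s vs_smult_add_right[OF V])
  moreover have "\<forall>x\<in>carrier W. \<forall>a b. (a * b) \<odot>\<^bsub>W\<^esub> x = a \<odot>\<^bsub>W\<^esub> (b \<odot>\<^bsub>W\<^esub> x)"
    unfolding lift by (simp add: s vs_smult_assoc[OF V])
  moreover have "\<forall>x\<in>carrier W. (1::'k) \<odot>\<^bsub>W\<^esub> x = x"
    unfolding lift by (simp add: s vs_smult_one[OF V])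
  moreover have "\<forall>x\<in>carrier W. (0::'k) \<odot>\<^bsub>W\<^esub> x = \<zero>\<^bsub>W\<^esub>"
    unfolding lift by (simp add: s vs_smult_zero[OF V])
  moreover have "\<zero>\<^bsub>W\<^esub> \<in> carrier W" using fW[of "\<zero>\<^bsub>V\<^esub>"] f(2) by simp
  ultimately show ?thesis by (intro vectorspaceI) simp_all
qed

subsection \<open>Finitely supported functions as a vector space\<close>

text \<open>
  The finitely supported functions form a vector space on a whole type, where the exchange lemma and
  the extension of independent sets to bases can be used directly. Dimensions are reduced to this
  case, and rational chains are such functions.
\<close>

abbreviation pscale :: "'k \<Rightarrow> ('s \<Rightarrow>\<^sub>0 'k::field) \<Rightarrow> 's \<Rightarrow>\<^sub>0 'k" where
  "pscale c \<equiv> Poly_Mapping.map ((*) c)"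

lemma lookup_pscale [simp]: "Poly_Mapping.lookup (pscale c f) x = c * Poly_Mapping.lookup f x"
  by (transfer) (auto simp: when_def)

lemma pscale_single [simp]: "pscale c (Poly_Mapping.single x a) = Poly_Mapping.single x (c * a)"
  by (rule poly_mapping_eqI) (simp add: lookup_single when_def)

global_interpretation pm: vector_space "pscale :: 'k \<Rightarrow> ('s \<Rightarrow>\<^sub>0 'k::field) \<Rightarrow> 's \<Rightarrow>\<^sub>0 'k"
  by unfold_locales (auto intro!: poly_mapping_eqI simp: lookup_add algebra_simps)

lemma poly_mapping_sum_single:
  assumes "finite S" "Poly_Mapping.keys f \<subseteq> S"
  shows "f = (\<Sum>x\<in>S. Poly_Mapping.single x (Poly_Mapping.lookup f x))"
proof (rule poly_mapping_eqI)
  fix y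
  show "Poly_Mapping.lookup f y
      = Poly_Mapping.lookup (\<Sum>x\<in>S. Poly_Mapping.single x (Poly_Mapping.lookup f x)) y"
    using assms by (auto simp: lookup_sum lookup_single when_def in_keys_iff)
qed

subsection \<open>Coordinate systems and dimension\<close>

text \<open>
  A finite basis together with its dual basis. Bases of quotients are hard to recognize
  directly, whereas linear independence is immediate once dual functionals are available, and those
  can be built from universal properties.
\<close>

definition coordinate_system ::
  "('k::field, 'v, 'm) module_scheme \<Rightarrow> 'i set \<Rightarrow> ('i \<Rightarrow> 'v) \<Rightarrow> ('i \<Rightarrow> 'v \<Rightarrow> 'k) \<Rightarrow> bool" where
  "coordinate_system V I e c \<longleftrightarrow> vectorspace V \<and> finite I \<and>
     (\<forall>i\<in>I. e i \<in> carrier V \<and> linear_functional V (c i)) \<and>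
     (\<forall>i\<in>I. \<forall>j\<in>I. c i (e j) = (if i = j then 1 else 0)) \<and> vspan V (e ` I) = carrier V"

lemma
  assumes "coordinate_system V I e c"
  shows coords_vectorspace: "vectorspace V" and coords_finite: "finite I"
    and coords_carrier: "i \<in> I \<Longrightarrow> e i \<in> carrier V"
    and coords_functional: "i \<in> I \<Longrightarrow> linear_functional V (c i)"
    and coords_dual: "i \<in> I \<Longrightarrow> j \<in> I \<Longrightarrow> c i (e j) = (if i = j then 1 else 0)"
    and coords_span: "vspan V (e ` I) = carrier V"
  using assms unfolding coordinate_system_def by blast+

text \<open>
  The vectors that equal their own expansion in the coordinates form a subspace containing all \<open>e i\<close>,
  hence are all of \<open>V\<close>. Applied with various subspaces \<open>W\<close>, this replaces explicit
  manipulations of linear combinations.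
\<close>

lemma coords_expansion_in:
  fixes V :: "('k::field, 'v, 'm) module_scheme"
  assumes cs: "coordinate_system V I e c" and v: "v \<in> carrier V"
    and W: "subspace_of W V" and e: "\<And>i. i \<in> I \<Longrightarrow> c i v \<noteq> 0 \<Longrightarrow> e i \<in> W"
  shows "v \<in> W"
proof -
  note V = coords_vectorspace[OF cs] and I = coords_finite[OF cs]
  interpret V: abelian_group V using vs_abelian_group[OF V] .
  interpret M: Module.module "ring_of_type_algebra :: 'k ring" V by (rule V)
  have sm: "c i x \<odot>\<^bsub>V\<^esub> e i \<in> carrier V" if "i \<in> I" for i x
    using vs_smult_closed[OF V] coords_carrier[OF cs that] .
  let ?E = "{v \<in> carrier V. v = finsum V (\<lambda>i. c i v \<odot>\<^bsub>V\<^esub> e i) I}"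
  have "subspace_of ?E V"
  proof (rule subspaceI[OF V])
    have "finsum V (\<lambda>i. c i \<zero>\<^bsub>V\<^esub> \<odot>\<^bsub>V\<^esub> e i) I = finsum V (\<lambda>i. \<zero>\<^bsub>V\<^esub>) I"
      by (intro V.finsum_cong')
        (auto simp: functional_zero[OF V coords_functional[OF cs]] vs_smult_zero[OF V] coords_carrier[OF cs])
    then show "\<zero>\<^bsub>V\<^esub> \<in> ?E" by simp
    show "x \<oplus>\<^bsub>V\<^esub> y \<in> ?E" if "x \<in> ?E" "y \<in> ?E" for x y
    proof -
      have xy: "x \<in> carrier V" "y \<in> carrier V" using that by auto
      have "finsum V (\<lambda>i. c i (x \<oplus>\<^bsub>V\<^esub> y) \<odot>\<^bsub>V\<^esub> e i) I
          = finsum V (\<lambda>i. c i x \<odot>\<^bsub>V\<^esub> e i \<oplus>\<^bsub>V\<^esub> c i y \<odot>\<^bsub>V\<^esub> e i) I"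
        using sm xy by (intro V.finsum_cong')
          (auto simp: functional_add[OF coords_functional[OF cs]] vs_smult_add_left[OF V] coords_carrier[OF cs])
      also have "\<dots> = finsum V (\<lambda>i. c i x \<odot>\<^bsub>V\<^esub> e i) I \<oplus>\<^bsub>V\<^esub> finsum V (\<lambda>i. c i y \<odot>\<^bsub>V\<^esub> e i) I"
        using sm by (intro V.finsum_addf) auto
      finally show ?thesis using that by simp
    qed
    show "a \<odot>\<^bsub>V\<^esub> x \<in> ?E" if "x \<in> ?E" for a x
    proof -
      have x: "x \<in> carrier V" using that by auto
      have "finsum V (\<lambda>i. c i (a \<odot>\<^bsub>V\<^esub> x) \<odot>\<^bsub>V\<^esub> e i) I = finsum V (\<lambda>i. a \<odot>\<^bsub>V\<^esub> (c i x \<odot>\<^bsub>V\<^esub> e i)) I"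
        using sm x by (intro V.finsum_cong') (auto simp: functional_smult[OF coords_functional[OF cs]]
          vs_smult_assoc[OF V] coords_carrier[OF cs] intro!: vs_smult_closed[OF V])
      also have "\<dots> = a \<odot>\<^bsub>V\<^esub> finsum V (\<lambda>i. c i x \<odot>\<^bsub>V\<^esub> e i) I"
        using sm I by (intro M.finsum_smult_ldistr[symmetric]) auto
      finally show ?thesis using that x vs_smult_closed[OF V] by simp
    qed
  qed auto
  moreover have "e j \<in> ?E" if j: "j \<in> I" for j
  proof -
    have "finsum V (\<lambda>i. c i (e j) \<odot>\<^bsub>V\<^esub> e i) I = finsum V (\<lambda>i. if j = i then e i else \<zero>\<^bsub>V\<^esub>) I"
      using j by (intro V.finsum_cong') (auto simp: coords_dual[OF cs] vs_smult_one[OF V] vs_smult_zero[OF V]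
          coords_carrier[OF cs])
    also have "\<dots> = e j" using j I coords_carrier[OF cs] by (intro V.finsum_singleton) auto
    finally show ?thesis using coords_carrier[OF cs j] by simp
  qed
  ultimately have "carrier V \<subseteq> ?E" using vspan_minimal[of ?E V "e ` I"] coords_span[OF cs] by auto
  with v have v_eq: "v = finsum V (\<lambda>i. c i v \<odot>\<^bsub>V\<^esub> e i) I" by auto
  have "finsum V (\<lambda>i. c i v \<odot>\<^bsub>V\<^esub> e i) J \<in> W" if "finite J" "J \<subseteq> I" for J
    using that
  proof (induction J rule: finite_induct)
    case (insert j J)
    have "c j v \<odot>\<^bsub>V\<^esub> e j \<in> W"
      using e[of j] insert.prems vs_smult_zero[OF V] coords_carrier[OF cs, of j]
        subspace_smult[OF W] subspace_zero[OF W] by (cases "c j v = 0") auto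
    then show ?case using insert sm by (subst V.finsum_insert) (auto intro: subspace_plus[OF W])
  qed (simp add: subspace_zero[OF W])
  from this[OF I subset_refl] show ?thesis unfolding v_eq[symmetric] .
qed

lemma coords_eqI:
  assumes cs: "coordinate_system V I e c" and uv: "u \<in> carrier V" "v \<in> carrier V"
    and eq: "\<And>i. i \<in> I \<Longrightarrow> c i u = c i v"
  shows "u = v"
proof -
  note V = coords_vectorspace[OF cs]
  interpret V: abelian_group V using vs_abelian_group[OF V] .
  have m: "(-1) \<odot>\<^bsub>V\<^esub> v \<in> carrier V" using vs_smult_closed[OF V] uv by blast
  have "u \<oplus>\<^bsub>V\<^esub> (-1) \<odot>\<^bsub>V\<^esub> v \<in> {\<zero>\<^bsub>V\<^esub>}"
  proof (rule coords_expansion_in[OF cs])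
    show "subspace_of {\<zero>\<^bsub>V\<^esub>} V"
      by (rule subspaceI[OF V]) (auto simp: vs_smult_zero_right[OF V])
    show "e i \<in> {\<zero>\<^bsub>V\<^esub>}" if "i \<in> I" "c i (u \<oplus>\<^bsub>V\<^esub> (-1) \<odot>\<^bsub>V\<^esub> v) \<noteq> 0" for i
      using that eq uv m functional_add[OF coords_functional[OF cs]]
        functional_smult[OF coords_functional[OF cs]] by simp
  qed (use uv m in simp)
  then have "u \<oplus>\<^bsub>V\<^esub> \<ominus>\<^bsub>V\<^esub> v = \<zero>\<^bsub>V\<^esub>" using vs_minus[OF V] uv by simp
  then show ?thesis using uv by (metis V.minus_equality V.minus_minus V.a_inv_closed)
qed

text \<open>
  Taking coordinates embeds \<open>V\<close> into the finitely supported functions and carries spans to spans, so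
  that the invariance of the size of a basis can be transported from there.
\<close>

lemma vdim_coordinate_system:
  assumes cs: "coordinate_system (V :: ('k::field, 'v, 'm) module_scheme) I e c"
  shows "vdim V = card I"
proof -
  note V = coords_vectorspace[OF cs] and I = coords_finite[OF cs]
  define \<Phi> where "\<Phi> v = (\<Sum>i\<in>I. Poly_Mapping.single i (c i v))" for v
  have look: "Poly_Mapping.lookup (\<Phi> v) j = (if j \<in> I then c j v else 0)" for v j
    using I by (simp add: \<Phi>_def lookup_sum lookup_single when_def)
  have inj: "inj_on \<Phi> (carrier V)"
  proof (rule inj_onI)
    fix u v assume uv: "u \<in> carrier V" "v \<in> carrier V" and eq: "\<Phi> u = \<Phi> v"
    have "c j u = c j v" if "j \<in> I" for j
      using arg_cong[OF eq, of "\<lambda>f. Poly_Mapping.lookup f j"] that by (simp add: look)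
    then show "u = v" using coords_eqI[OF cs uv] by blast
  qed
  have add: "\<Phi> (u \<oplus>\<^bsub>V\<^esub> v) = \<Phi> u + \<Phi> v" if "u \<in> carrier V" "v \<in> carrier V" for u v
    using that functional_add[OF coords_functional[OF cs]]
    by (intro poly_mapping_eqI) (simp add: look lookup_add)
  have smult: "\<Phi> (a \<odot>\<^bsub>V\<^esub> v) = pscale a (\<Phi> v)" if "v \<in> carrier V" for a v
    using that functional_smult[OF coords_functional[OF cs]]
    by (intro poly_mapping_eqI) (simp add: look)
  have zero: "\<Phi> \<zero>\<^bsub>V\<^esub> = 0"
    using functional_zero[OF V coords_functional[OF cs]]
    by (intro poly_mapping_eqI) (simp add: look)
  have span: "\<Phi> ` vspan V S = pm.span (\<Phi> ` S)" if S: "S \<subseteq> carrier V" for S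
  proof
    have "subspace_of {v \<in> carrier V. \<Phi> v \<in> pm.span (\<Phi> ` S)} V"
      using vs_add_closed[OF V] vs_smult_closed[OF V] vs_zero_closed[OF V]
      by (intro subspaceI[OF V]) (auto simp: add smult zero pm.span_zero intro: pm.span_add pm.span_scale)
    from vspan_minimal[OF this, of S] show "\<Phi> ` vspan V S \<subseteq> pm.span (\<Phi> ` S)"
      using S by (auto intro: pm.span_base)
    have W: "subspace_of (vspan V S) V" using subspace_vspan[OF V S] .
    have "pm.subspace (\<Phi> ` vspan V S)"
    proof (rule pm.subspaceI)
      show "0 \<in> \<Phi> ` vspan V S" using zero subspace_zero[OF W] by force
      show "x + y \<in> \<Phi> ` vspan V S" if "x \<in> \<Phi> ` vspan V S" "y \<in> \<Phi> ` vspan V S" for x y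
      proof -
        from that obtain u v where "u \<in> vspan V S" "v \<in> vspan V S" "x = \<Phi> u" "y = \<Phi> v"
          by blast
        then have "x + y = \<Phi> (u \<oplus>\<^bsub>V\<^esub> v)" "u \<oplus>\<^bsub>V\<^esub> v \<in> vspan V S"
          using add[of u v] subspace_plus[OF W] subspace_carrier[OF W] by (auto simp: subset_iff)
        then show ?thesis by blast
      qed
      show "pscale a x \<in> \<Phi> ` vspan V S" if "x \<in> \<Phi> ` vspan V S" for a x
      proof -
        from that obtain u where "u \<in> vspan V S" "x = \<Phi> u" by blast
        then have "pscale a x = \<Phi> (a \<odot>\<^bsub>V\<^esub> u)" "a \<odot>\<^bsub>V\<^esub> u \<in> vspan V S"
          using smult[of u a] subspace_smult[OF W] subspace_carrier[OF W] by (auto simp: subset_iff)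
        then show ?thesis by blast
      qed
    qed
    then show "pm.span (\<Phi> ` S) \<subseteq> \<Phi> ` vspan V S"
      using vspan_superset[of S V] by (intro pm.span_minimal) auto
  qed
  have indep: "pm.independent (\<Phi> ` B)" and card: "card (\<Phi> ` B) = card B"
    and spans: "pm.span (\<Phi> ` B) = \<Phi> ` carrier V" if B: "vbasis V B" for B
  proof -
    have B1: "B \<subseteq> carrier V" and B2: "vspan V B = carrier V"
      and B3: "\<And>b. b \<in> B \<Longrightarrow> b \<notin> vspan V (B - {b})"
      using B unfolding vbasis_def by auto
    show "card (\<Phi> ` B) = card B" using inj B1 by (intro card_image) (rule inj_on_subset)
    show "pm.span (\<Phi> ` B) = \<Phi> ` carrier V" using span[OF B1] B2 by simp
    show "pm.independent (\<Phi> ` B)"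
      unfolding pm.dependent_def
    proof clarify
      fix b assume b: "b \<in> B" and mem: "\<Phi> b \<in> pm.span (\<Phi> ` B - {\<Phi> b})"
      have "\<Phi> ` B - {\<Phi> b} = \<Phi> ` (B - {b})"
        using inj_on_image_set_diff[OF inj, of B "{b}"] B1 b by auto
      with mem have "\<Phi> b \<in> \<Phi> ` vspan V (B - {b})" using span[of "B - {b}"] B1 by auto
      moreover have "vspan V (B - {b}) \<subseteq> carrier V"
        using subspace_carrier[OF subspace_vspan[OF V, of "B - {b}"]] B1 by blast
      ultimately have "b \<in> vspan V (B - {b})" using inj B1 b by (auto dest: inj_onD)
      with B3[OF b] show False ..
    qed
  qed
  have E: "vbasis V (e ` I)"
    unfolding vbasis_def
  proof (intro conjI ballI)
    show "e ` I \<subseteq> carrier V" using coords_carrier[OF cs] by blast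
    show "vspan V (e ` I) = carrier V" using coords_span[OF cs] .
    fix b assume "b \<in> e ` I"
    then obtain i where i: "i \<in> I" "b = e i" by blast
    have "vspan V (e ` I - {b}) \<subseteq> {v \<in> carrier V. c i v = 0}"
    proof (rule vspan_minimal)
      show "subspace_of {v \<in> carrier V. c i v = 0} V"
        using subspace_kernel[OF V coords_functional[OF cs i(1)] subspace_self[OF V]] .
      show "e ` I - {b} \<subseteq> {v \<in> carrier V. c i v = 0}"
        using i coords_dual[OF cs] coords_carrier[OF cs] by auto
    qed
    then show "b \<notin> vspan V (e ` I - {b})" using coords_dual[OF cs i(1) i(1)] i by auto
  qed
  \<comment> \<open>The dimension is defined by an arbitrary basis; it has as many elements as the given one.\<close>
  define B where "B = (SOME B. vbasis V B)"
  have B: "vbasis V B" unfolding B_def using E by (rule someI)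
  obtain f where "bij_betw f (\<Phi> ` B) (\<Phi> ` e ` I)"
    using pm.bij_if_span_eq_span_bases[OF indep[OF B] indep[OF E]] spans[OF B] spans[OF E] by auto
  then have "card (\<Phi> ` B) = card (\<Phi> ` e ` I)" by (rule bij_betw_same_card)
  then have "card B = card (e ` I)" using card[OF B] card[OF E] by simp
  moreover have "inj_on e I" using coords_dual[OF cs] by (intro inj_onI) (metis zero_neq_one)
  ultimately show ?thesis by (simp add: vdim_def B_def card_image)
qed

text \<open>
  A space on which finitely many functionals separate points is finite-dimensional. Induction on the
  functionals: the kernel \<open>K\<close> of one of them has a coordinate system by induction, and if \<open>K\<close> is not
  everything it is complemented by one further vector \<open>v0\<close>.
\<close>

lemma coordinate_system_exists:
  fixes V :: "('k::field, 'v, 'm) module_scheme" and F :: "'s set"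
  assumes F: "finite F" and V: "vectorspace V"
    and \<phi>: "\<And>s. s \<in> F \<Longrightarrow> linear_functional V (\<phi> s)"
    and inj: "\<And>v. v \<in> carrier V \<Longrightarrow> (\<And>s. s \<in> F \<Longrightarrow> \<phi> s v = 0) \<Longrightarrow> v = \<zero>\<^bsub>V\<^esub>"
  shows "\<exists>n e c. coordinate_system V {..<n::nat} e c"
  using F V \<phi> inj
proof (induction F arbitrary: V rule: finite_induct)
  case empty
  have "v = \<zero>\<^bsub>V\<^esub>" if "v \<in> carrier V" for v using empty.prems(3)[OF that] by blast
  then have "carrier V = {\<zero>\<^bsub>V\<^esub>}" using vs_zero_closed[OF empty.prems(1)] by blast
  moreover have W: "subspace_of (vspan V {}) V" using subspace_vspan[OF empty.prems(1)] by simp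
  ultimately have "vspan V {} = carrier V"
    using subspace_carrier[OF W] subspace_zero[OF W] by (metis empty_subsetI insert_subset subset_antisym)
  then have "coordinate_system V {..<0::nat} undefined undefined"
    using empty.prems(1) by (simp add: coordinate_system_def)
  then show ?case by blast
next
  case (insert s F V)
  note V = insert.prems(1) and \<phi> = insert.prems(2)
  note fs = functional_add[OF \<phi>[of s]] functional_smult[OF \<phi>[of s]]
  define K where "K = {v \<in> carrier V. \<phi> s v = 0}"
  have K: "subspace_of K V"
    unfolding K_def using subspace_kernel[OF V \<phi> subspace_self[OF V]] by blast
  have VK: "vectorspace (V\<lparr>carrier := K\<rparr>)" using vectorspace_subspace[OF V K] .
  have "\<exists>n e c. coordinate_system (V\<lparr>carrier := K\<rparr>) {..<n::nat} e c"
  proof (rule insert.IH[OF VK])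
    show "linear_functional (V\<lparr>carrier := K\<rparr>) (\<phi> t)" if "t \<in> F" for t
      using \<phi>[of t] that unfolding linear_functional_def K_def by auto
    show "v = \<zero>\<^bsub>V\<lparr>carrier := K\<rparr>\<^esub>"
      if "v \<in> carrier (V\<lparr>carrier := K\<rparr>)" "\<And>t. t \<in> F \<Longrightarrow> \<phi> t v = 0" for v
    proof -
      have "v = \<zero>\<^bsub>V\<^esub>" by (rule insert.prems(3)) (use that in \<open>auto simp: K_def\<close>)
      then show ?thesis by simp
    qed
  qed
  then obtain n e c where cs: "coordinate_system (V\<lparr>carrier := K\<rparr>) {..<n::nat} e c" by blast
  show ?case
  proof (cases "K = carrier V")
    case True
    then show ?thesis using cs by auto
  next
    case False
    then obtain w where w: "w \<in> carrier V" "\<phi> s w \<noteq> 0" unfolding K_def by blast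
    define v0 where "v0 = inverse (\<phi> s w) \<odot>\<^bsub>V\<^esub> w"
    have v0: "v0 \<in> carrier V" "\<phi> s v0 = 1"
      using w fs by (auto simp: v0_def vs_smult_closed[OF V])
    interpret V: abelian_group V using vs_abelian_group[OF V] .
    \<comment> \<open>The projection onto the kernel along \<open>v0\<close> extends the coordinates from the kernel to \<open>V\<close>.\<close>
    define pr where "pr v = v \<oplus>\<^bsub>V\<^esub> (- \<phi> s v) \<odot>\<^bsub>V\<^esub> v0" for v
    have pr_K: "pr v \<in> K" if "v \<in> carrier V" for v
      using that v0 fs by (auto simp: K_def pr_def vs_smult_closed[OF V])
    have pr_add: "pr (u \<oplus>\<^bsub>V\<^esub> v) = pr u \<oplus>\<^bsub>V\<^esub> pr v" if "u \<in> carrier V" "v \<in> carrier V" for u v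
    proof -
      have "(- \<phi> s (u \<oplus>\<^bsub>V\<^esub> v)) \<odot>\<^bsub>V\<^esub> v0 = (- \<phi> s u) \<odot>\<^bsub>V\<^esub> v0 \<oplus>\<^bsub>V\<^esub> (- \<phi> s v) \<odot>\<^bsub>V\<^esub> v0"
        using vs_smult_add_left[OF V v0(1), of "- \<phi> s u" "- \<phi> s v"] fs(1) that by simp
      then show ?thesis
        using that v0 vs_smult_closed[OF V] unfolding pr_def by (simp add: V.a_ac)
    qed
    have pr_smult: "pr (a \<odot>\<^bsub>V\<^esub> v) = a \<odot>\<^bsub>V\<^esub> pr v" if "v \<in> carrier V" for a v
      using that v0 fs(2) vs_smult_assoc[OF V v0(1), of a "- \<phi> s v"]
      by (simp add: pr_def vs_smult_add_right[OF V] vs_smult_closed[OF V])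
    have pr_id: "pr v = v" if "v \<in> K" for v
      using that v0 vs_smult_zero[OF V v0(1)] by (simp add: pr_def K_def)
    have pr_v0: "pr v0 = \<zero>\<^bsub>V\<^esub>"
      using V.r_neg[OF v0(1)] v0(2) by (simp add: pr_def vs_minus[OF V v0(1), symmetric])
    have pr_inv: "v = pr v \<oplus>\<^bsub>V\<^esub> \<phi> s v \<odot>\<^bsub>V\<^esub> v0" if "v \<in> carrier V" for v
    proof -
      have "pr v \<oplus>\<^bsub>V\<^esub> \<phi> s v \<odot>\<^bsub>V\<^esub> v0 = v \<oplus>\<^bsub>V\<^esub> ((- \<phi> s v) \<odot>\<^bsub>V\<^esub> v0 \<oplus>\<^bsub>V\<^esub> \<phi> s v \<odot>\<^bsub>V\<^esub> v0)"
        using that v0 vs_smult_closed[OF V] by (simp add: pr_def V.a_assoc)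
      also have "(- \<phi> s v) \<odot>\<^bsub>V\<^esub> v0 \<oplus>\<^bsub>V\<^esub> \<phi> s v \<odot>\<^bsub>V\<^esub> v0 = \<zero>\<^bsub>V\<^esub>"
        using vs_smult_add_left[OF V v0(1), of "- \<phi> s v" "\<phi> s v"] vs_smult_zero[OF V v0(1)] by simp
      finally show ?thesis using that by simp
    qed
    have eK: "e i \<in> K" if "i < n" for i using coords_carrier[OF cs] that by simp
    let ?e = "e(n := v0)" and ?c = "\<lambda>i. if i = n then \<phi> s else c i \<circ> pr"
    have carr: "K \<subseteq> carrier V" unfolding K_def by blast
    have "coordinate_system V {..<Suc n} ?e ?c"
      unfolding coordinate_system_def
    proof (intro conjI ballI)
      show "vectorspace V" by (rule V)
      show "?e i \<in> carrier V" if "i \<in> {..<Suc n}" for i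
        using that eK carr v0 by (auto simp: less_Suc_eq)
      show "linear_functional V (?c i)" if "i \<in> {..<Suc n}" for i
      proof (cases "i = n")
        case False
        then have f: "linear_functional (V\<lparr>carrier := K\<rparr>) (c i)" using coords_functional[OF cs] that by simp
        show ?thesis
          using False functional_add[OF f] functional_smult[OF f] pr_K
          by (auto simp: linear_functional_def pr_add pr_smult)
      qed (use \<phi> in simp)
      show "?c i (?e j) = (if i = j then 1 else 0)" if "i \<in> {..<Suc n}" "j \<in> {..<Suc n}" for i j
      proof (cases "i = n")
        case True
        then show ?thesis using that eK[of j] v0 by (cases "j = n") (simp_all add: K_def)
      next
        case False
        then have "i < n" using that by simp
        then show ?thesis
          using that coords_dual[OF cs, of i j] pr_id[OF eK[of j]] pr_v0 False
            functional_zero[OF VK coords_functional[OF cs, of i]]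
          by (cases "j = n") simp_all
      qed
      show "vspan V (?e ` {..<Suc n}) = carrier V"
      proof
        have sub: "?e ` {..<Suc n} \<subseteq> carrier V" using eK carr v0 by (auto simp: less_Suc_eq)
        let ?W = "vspan V (?e ` {..<Suc n})"
        have W: "subspace_of ?W V" using subspace_vspan[OF V sub] .
        show "?W \<subseteq> carrier V" using subspace_carrier[OF W] .
        have "K = vspan V (e ` {..<n})"
          using coords_span[OF cs] vspan_in_subspace[OF V K, of "e ` {..<n}"] eK by auto
        also have "\<dots> \<subseteq> ?W" by (rule vspan_mono) (auto simp: image_iff)
        finally have KW: "K \<subseteq> ?W" .
        have "v0 \<in> ?W" using vspan_superset[of "?e ` {..<Suc n}" V] by (auto simp: image_iff)
        then have "pr v \<oplus>\<^bsub>V\<^esub> \<phi> s v \<odot>\<^bsub>V\<^esub> v0 \<in> ?W" if "v \<in> carrier V" for v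
          using subspace_plus[OF W] subspace_smult[OF W] pr_K[OF that] KW by blast
        then show "carrier V \<subseteq> ?W" using pr_inv by force
      qed
    qed simp
    then show ?thesis by blast
  qed
qed

subsection \<open>Operations on coordinate systems\<close>

lemma coordinate_system_subspace:
  fixes V :: "('k::field, 'v, 'm) module_scheme"
  assumes cs: "coordinate_system V I e c" and J: "J \<subseteq> I"
  shows "coordinate_system (V\<lparr>carrier := {v \<in> carrier V. \<forall>i\<in>I - J. c i v = 0}\<rparr>) J e c"
proof -
  note V = coords_vectorspace[OF cs]
  define W where "W = {v \<in> carrier V. \<forall>i\<in>I - J. c i v = 0}"
  have W: "subspace_of W V"
    unfolding W_def
    by (rule subspaceI[OF V])
      (auto simp: functional_add[OF coords_functional[OF cs]] functional_smult[OF coords_functional[OF cs]]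
        functional_zero[OF V coords_functional[OF cs]] vs_add_closed[OF V] vs_smult_closed[OF V] vs_zero_closed[OF V])
  have eW: "e j \<in> W" if "j \<in> J" for j
    using that J coords_carrier[OF cs] coords_dual[OF cs] unfolding W_def by auto
  have carr: "e ` J \<subseteq> carrier V" using eW W_def by auto
  have "W \<subseteq> vspan V (e ` J)"
  proof
    fix v assume v: "v \<in> W"
    show "v \<in> vspan V (e ` J)"
    proof (rule coords_expansion_in[OF cs])
      show "e i \<in> vspan V (e ` J)" if "i \<in> I" "c i v \<noteq> 0" for i
        using that v vspan_superset[of "e ` J" V] unfolding W_def by auto
    qed (use v subspace_vspan[OF V carr] in \<open>auto simp: W_def\<close>)
  qed
  moreover have "vspan V (e ` J) \<subseteq> W" using vspan_minimal[OF W, of "e ` J"] eW by auto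
  ultimately have "vspan (V\<lparr>carrier := W\<rparr>) (e ` J) = W"
    using vspan_in_subspace[OF V W, of "e ` J"] eW by auto
  moreover have "linear_functional (V\<lparr>carrier := W\<rparr>) (c i)" if "i \<in> J" for i
    using coords_functional[OF cs, of i] that J unfolding linear_functional_def W_def by auto
  ultimately have "coordinate_system (V\<lparr>carrier := W\<rparr>) J e c"
    using vectorspace_subspace[OF V W] eW J finite_subset[OF J coords_finite[OF cs]]
      coords_dual[OF cs, OF subsetD subsetD, OF J _ J]
    unfolding coordinate_system_def by simp
  then show ?thesis unfolding W_def .
qed

lemma coordinate_system_cong:
  fixes V :: "('k::field, 'v, 'm) module_scheme" and V' :: "('k, 'v, 'n) module_scheme"
  assumes eq: "carrier V = carrier V'" "add V = add V'" "zero V = zero V'" "smult V = smult V'"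
    and cs: "coordinate_system V I e c"
  shows "coordinate_system V' I e c"
  using cs vectorspace_cong[OF eq] unfolding coordinate_system_def vspan_cong[OF eq] linear_functional_def eq
  by blast

lemma coordinate_system_iso:
  fixes V :: "('k::field, 'v, 'm) module_scheme" and W :: "('k, 'w, 'n) module_scheme"
  assumes V: "vectorspace V" and cs: "coordinate_system W I e c"
    and lin: "linear_map V W \<phi>" and bij: "bij_betw \<phi> (carrier V) (carrier W)"
  shows "coordinate_system V I (inv_into (carrier V) \<phi> \<circ> e) (\<lambda>i. c i \<circ> \<phi>)"
proof -
  note W = coords_vectorspace[OF cs]
  let ?e = "inv_into (carrier V) \<phi> \<circ> e"
  have e: "?e i \<in> carrier V" "\<phi> (?e i) = e i" if "i \<in> I" for i
    using that coords_carrier[OF cs that] bij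
    by (auto simp: bij_betw_def intro: inv_into_into f_inv_into_f)
  let ?U = "vspan V (?e ` I)"
  have U: "subspace_of ?U V" using subspace_vspan[OF V] e by blast
  have UV: "?U \<subseteq> carrier V" using subspace_carrier[OF U] .
  have "subspace_of (\<phi> ` ?U) W"
  proof (rule subspaceI[OF W])
    show "\<phi> ` ?U \<subseteq> carrier W" using UV lin unfolding linear_map_def by blast
    show "\<zero>\<^bsub>W\<^esub> \<in> \<phi> ` ?U" using linear_map_zero[OF V W lin] subspace_zero[OF U] by (metis imageI)
    show "x \<oplus>\<^bsub>W\<^esub> y \<in> \<phi> ` ?U" if xy: "x \<in> \<phi> ` ?U" "y \<in> \<phi> ` ?U" for x y
    proof -
      from xy obtain u v where uv: "u \<in> ?U" "v \<in> ?U" "x = \<phi> u" "y = \<phi> v" by blast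
      then have "u \<in> carrier V" "v \<in> carrier V" using UV by blast+
      then have "x \<oplus>\<^bsub>W\<^esub> y = \<phi> (u \<oplus>\<^bsub>V\<^esub> v)" using lin uv(3,4) unfolding linear_map_def by simp
      then show ?thesis using subspace_plus[OF U uv(1,2)] by blast
    qed
    show "a \<odot>\<^bsub>W\<^esub> x \<in> \<phi> ` ?U" if x: "x \<in> \<phi> ` ?U" for a x
    proof -
      from x obtain u where u: "u \<in> ?U" "x = \<phi> u" by blast
      then have "u \<in> carrier V" using UV by blast
      then have "a \<odot>\<^bsub>W\<^esub> x = \<phi> (a \<odot>\<^bsub>V\<^esub> u)" using lin u(2) unfolding linear_map_def by simp
      then show ?thesis using subspace_smult[OF U u(1)] by blast
    qed
  qed
  moreover have "e i \<in> \<phi> ` ?U" if "i \<in> I" for i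
    using e(2)[OF that] vspan_superset[of "?e ` I" V] that by (metis image_eqI subsetD)
  ultimately have "carrier W \<subseteq> \<phi> ` ?U"
    using vspan_minimal[of "\<phi> ` ?U" W "e ` I"] coords_span[OF cs] by auto
  then have "carrier V \<subseteq> ?U"
  proof -
    assume *: "carrier W \<subseteq> \<phi> ` ?U"
    show "carrier V \<subseteq> ?U"
    proof
      fix v assume v: "v \<in> carrier V"
      then have "\<phi> v \<in> \<phi> ` ?U" using * lin unfolding linear_map_def by blast
      then show "v \<in> ?U"
        using inj_on_image_mem_iff[OF bij_betw_imp_inj_on[OF bij] v UV] by blast
    qed
  qed
  then have "?U = carrier V" using UV by blast
  moreover have "linear_functional V (c i \<circ> \<phi>)" if "i \<in> I" for i
    using coords_functional[OF cs that] lin unfolding linear_functional_def linear_map_def by auto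
  ultimately show ?thesis
    using V coords_finite[OF cs] coords_dual[OF cs] e unfolding coordinate_system_def by auto
qed

subsection \<open>Quotients\<close>

context
  fixes F :: "('k::field, 'v, 'm) module_scheme" and I :: "'v set"
  assumes F: "vectorspace F" and I: "subspace_of I F"
begin

lemma quot_abelian_subgroup: "abelian_subgroup I F"
proof (rule abelian_subgroupI3)
  show "additive_subgroup I F" using I unfolding submodule_def additive_subgroup_def by blast
  show "abelian_group F" using vs_abelian_group[OF F] .
qed

lemma quot_carrier: "carrier (quot F I) = (\<lambda>x. I +>\<^bsub>F\<^esub> x) ` carrier F"
  by (auto simp: quot_def A_RCOSETS_defs a_r_coset_def)

lemma quot_add:
  "x \<in> carrier F \<Longrightarrow> y \<in> carrier F \<Longrightarrow>
    (I +>\<^bsub>F\<^esub> x) \<oplus>\<^bsub>quot F I\<^esub> (I +>\<^bsub>F\<^esub> y) = I +>\<^bsub>F\<^esub> (x \<oplus>\<^bsub>F\<^esub> y)"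
  using abelian_subgroup.a_rcos_sum[OF quot_abelian_subgroup] by (simp add: quot_def)

lemma quot_rep: "x \<in> carrier F \<Longrightarrow> x \<in> I +>\<^bsub>F\<^esub> x"
  using abelian_subgroup.a_rcos_self[OF quot_abelian_subgroup] .

lemma quot_smult:
  assumes x: "x \<in> carrier F"
  shows "a \<odot>\<^bsub>quot F I\<^esub> (I +>\<^bsub>F\<^esub> x) = I +>\<^bsub>F\<^esub> (a \<odot>\<^bsub>F\<^esub> x)"
proof -
  interpret F: abelian_group F using vs_abelian_group[OF F] .
  note IF = subspace_carrier[OF I, THEN subsetD]
  have "I <+>\<^bsub>F\<^esub> ((\<lambda>v. a \<odot>\<^bsub>F\<^esub> v) ` (I +>\<^bsub>F\<^esub> x)) = I +>\<^bsub>F\<^esub> (a \<odot>\<^bsub>F\<^esub> x)" (is "?L = ?R")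
  proof
    show "?L \<subseteq> ?R"
    proof
      fix z assume "z \<in> ?L"
      then obtain i j where ij: "i \<in> I" "j \<in> I" "z = i \<oplus>\<^bsub>F\<^esub> a \<odot>\<^bsub>F\<^esub> (j \<oplus>\<^bsub>F\<^esub> x)"
        by (auto simp: set_add_def set_mult_def a_r_coset_def r_coset_def)
      then have "z = (i \<oplus>\<^bsub>F\<^esub> a \<odot>\<^bsub>F\<^esub> j) \<oplus>\<^bsub>F\<^esub> a \<odot>\<^bsub>F\<^esub> x"
        using x IF vs_smult_add_right[OF F] vs_smult_closed[OF F] by (simp add: F.a_assoc)
      moreover have "i \<oplus>\<^bsub>F\<^esub> a \<odot>\<^bsub>F\<^esub> j \<in> I" using ij subspace_plus[OF I] subspace_smult[OF I] by blast
      ultimately show "z \<in> ?R" by (auto simp: a_r_coset_def r_coset_def)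
    qed
    show "?R \<subseteq> ?L"
    proof
      fix z assume "z \<in> ?R"
      then obtain i where i: "i \<in> I" "z = i \<oplus>\<^bsub>F\<^esub> a \<odot>\<^bsub>F\<^esub> x"
        by (auto simp: a_r_coset_def r_coset_def)
      then show "z \<in> ?L" using quot_rep[OF x] by (auto simp: set_add_def set_mult_def)
    qed
  qed
  then show ?thesis by (simp add: quot_def)
qed

lemma quot_zero: "\<zero>\<^bsub>quot F I\<^esub> = I +>\<^bsub>F\<^esub> \<zero>\<^bsub>F\<^esub>"
proof -
  interpret F: abelian_group F using vs_abelian_group[OF F] .
  show ?thesis using F.a_coset_add_zero[OF subspace_carrier[OF I]] by (simp add: quot_def)
qed

lemma quot_vectorspace: "vectorspace (quot F I)"
  using quot_carrier quot_zero quot_add quot_smult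
  by (intro vectorspace_surj_image[OF F, of "\<lambda>x. I +>\<^bsub>F\<^esub> x"]) auto

lemma quot_linear_map: "linear_map F (quot F I) (\<lambda>x. I +>\<^bsub>F\<^esub> x)"
  unfolding linear_map_def using quot_carrier quot_add quot_smult by auto

lemma quot_eq_iff:
  assumes "x \<in> carrier F" "y \<in> carrier F"
  shows "I +>\<^bsub>F\<^esub> x = I +>\<^bsub>F\<^esub> y \<longleftrightarrow> (\<exists>i\<in>I. x = i \<oplus>\<^bsub>F\<^esub> y)"
proof
  assume "I +>\<^bsub>F\<^esub> x = I +>\<^bsub>F\<^esub> y"
  then show "\<exists>i\<in>I. x = i \<oplus>\<^bsub>F\<^esub> y" using quot_rep[OF assms(1)] by (auto simp: a_r_coset_def r_coset_def)
next
  assume "\<exists>i\<in>I. x = i \<oplus>\<^bsub>F\<^esub> y"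
  then have "x \<in> I +>\<^bsub>F\<^esub> y" by (auto simp: a_r_coset_def r_coset_def)
  then show "I +>\<^bsub>F\<^esub> x = I +>\<^bsub>F\<^esub> y"
    using abelian_group.a_repr_independence[OF vs_abelian_group[OF F], of x I y] assms I
    by (auto simp: submodule_def)
qed

lemma quot_eq_zero_iff: "x \<in> carrier F \<Longrightarrow> I +>\<^bsub>F\<^esub> x = \<zero>\<^bsub>quot F I\<^esub> \<longleftrightarrow> x \<in> I"
proof -
  interpret F: abelian_group F using vs_abelian_group[OF F] .
  assume "x \<in> carrier F"
  then show ?thesis
    using quot_eq_iff[of x "\<zero>\<^bsub>F\<^esub>"] subspace_carrier[OF I] by (force simp: quot_zero)
qed

text \<open>
  Functionals on a quotient are the functionals vanishing on the subspace; all dual bases below arise in this way.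
\<close>

lemma quot_functional:
  assumes f: "linear_functional F f" and ker: "\<And>x. x \<in> I \<Longrightarrow> f x = 0"
  obtains g where "linear_functional (quot F I) g" "\<And>x. x \<in> carrier F \<Longrightarrow> g (I +>\<^bsub>F\<^esub> x) = f x"
proof -
  define g where "g C = f (SOME x. x \<in> carrier F \<and> C = I +>\<^bsub>F\<^esub> x)" for C
  have g: "g (I +>\<^bsub>F\<^esub> x) = f x" if x: "x \<in> carrier F" for x
  proof -
    define y where "y = (SOME y. y \<in> carrier F \<and> I +>\<^bsub>F\<^esub> x = I +>\<^bsub>F\<^esub> y)"
    have y: "y \<in> carrier F \<and> I +>\<^bsub>F\<^esub> x = I +>\<^bsub>F\<^esub> y" unfolding y_def by (rule someI[of _ x]) (simp add: x)
    then obtain i where i: "i \<in> I" "x = i \<oplus>\<^bsub>F\<^esub> y" using quot_eq_iff[OF x, of y] by auto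
    have "i \<in> carrier F" using subspace_carrier[OF I] i(1) by auto
    then have "f x = f y" using functional_add[OF f, of i y] ker[OF i(1)] y unfolding i(2) by simp
    then show ?thesis unfolding g_def y_def by simp
  qed
  have gadd: "g ((I +>\<^bsub>F\<^esub> x) \<oplus>\<^bsub>quot F I\<^esub> (I +>\<^bsub>F\<^esub> y)) = g (I +>\<^bsub>F\<^esub> x) + g (I +>\<^bsub>F\<^esub> y)"
    if "x \<in> carrier F" "y \<in> carrier F" for x y
    using that by (simp add: g quot_add vs_add_closed[OF F] functional_add[OF f])
  have gsm: "g (a \<odot>\<^bsub>quot F I\<^esub> (I +>\<^bsub>F\<^esub> x)) = a * g (I +>\<^bsub>F\<^esub> x)" if "x \<in> carrier F" for a x
    using that by (simp add: g quot_smult vs_smult_closed[OF F] functional_smult[OF f])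
  have "linear_functional (quot F I) g"
    unfolding linear_functional_def quot_carrier ball_simps using gadd gsm by simp
  then show thesis using g by (rule that)
qed

end

subsection \<open>Direct sums\<close>

lemma direct_sum_vectorspace:
  fixes V :: "'i \<Rightarrow> ('k::field, 'v, 'm) module_scheme"
  assumes V: "\<And>i. i \<in> I \<Longrightarrow> vectorspace (V i)"
  shows "vectorspace (direct_sum I V)"
proof (rule vectorspaceI)
  note ag = vs_abelian_group[OF V]
  have fin: "finite {i \<in> I. f i \<oplus>\<^bsub>V i\<^esub> g i \<noteq> \<zero>\<^bsub>V i\<^esub>}"
    if "finite {i \<in> I. f i \<noteq> \<zero>\<^bsub>V i\<^esub>}" "finite {i \<in> I. g i \<noteq> \<zero>\<^bsub>V i\<^esub>}" for f g
  proof (rule finite_subset[OF _ finite_UnI[OF that]])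
    show "{i \<in> I. f i \<oplus>\<^bsub>V i\<^esub> g i \<noteq> \<zero>\<^bsub>V i\<^esub>} \<subseteq> {i \<in> I. f i \<noteq> \<zero>\<^bsub>V i\<^esub>} \<union> {i \<in> I. g i \<noteq> \<zero>\<^bsub>V i\<^esub>}"
      using abelian_monoid.l_zero[OF abelian_group.axioms(1)[OF ag]] vs_zero_closed[OF V] by auto
  qed
  have fin2: "finite {i \<in> I. a \<odot>\<^bsub>V i\<^esub> f i \<noteq> \<zero>\<^bsub>V i\<^esub>}" if "finite {i \<in> I. f i \<noteq> \<zero>\<^bsub>V i\<^esub>}" for f a
    by (rule finite_subset[OF _ that]) (use vs_smult_zero_right[OF V] in auto)
  show "f \<oplus>\<^bsub>direct_sum I V\<^esub> g \<in> carrier (direct_sum I V)"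
    if "f \<in> carrier (direct_sum I V)" "g \<in> carrier (direct_sum I V)" for f g
    using that fin[of f g]
    by (auto simp: direct_sum_def PiE_iff intro: vs_add_closed[OF V] cong: conj_cong)
  show "a \<odot>\<^bsub>direct_sum I V\<^esub> f \<in> carrier (direct_sum I V)"
    if "f \<in> carrier (direct_sum I V)" for f and a :: 'k
    using that fin2[of f a]
    by (auto simp: direct_sum_def PiE_iff intro: vs_smult_closed[OF V] cong: conj_cong)
  show "\<zero>\<^bsub>direct_sum I V\<^esub> \<in> carrier (direct_sum I V)"
    by (auto simp: direct_sum_def vs_zero_closed[OF V] cong: conj_cong)
  show "\<zero>\<^bsub>direct_sum I V\<^esub> \<oplus>\<^bsub>direct_sum I V\<^esub> f = f" if "f \<in> carrier (direct_sum I V)" for f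
    using that abelian_monoid.l_zero[OF abelian_group.axioms(1)[OF ag]]
    by (intro ext) (auto simp: direct_sum_def PiE_iff extensional_def restrict_def)
  show "0 \<odot>\<^bsub>direct_sum I V\<^esub> f = \<zero>\<^bsub>direct_sum I V\<^esub>" if "f \<in> carrier (direct_sum I V)" for f
    using that vs_smult_zero[OF V]
    by (intro ext) (auto simp: direct_sum_def PiE_iff extensional_def restrict_def)
  show "1 \<odot>\<^bsub>direct_sum I V\<^esub> f = f" if "f \<in> carrier (direct_sum I V)" for f
    using that vs_smult_one[OF V]
    by (intro ext) (auto simp: direct_sum_def PiE_iff extensional_def restrict_def)
  show "(a * b) \<odot>\<^bsub>direct_sum I V\<^esub> f = a \<odot>\<^bsub>direct_sum I V\<^esub> (b \<odot>\<^bsub>direct_sum I V\<^esub> f)"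
    if "f \<in> carrier (direct_sum I V)" for f and a b :: 'k
    using that vs_smult_assoc[OF V]
    by (intro ext) (auto simp: direct_sum_def PiE_iff extensional_def restrict_def)
  show "(a + b) \<odot>\<^bsub>direct_sum I V\<^esub> f = a \<odot>\<^bsub>direct_sum I V\<^esub> f \<oplus>\<^bsub>direct_sum I V\<^esub> b \<odot>\<^bsub>direct_sum I V\<^esub> f"
    if "f \<in> carrier (direct_sum I V)" for f and a b :: 'k
    using that vs_smult_add_left[OF V]
    by (intro ext) (auto simp: direct_sum_def PiE_iff extensional_def restrict_def)
  show "a \<odot>\<^bsub>direct_sum I V\<^esub> (f \<oplus>\<^bsub>direct_sum I V\<^esub> g)
      = a \<odot>\<^bsub>direct_sum I V\<^esub> f \<oplus>\<^bsub>direct_sum I V\<^esub> a \<odot>\<^bsub>direct_sum I V\<^esub> g"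
    if "f \<in> carrier (direct_sum I V)" "g \<in> carrier (direct_sum I V)" for f g and a :: 'k
    using that vs_smult_add_right[OF V]
    by (intro ext) (auto simp: direct_sum_def PiE_iff extensional_def restrict_def)
  show "f \<oplus>\<^bsub>direct_sum I V\<^esub> g = g \<oplus>\<^bsub>direct_sum I V\<^esub> f"
    if "f \<in> carrier (direct_sum I V)" "g \<in> carrier (direct_sum I V)" for f g
    using that abelian_monoid.a_comm[OF abelian_group.axioms(1)[OF ag]]
    by (intro ext) (auto simp: direct_sum_def PiE_iff extensional_def restrict_def)
  show "(f \<oplus>\<^bsub>direct_sum I V\<^esub> g) \<oplus>\<^bsub>direct_sum I V\<^esub> h = f \<oplus>\<^bsub>direct_sum I V\<^esub> (g \<oplus>\<^bsub>direct_sum I V\<^esub> h)"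
    if "f \<in> carrier (direct_sum I V)" "g \<in> carrier (direct_sum I V)" "h \<in> carrier (direct_sum I V)" for f g h
    using that abelian_monoid.a_assoc[OF abelian_group.axioms(1)[OF ag]]
    by (intro ext) (auto simp: direct_sum_def PiE_iff extensional_def restrict_def)
qed

lemma coordinate_system_direct_sum:
  fixes V :: "'i \<Rightarrow> ('k::field, 'v, 'm) module_scheme" and J :: "'i \<Rightarrow> 'j set"
  assumes cs: "\<And>i. i \<in> I \<Longrightarrow> coordinate_system (V i) (J i) (e i) (c i)"
    and fin: "finite (Sigma I J)"
  shows "coordinate_system (direct_sum I V) (Sigma I J)
    (\<lambda>(i, j). \<lambda>k\<in>I. if k = i then e i j else \<zero>\<^bsub>V k\<^esub>) (\<lambda>(i, j) f. c i j (f i))"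
proof -
  note V = coords_vectorspace[OF cs]
  have D: "vectorspace (direct_sum I V)" using direct_sum_vectorspace[OF V] .
  define inc where "inc i v = (\<lambda>k\<in>I. if k = i then v else \<zero>\<^bsub>V k\<^esub>)" for i v
  have inc_carr: "inc i v \<in> carrier (direct_sum I V)" if "i \<in> I" "v \<in> carrier (V i)" for i v
  proof -
    have "{k \<in> I. inc i v k \<noteq> \<zero>\<^bsub>V k\<^esub>} \<subseteq> {i}" by (auto simp: inc_def)
    then have "finite {k \<in> I. inc i v k \<noteq> \<zero>\<^bsub>V k\<^esub>}" by (rule finite_subset) simp
    then show ?thesis using that vs_zero_closed[OF V] by (auto simp: direct_sum_def inc_def)
  qed
  have inc_lin: "linear_map (V i) (direct_sum I V) (inc i)" if i: "i \<in> I" for i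
    unfolding linear_map_def
  proof (intro conjI ballI allI)
    show "inc i (u \<oplus>\<^bsub>V i\<^esub> v) = inc i u \<oplus>\<^bsub>direct_sum I V\<^esub> inc i v" for u v
      using abelian_monoid.l_zero[OF abelian_group.axioms(1)[OF vs_abelian_group[OF V]]] vs_zero_closed[OF V]
      by (intro ext) (auto simp: direct_sum_def inc_def)
    show "inc i (a \<odot>\<^bsub>V i\<^esub> v) = a \<odot>\<^bsub>direct_sum I V\<^esub> inc i v" for a v
      using vs_smult_zero_right[OF V] by (intro ext) (auto simp: direct_sum_def inc_def)
  qed (use inc_carr i in auto)
  let ?E = "\<lambda>(i, j). inc i (e i j)"
  have Ecarr: "?E ` Sigma I J \<subseteq> carrier (direct_sum I V)"
    using inc_carr coords_carrier[OF cs] by auto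
  let ?W = "vspan (direct_sum I V) (?E ` Sigma I J)"
  have W: "subspace_of ?W (direct_sum I V)" using subspace_vspan[OF D Ecarr] .
  have incW: "inc i v \<in> ?W" if i: "i \<in> I" and v: "v \<in> carrier (V i)" for i v
  proof (rule linear_image_in_span[OF V[OF i] D inc_lin[OF i]])
    show "v \<in> vspan (V i) (e i ` J i)" using v coords_span[OF cs[OF i]] by simp
    show "inc i s \<in> ?W" if "s \<in> e i ` J i" for s
      using that i vspan_superset[of "?E ` Sigma I J" "direct_sum I V"] by force
  qed (use W coords_carrier[OF cs[OF i]] in auto)
  have "f \<in> ?W" if f: "f \<in> carrier (direct_sum I V)" for f
  proof -
    define S where "S = {i \<in> I. f i \<noteq> \<zero>\<^bsub>V i\<^esub>}"
    have S: "finite S" "S \<subseteq> I" and fV: "\<And>i. i \<in> I \<Longrightarrow> f i \<in> carrier (V i)" and fe: "f \<in> extensional I"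
      using f by (auto simp: direct_sum_def S_def PiE_iff)
    have "(\<lambda>k\<in>I. if k \<in> T then f k else \<zero>\<^bsub>V k\<^esub>) \<in> ?W" if "finite T" "T \<subseteq> I" for T
      using that
    proof (induction T rule: finite_induct)
      case empty
      have "(\<lambda>k\<in>I. if k \<in> {} then f k else \<zero>\<^bsub>V k\<^esub>) = \<zero>\<^bsub>direct_sum I V\<^esub>"
        by (simp add: direct_sum_def)
      then show ?case using subspace_zero[OF W] by (simp only:)
    next
      case (insert t T)
      have eq: "(\<lambda>k\<in>I. if k \<in> insert t T then f k else \<zero>\<^bsub>V k\<^esub>)
          = inc t (f t) \<oplus>\<^bsub>direct_sum I V\<^esub> (\<lambda>k\<in>I. if k \<in> T then f k else \<zero>\<^bsub>V k\<^esub>)"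
        using insert.hyps insert.prems fV vs_zero_closed[OF V]
          abelian_monoid.l_zero[OF abelian_group.axioms(1)[OF vs_abelian_group[OF V]]]
          abelian_monoid.r_zero[OF abelian_group.axioms(1)[OF vs_abelian_group[OF V]]]
        by (intro ext) (auto simp: direct_sum_def inc_def)
      show ?case
        unfolding eq
      proof (rule subspace_plus[OF W])
        show "inc t (f t) \<in> ?W" using insert.prems fV by (intro incW) auto
        show "(\<lambda>k\<in>I. if k \<in> T then f k else \<zero>\<^bsub>V k\<^esub>) \<in> ?W"
          using insert.prems by (intro insert.IH) auto
      qed
    qed
    from this[OF S] have "(\<lambda>k\<in>I. if k \<in> S then f k else \<zero>\<^bsub>V k\<^esub>) \<in> ?W" .
    moreover have "(\<lambda>k\<in>I. if k \<in> S then f k else \<zero>\<^bsub>V k\<^esub>) = f"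
      using fe by (intro ext) (auto simp: S_def extensional_def)
    ultimately show ?thesis by simp
  qed
  then have "?W = carrier (direct_sum I V)" using subspace_carrier[OF W] by blast
  moreover have "linear_functional (direct_sum I V) (\<lambda>f. c i j (f i))" if "i \<in> I" "j \<in> J i" for i j
    using that functional_add[OF coords_functional[OF cs]] functional_smult[OF coords_functional[OF cs]]
    by (auto simp: linear_functional_def direct_sum_def PiE_iff)
  moreover have "c i j (inc i' (e i' j') i) = (if (i, j) = (i', j') then 1 else 0)"
    if "i \<in> I" "j \<in> J i" "i' \<in> I" "j' \<in> J i'" for i j i' j'
    using that coords_dual[OF cs] functional_zero[OF V coords_functional[OF cs]]
    by (auto simp: inc_def)
  ultimately have "coordinate_system (direct_sum I V) (Sigma I J) ?E (\<lambda>(i, j) f. c i j (f i))"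
    using D fin Ecarr unfolding coordinate_system_def by auto
  then show ?thesis unfolding inc_def by simp
qed

section \<open>Graded vector spaces with a homogeneous basis\<close>

text \<open>
  A coordinate system adapted to a grading. The grading is described through the coordinates, as the
  common zeros of the functionals of other degrees, which is the form needed to compare it with
  the parts of other graded spaces.
\<close>

definition homogeneous_coordinates ::
  "('k::field, 'v) graded_module \<Rightarrow> 'i set \<Rightarrow> ('i \<Rightarrow> 'v) \<Rightarrow> ('i \<Rightarrow> 'v \<Rightarrow> 'k) \<Rightarrow> ('i \<Rightarrow> int) \<Rightarrow> bool" where
  "homogeneous_coordinates V I e c dg \<longleftrightarrow> coordinate_system V I e c \<and>
     (\<forall>d. degpart V d = {v \<in> carrier V. \<forall>i\<in>I. dg i \<noteq> d \<longrightarrow> c i v = 0})"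

lemma
  assumes "homogeneous_coordinates V I e c dg"
  shows homogeneous_coords: "coordinate_system V I e c"
    and homogeneous_degpart: "degpart V d = {v \<in> carrier V. \<forall>i\<in>I. dg i \<noteq> d \<longrightarrow> c i v = 0}"
  using assms unfolding homogeneous_coordinates_def by blast+

lemma homogeneous_basis_degpart:
  "homogeneous_coordinates V I e c dg \<Longrightarrow> i \<in> I \<Longrightarrow> e i \<in> degpart V (dg i)"
  using coords_dual[OF homogeneous_coords] coords_carrier[OF homogeneous_coords]
  by (fastforce simp: homogeneous_degpart)

lemma coordinate_system_degpart:
  assumes hc: "homogeneous_coordinates V I e c dg"
  shows "coordinate_system (V\<lparr>carrier := degpart V d\<rparr>) {i \<in> I. dg i = d} e c"
proof -
  have "degpart V d = {v \<in> carrier V. \<forall>i\<in>I - {i \<in> I. dg i = d}. c i v = 0}"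
    unfolding homogeneous_degpart[OF hc] by auto
  then show ?thesis using coordinate_system_subspace[OF homogeneous_coords[OF hc], of "{i \<in> I. dg i = d}"] by simp
qed

lemma graded_dim_homogeneous:
  "homogeneous_coordinates V I e c dg \<Longrightarrow> graded_dim V d = card {i \<in> I. dg i = d}"
  unfolding graded_dim_def by (rule vdim_coordinate_system[OF coordinate_system_degpart])

lemma poincare_polynomial_eq:
  assumes I: "finite I" and dim: "\<And>d. graded_dim V d = card {i \<in> I. dg i = d}"
  shows "poincare_polynomial V = (\<Sum>i\<in>I. fls_X_intpow (dg i))"
proof -
  have "{d. graded_dim V d \<noteq> 0} = dg ` I" using I by (auto simp: dim)
  moreover have "(\<Sum>i\<in>I. fls_X_intpow (dg i) :: rat fls)
      = (\<Sum>d\<in>dg ` I. \<Sum>i\<in>{i \<in> I. dg i = d}. fls_X_intpow (dg i))"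
    using sum.image_gen[OF I] .
  ultimately show ?thesis unfolding poincare_polynomial_def by (simp add: dim)
qed

lemma with_grading_simps [simp]:
  "carrier (with_grading V D) = carrier V" "add (with_grading V D) = add V"
  "zero (with_grading V D) = zero V" "smult (with_grading V D) = smult V"
  "degpart (with_grading V D) = D"
  by (simp_all add: with_grading_def module.extend_def graded_module.fields_def)

text \<open>
  An isomorphism restricts to the parts of each degree, and dimensions are read off from the
  coordinates on the other side. The source is a subset \<open>U\<close> of a vector space \<open>T\<close>, as for the
  invariants of a group action; each of its degree parts is a subspace of \<open>T\<close> by the definition of a
  grading.
\<close>

lemma poincare_polynomial_isomorphic:
  fixes T :: "('k::field, 'v) module" and W :: "('k, 'w) graded_module"
  assumes T: "vectorspace T" and U: "U \<subseteq> carrier T"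
    and gr: "is_grading (T\<lparr>carrier := U\<rparr>) D"
    and iso: "graded_isomorphic (with_grading (T\<lparr>carrier := U\<rparr>) D) W"
    and hc: "homogeneous_coordinates W I e c dg"
  shows "poincare_polynomial (with_grading (T\<lparr>carrier := U\<rparr>) D) = (\<Sum>i\<in>I. fls_X_intpow (dg i))"
proof (rule poincare_polynomial_eq)
  show "finite I" using coords_finite[OF homogeneous_coords[OF hc]] .
  fix d
  define V where "V = (with_grading (T\<lparr>carrier := U\<rparr>) D)\<lparr>carrier := D d\<rparr>"
  obtain \<phi> where \<phi>: "linear_iso (with_grading (T\<lparr>carrier := U\<rparr>) D) W \<phi>" "\<And>d. \<phi> ` D d = degpart W d"
    using iso unfolding graded_isomorphic_def by auto
  have D1: "subspace_of (D d) (T\<lparr>carrier := U\<rparr>)" using gr unfolding is_grading_def by blast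
  then have DU: "D d \<subseteq> U" using subspace_carrier[OF D1] by simp
  have D2: "subspace_of (D d) T"
  proof (rule subspaceI[OF T])
    show "D d \<subseteq> carrier T" using DU U by blast
    show "\<zero>\<^bsub>T\<^esub> \<in> D d" using subspace_zero[OF D1] by simp
    show "x \<oplus>\<^bsub>T\<^esub> y \<in> D d" if "x \<in> D d" "y \<in> D d" for x y using subspace_plus[OF D1 that] by simp
    show "a \<odot>\<^bsub>T\<^esub> x \<in> D d" if "x \<in> D d" for a x using subspace_smult[OF D1 that, of a] by simp
  qed
  have V: "vectorspace V"
    by (rule vectorspace_cong[OF _ _ _ _ vectorspace_subspace[OF T D2]]) (simp_all add: V_def)
  have "linear_map V (W\<lparr>carrier := degpart W d\<rparr>) \<phi>"
    using \<phi> DU unfolding linear_map_def linear_iso_def V_def by (auto simp: subset_iff)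
  moreover have "bij_betw \<phi> (carrier V) (carrier (W\<lparr>carrier := degpart W d\<rparr>))"
    using \<phi> DU unfolding linear_iso_def V_def bij_betw_def by (auto intro: inj_on_subset)
  ultimately have "coordinate_system V {i \<in> I. dg i = d} (inv_into (carrier V) \<phi> \<circ> e) (\<lambda>i. c i \<circ> \<phi>)"
    by (intro coordinate_system_iso[OF V coordinate_system_degpart[OF hc]])
  then show "graded_dim (with_grading (T\<lparr>carrier := U\<rparr>) D) d = card {i \<in> I. dg i = d}"
    using vdim_coordinate_system unfolding graded_dim_def V_def by auto
qed

lemma homogeneous_coordinates_shift:
  assumes hc: "homogeneous_coordinates V I e c dg"
  shows "homogeneous_coordinates (shift V r) I e c (\<lambda>i. dg i + r)"
proof -
  have "coordinate_system (shift V r) I e c"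
    by (rule coordinate_system_cong[OF _ _ _ _ homogeneous_coords[OF hc]]) (simp_all add: shift_def)
  then show ?thesis
    unfolding homogeneous_coordinates_def
    by (auto simp: shift_def homogeneous_degpart[OF hc] algebra_simps)
qed

lemma homogeneous_coordinates_direct_sum:
  fixes V :: "'i \<Rightarrow> ('k::field, 'v) graded_module" and J :: "'i \<Rightarrow> 'j set"
  assumes hc: "\<And>i. i \<in> I \<Longrightarrow> homogeneous_coordinates (V i) (J i) (e i) (c i) (dg i)"
    and fin: "finite (Sigma I J)"
  shows "homogeneous_coordinates (graded_direct_sum I V) (Sigma I J)
    (\<lambda>(i, j). \<lambda>k\<in>I. if k = i then e i j else \<zero>\<^bsub>V k\<^esub>) (\<lambda>(i, j) f. c i j (f i)) (\<lambda>(i, j). dg i j)"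
proof -
  have "coordinate_system (graded_direct_sum I V) (Sigma I J)
    (\<lambda>(i, j). \<lambda>k\<in>I. if k = i then e i j else \<zero>\<^bsub>V k\<^esub>) (\<lambda>(i, j) f. c i j (f i))"
    by (rule coordinate_system_cong[OF _ _ _ _ coordinate_system_direct_sum[of I V J e c]])
      (simp_all add: graded_direct_sum_def homogeneous_coords[OF hc] fin)
  moreover have "f i \<in> carrier (V i)" if "f \<in> carrier (direct_sum I V)" "i \<in> I" for f i
    using that by (auto simp: direct_sum_def)
  ultimately show ?thesis
    unfolding homogeneous_coordinates_def
    by (auto simp: graded_direct_sum_def homogeneous_degpart[OF hc])
qed

text \<open>
  In tensor products and symmetric powers the degree parts are spans of homogeneous
  generators. It then suffices that coordinates of a wrong degree vanish on these generators:
  the part of degree \<open>d\<close> is contained in the common zeros, and a vector of the common zeros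
  expands in the basis vectors of degree \<open>d\<close>.
\<close>

lemma homogeneous_coordinatesI:
  fixes V :: "('k::field, 'v) graded_module" and G :: "int \<Rightarrow> 'v set"
  assumes cs: "coordinate_system V I e c"
    and dg: "\<And>d. degpart V d = vspan V (G d)" and G: "\<And>d. G d \<subseteq> carrier V"
    and van: "\<And>d x i. x \<in> G d \<Longrightarrow> i \<in> I \<Longrightarrow> dg i \<noteq> d \<Longrightarrow> c i x = 0"
    and e: "\<And>i. i \<in> I \<Longrightarrow> e i \<in> G (dg i)"
  shows "homogeneous_coordinates V I e c dg"
  unfolding homogeneous_coordinates_def
proof (intro conjI allI cs)
  fix d
  note V = coords_vectorspace[OF cs]
  let ?D = "{v \<in> carrier V. \<forall>i\<in>I. dg i \<noteq> d \<longrightarrow> c i v = 0}"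
  have W: "subspace_of (vspan V (G d)) V" using subspace_vspan[OF V G] .
  have "subspace_of ?D V"
    by (rule subspaceI[OF V])
      (auto simp: functional_add[OF coords_functional[OF cs]] functional_smult[OF coords_functional[OF cs]]
        functional_zero[OF V coords_functional[OF cs]] vs_add_closed[OF V] vs_smult_closed[OF V] vs_zero_closed[OF V])
  then have "vspan V (G d) \<subseteq> ?D" using G van by (intro vspan_minimal) auto
  moreover have "?D \<subseteq> vspan V (G d)"
  proof
    fix v assume v: "v \<in> ?D"
    show "v \<in> vspan V (G d)"
    proof (rule coords_expansion_in[OF cs _ W])
      show "e i \<in> vspan V (G d)" if "i \<in> I" "c i v \<noteq> 0" for i
      proof -
        have "dg i = d" using that v by blast
        then show ?thesis using e[OF that(1)] vspan_superset[of "G d" V] by auto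
      qed
    qed (use v in auto)
  qed
  ultimately show "degpart V d = ?D" unfolding dg by (rule subset_antisym)
qed

section \<open>Free vector spaces and tensor products\<close>

lemma free_space_simps [simp]:
  "carrier (free_space S) = {f. Poly_Mapping.keys f \<subseteq> S}"
  "f \<oplus>\<^bsub>free_space S\<^esub> g = f + g" "\<zero>\<^bsub>free_space S\<^esub> = 0" "a \<odot>\<^bsub>free_space S\<^esub> f = pscale a f"
  by (simp_all add: free_space_def)

lemma free_space_vectorspace: "vectorspace (free_space S :: ('k::field, 's \<Rightarrow>\<^sub>0 'k) module)"
proof (rule vectorspaceI)
  fix f g :: "'s \<Rightarrow>\<^sub>0 'k" and a :: 'k
  assume "f \<in> carrier (free_space S)" "g \<in> carrier (free_space S)"
  then show "f \<oplus>\<^bsub>free_space S\<^esub> g \<in> carrier (free_space S)" using keys_add[of f g] by auto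
next
  fix f :: "'s \<Rightarrow>\<^sub>0 'k" and a :: 'k
  assume "f \<in> carrier (free_space S)"
  then show "a \<odot>\<^bsub>free_space S\<^esub> f \<in> carrier (free_space S)" by (auto simp: in_keys_iff)
qed (auto intro!: poly_mapping_eqI simp: lookup_add algebra_simps)

definition free_extension :: "('s \<Rightarrow> 'k::field) \<Rightarrow> ('s \<Rightarrow>\<^sub>0 'k) \<Rightarrow> 'k" where
  "free_extension g f = (\<Sum>x\<in>Poly_Mapping.keys f. Poly_Mapping.lookup f x * g x)"

lemma free_extension_superset:
  "finite S \<Longrightarrow> Poly_Mapping.keys f \<subseteq> S \<Longrightarrow> free_extension g f = (\<Sum>x\<in>S. Poly_Mapping.lookup f x * g x)"
  unfolding free_extension_def by (intro sum.mono_neutral_left) (auto simp: in_keys_iff)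

lemma free_extension_single [simp]: "free_extension g (Poly_Mapping.single x a) = a * g x"
  by (subst free_extension_superset[of "{x}"]) auto

lemma free_extension_add [simp]: "free_extension g (f + h) = free_extension g f + free_extension g h"
proof -
  let ?S = "Poly_Mapping.keys f \<union> Poly_Mapping.keys h"
  have "Poly_Mapping.keys (f + h) \<subseteq> ?S" using keys_add[of f h] .
  then show ?thesis
    using free_extension_superset[of ?S f g] free_extension_superset[of ?S h g]
      free_extension_superset[of ?S "f + h" g]
    by (simp add: lookup_add sum.distrib algebra_simps)
qed

lemma free_extension_pscale [simp]: "free_extension g (pscale a f) = a * free_extension g f"
proof -
  have "Poly_Mapping.keys (pscale a f) \<subseteq> Poly_Mapping.keys f" by (auto simp: in_keys_iff)
  then show ?thesis
    using free_extension_superset[of "Poly_Mapping.keys f" "pscale a f" g]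
    by (simp add: free_extension_def sum_distrib_left mult.assoc)
qed

lemma free_extension_uminus [simp]: "free_extension g (- f) = - free_extension g f"
  using free_extension_add[of g f "- f"] by (simp add: free_extension_def eq_neg_iff_add_eq_0 add.commute)

lemma free_extension_diff [simp]: "free_extension g (f - h) = free_extension g f - free_extension g h"
  using free_extension_add[of g f "- h"] by simp

lemma free_extension_functional: "linear_functional (free_space S) (free_extension g)"
  unfolding linear_functional_def by simp

lemma free_space_subspace_eq:
  assumes W: "subspace_of W (free_space S)" and single: "\<And>x. x \<in> S \<Longrightarrow> Poly_Mapping.single x 1 \<in> W"
  shows "W = carrier (free_space S)"
proof
  show "carrier (free_space S) \<subseteq> W"
  proof
    fix f :: "'a \<Rightarrow>\<^sub>0 'b" assume f: "f \<in> carrier (free_space S)"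
    have "(\<Sum>x\<in>T. Poly_Mapping.single x (Poly_Mapping.lookup f x)) \<in> W" if "finite T" "T \<subseteq> S" for T
      using that
    proof (induction T rule: finite_induct)
      case empty
      then show ?case using subspace_zero[OF W] by simp
    next
      case (insert x T)
      have "pscale (Poly_Mapping.lookup f x) (Poly_Mapping.single x 1) \<in> W"
        using subspace_smult[OF W single[of x], of "Poly_Mapping.lookup f x"] insert.prems by simp
      then show ?case using insert subspace_plus[OF W] by simp
    qed
    from this[of "Poly_Mapping.keys f"] f show "f \<in> W"
      using poly_mapping_sum_single[of "Poly_Mapping.keys f" f] by simp
  qed
qed (rule subspace_carrier[OF W])

text \<open>
  A family of basis indices \<open>\<iota>\<close> gives the functional that sends a pure tensor to the product of the
  coordinates \<open>c i (\<iota> i)\<close>; it is well defined because this product is multilinear. These functionals are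
  dual to the tensors of basis vectors, which span by multilinearity.
\<close>

lemma homogeneous_coordinates_tensor:
  fixes V :: "'i \<Rightarrow> ('k::field, 'v) graded_module" and J :: "'i \<Rightarrow> 'j set"
  assumes hc: "\<And>i. i \<in> I \<Longrightarrow> homogeneous_coordinates (V i) (J i) (e i) (c i) (dg i)"
    and I: "finite I"
  shows "\<exists>E C. homogeneous_coordinates (graded_tensor I V) (\<Pi>\<^sub>E i\<in>I. J i) E C (\<lambda>\<iota>. \<Sum>i\<in>I. dg i (\<iota> i))"
proof -
  note cs = homogeneous_coords[OF hc]
  note V = coords_vectorspace[OF cs]
  define P where "P = (\<Pi>\<^sub>E i\<in>I. carrier (V i))"
  define F :: "('k, ('i \<Rightarrow> 'v) \<Rightarrow>\<^sub>0 'k) module" where "F = free_space P"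
  define R where "R = vspan F (tensor_relations I V)"
  define T where "T = tensor_space I V"
  define pt where "pt = pure_tensor I V"
  have F: "vectorspace F" unfolding F_def by (rule free_space_vectorspace)
  have upd: "x(i := v) \<in> P" if "x \<in> P" "i \<in> I" "v \<in> carrier (V i)" for x i v
    using that unfolding P_def by (auto simp: PiE_iff extensional_def)
  have singleF: "Poly_Mapping.single x a \<in> carrier F" if "x \<in> P" for x a
    using that by (simp add: F_def)
  have addF: "f + g \<in> carrier F" if "f \<in> carrier F" "g \<in> carrier F" for f g
    using vs_add_closed[OF F that] by (simp add: F_def)
  have diffF: "f - g \<in> carrier F" if "f \<in> carrier F" "g \<in> carrier F" for f g
    using that keys_diff[of f g] by (auto simp: F_def)
  have relF: "tensor_relations I V \<subseteq> carrier F"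
    unfolding tensor_relations_def P_def[symmetric]
    by (auto intro!: singleF diffF upd vs_add_closed[OF V] vs_smult_closed[OF V])
  have R: "subspace_of R F" unfolding R_def by (rule subspace_vspan[OF F relF])
  have T_eq: "T = quot F R" by (simp add: T_def tensor_space_def F_def R_def P_def Let_def)
  have pt_eq: "pt x = R +>\<^bsub>F\<^esub> Poly_Mapping.single x 1" for x
    by (simp add: pt_def pure_tensor_def F_def R_def P_def Let_def)
  have T: "vectorspace T" unfolding T_eq by (rule quot_vectorspace[OF F R])
  have \<pi>: "linear_map F T (\<lambda>x. R +>\<^bsub>F\<^esub> x)" unfolding T_eq by (rule quot_linear_map[OF F R])
  have ptT: "pt x \<in> carrier T" if "x \<in> P" for x
    using \<pi> singleF[OF that] unfolding linear_map_def pt_eq by blast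
  have relR: "f \<in> R" if "f \<in> tensor_relations I V" for f
    using that vspan_superset[of "tensor_relations I V" F] unfolding R_def by blast
  have pt_add: "pt (x(i := v \<oplus>\<^bsub>V i\<^esub> w)) = pt (x(i := v)) \<oplus>\<^bsub>T\<^esub> pt (x(i := w))"
    if xi: "x \<in> P" "i \<in> I" and v: "v \<in> carrier (V i)" and w: "w \<in> carrier (V i)" for x i v w
  proof -
    let ?s = "\<lambda>v. Poly_Mapping.single (x(i := v)) (1::'k)"
    have "?s (v \<oplus>\<^bsub>V i\<^esub> w) - ?s v - ?s w \<in> R"
      by (rule relR) (use xi v w in \<open>auto simp: tensor_relations_def P_def\<close>)
    then have "R +>\<^bsub>F\<^esub> ?s (v \<oplus>\<^bsub>V i\<^esub> w) = R +>\<^bsub>F\<^esub> (?s v + ?s w)"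
      using xi v w by (subst quot_eq_iff[OF F R])
        (auto simp: F_def[symmetric] intro!: singleF addF upd vs_add_closed[OF V],
         auto simp: F_def algebra_simps intro!: bexI[of _ "?s (v \<oplus>\<^bsub>V i\<^esub> w) - ?s v - ?s w"])
    then show ?thesis
      using quot_add[OF F R singleF singleF, of "x(i := v)" "x(i := w)" 1 1] xi v w upd
      unfolding pt_eq T_eq by (simp add: F_def)
  qed
  have pt_smult: "pt (x(i := a \<odot>\<^bsub>V i\<^esub> v)) = a \<odot>\<^bsub>T\<^esub> pt (x(i := v))"
    if xi: "x \<in> P" "i \<in> I" and v: "v \<in> carrier (V i)" for x i a v
  proof -
    let ?s = "\<lambda>v a. Poly_Mapping.single (x(i := v)) (a::'k)"
    have "?s (a \<odot>\<^bsub>V i\<^esub> v) 1 - ?s v a \<in> R"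
      by (rule relR) (use xi v in \<open>auto simp: tensor_relations_def P_def\<close>)
    then have "R +>\<^bsub>F\<^esub> ?s (a \<odot>\<^bsub>V i\<^esub> v) 1 = R +>\<^bsub>F\<^esub> ?s v a"
      using xi v by (subst quot_eq_iff[OF F R])
        (auto simp: F_def[symmetric] intro!: singleF addF upd vs_smult_closed[OF V],
         auto simp: F_def algebra_simps intro!: bexI[of _ "?s (a \<odot>\<^bsub>V i\<^esub> v) 1 - ?s v a"])
    then show ?thesis
      using quot_smult[OF F R singleF, of "x(i := v)" a 1] xi v upd
      unfolding pt_eq T_eq by (simp add: F_def)
  qed
  \<comment> \<open>The coordinate functionals, first as functions on families of vectors.\<close>
  define h where "h \<iota> x = (\<Prod>i\<in>I. c i (\<iota> i) (x i))" for \<iota> x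
  define Idx where "Idx = (\<Pi>\<^sub>E i\<in>I. J i)"
  have h_upd: "h \<iota> (x(i := v)) = c i (\<iota> i) v * (\<Prod>k\<in>I - {i}. c k (\<iota> k) (x k))"
    if "i \<in> I" for \<iota> x i v
  proof -
    have "h \<iota> (x(i := v)) = c i (\<iota> i) v * (\<Prod>k\<in>I - {i}. c k (\<iota> k) ((x(i := v)) k))"
      unfolding h_def using I that by (subst prod.remove[of I i]) auto
    also have "(\<Prod>k\<in>I - {i}. c k (\<iota> k) ((x(i := v)) k)) = (\<Prod>k\<in>I - {i}. c k (\<iota> k) (x k))"
      by (rule prod.cong) auto
    finally show ?thesis .
  qed
  have "\<exists>g. linear_functional T g \<and> (\<forall>x\<in>P. g (pt x) = h \<iota> x)" if \<iota>: "\<iota> \<in> Idx" for \<iota>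
  proof -
    have cf: "linear_functional (V i) (c i (\<iota> i))" if "i \<in> I" for i
      using coords_functional[OF cs[OF that]] \<iota> that unfolding Idx_def by auto
    have lf: "linear_functional F (free_extension (h \<iota>))"
      unfolding F_def by (rule free_extension_functional)
    have "R \<subseteq> {f \<in> carrier F. free_extension (h \<iota>) f = 0}"
      unfolding R_def
    proof (rule vspan_minimal[OF subspace_kernel[OF F lf subspace_self[OF F]]])
      have "free_extension (h \<iota>) f = 0" if "f \<in> tensor_relations I V" for f
        using that unfolding tensor_relations_def
        by (auto simp: h_upd functional_add[OF cf] functional_smult[OF cf] distrib_right mult.assoc)
      then show "tensor_relations I V \<subseteq> {f \<in> carrier F. free_extension (h \<iota>) f = 0}" using relF by blast
    qed
    then have ker: "free_extension (h \<iota>) x = 0" if "x \<in> R" for x using that by blast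
    obtain g where g: "linear_functional (quot F R) g"
        "\<And>x. x \<in> carrier F \<Longrightarrow> g (R +>\<^bsub>F\<^esub> x) = free_extension (h \<iota>) x"
      by (rule quot_functional[OF F R lf ker, OF _ that]) assumption+
    then have "\<forall>x\<in>P. g (pt x) = h \<iota> x" using singleF unfolding pt_eq by simp
    with g(1) show ?thesis unfolding T_eq by blast
  qed
  then obtain C where C: "\<And>\<iota>. \<iota> \<in> Idx \<Longrightarrow> linear_functional T (C \<iota>)"
    "\<And>\<iota> x. \<iota> \<in> Idx \<Longrightarrow> x \<in> P \<Longrightarrow> C \<iota> (pt x) = h \<iota> x" by metis
  define b where "b \<iota> = (\<lambda>i\<in>I. e i (\<iota> i))" for \<iota>
  have bP: "b \<iota> \<in> P" if "\<iota> \<in> Idx" for \<iota>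
    using that coords_carrier[OF cs] unfolding b_def P_def Idx_def by auto
  let ?W = "vspan T ((\<lambda>\<iota>. pt (b \<iota>)) ` Idx)"
  have "(\<lambda>\<iota>. pt (b \<iota>)) ` Idx \<subseteq> carrier T" using ptT[OF bP] by auto
  then have W: "subspace_of ?W T" by (rule subspace_vspan[OF T])
  have ptW: "pt x \<in> ?W" if x: "x \<in> P" for x
  proof -
    \<comment> \<open>The factors outside \<open>S\<close> are basis vectors; those in \<open>S\<close> are expanded one at a time.\<close>
    have "\<forall>x\<in>P. (\<forall>i\<in>I - S. x i \<in> e i ` J i) \<longrightarrow> pt x \<in> ?W" if "finite S" "S \<subseteq> I" for S
      using that
    proof (induction S rule: finite_induct)
      case empty
      show ?case
      proof (intro ballI impI)
        fix x assume x: "x \<in> P" "\<forall>i\<in>I - {}. x i \<in> e i ` J i"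
        define \<iota> where "\<iota> = (\<lambda>i\<in>I. SOME j. j \<in> J i \<and> x i = e i j)"
        have \<iota>: "\<iota> i \<in> J i" "x i = e i (\<iota> i)" if "i \<in> I" for i
        proof -
          have "\<exists>j. j \<in> J i \<and> x i = e i j" using x(2) that by auto
          from someI_ex[OF this] show "\<iota> i \<in> J i" "x i = e i (\<iota> i)" using that by (simp_all add: \<iota>_def)
        qed
        have "x = b \<iota>" using x(1) \<iota> unfolding b_def P_def by (intro ext) (auto simp: PiE_iff extensional_def)
        moreover have "\<iota> \<in> Idx" using \<iota>(1) by (auto simp: Idx_def \<iota>_def)
        ultimately show "pt x \<in> ?W" using vspan_superset[of "(\<lambda>\<iota>. pt (b \<iota>)) ` Idx" T] by auto
      qed
    next
      case (insert s S)
      show ?case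
      proof (intro ballI impI)
        fix x assume x: "x \<in> P" "\<forall>i\<in>I - insert s S. x i \<in> e i ` J i"
        have s: "s \<in> I" using insert.prems by simp
        have lin: "linear_map (V s) T (\<lambda>v. pt (x(s := v)))"
          unfolding linear_map_def using pt_add[OF x(1) s] pt_smult[OF x(1) s] ptT upd[OF x(1) s] by simp
        have "pt (x(s := x s)) \<in> ?W"
        proof (rule linear_image_in_span[OF V[OF s] T lin _ _ _ W])
          show "x s \<in> vspan (V s) (e s ` J s)" using coords_span[OF cs[OF s]] x(1) s by (auto simp: P_def)
          show "e s ` J s \<subseteq> carrier (V s)" using coords_carrier[OF cs[OF s]] by blast
          fix v assume v: "v \<in> e s ` J s"
          then have "x(s := v) \<in> P" using upd[OF x(1) s] coords_carrier[OF cs[OF s]] by blast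
          moreover have "\<forall>i\<in>I - S. (x(s := v)) i \<in> e i ` J i" using x(2) v by auto
          ultimately show "pt (x(s := v)) \<in> ?W" using insert.IH insert.prems by blast
        qed
        then show "pt x \<in> ?W" by simp
      qed
    qed
    from this[OF I subset_refl] x show ?thesis by blast
  qed
  have span: "?W = carrier T"
  proof
    show "carrier T \<subseteq> ?W"
    proof
      fix t assume "t \<in> carrier T"
      then obtain f where f: "f \<in> carrier F" "t = R +>\<^bsub>F\<^esub> f" unfolding T_eq quot_carrier[OF F R] by blast
      have "{f \<in> carrier F. R +>\<^bsub>F\<^esub> f \<in> ?W} = carrier F"
        using free_space_subspace_eq[OF subspace_vimage[OF F T \<pi> W, unfolded F_def]] ptW singleF
        unfolding F_def[symmetric] pt_eq by auto
      with f show "t \<in> ?W" by blast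
    qed
  qed (rule subspace_carrier[OF W])
  have finIdx: "finite Idx" unfolding Idx_def using I coords_finite[OF cs] by (intro finite_PiE) auto
  have dual: "C \<iota> (pt (b \<kappa>)) = (if \<iota> = \<kappa> then 1 else 0)" if "\<iota> \<in> Idx" "\<kappa> \<in> Idx" for \<iota> \<kappa>
  proof -
    have "C \<iota> (pt (b \<kappa>)) = (\<Prod>i\<in>I. if \<iota> i = \<kappa> i then 1 else 0)"
      using that C(2)[OF that(1) bP[OF that(2)]] coords_dual[OF cs]
      unfolding h_def b_def Idx_def by (auto intro!: prod.cong simp: PiE_iff)
    also have "\<dots> = (if \<iota> = \<kappa> then 1 else 0)"
    proof (cases "\<iota> = \<kappa>")
      case False
      have "\<exists>i\<in>I. \<iota> i \<noteq> \<kappa> i"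
      proof (rule ccontr)
        assume "\<not> ?thesis"
        then have "\<iota> = \<kappa>" using that unfolding Idx_def by (intro PiE_ext[of \<iota> I J \<kappa>]) auto
        with False show False ..
      qed
      then obtain i where "i \<in> I" "\<iota> i \<noteq> \<kappa> i" by blast
      then have "(\<Prod>i\<in>I. if \<iota> i = \<kappa> i then 1 else 0 :: 'k) = 0" by (intro prod_zero[OF I]) auto
      then show ?thesis using False by simp
    qed simp
    finally show ?thesis .
  qed
  have csT: "coordinate_system T Idx (\<lambda>\<iota>. pt (b \<iota>)) C"
    unfolding coordinate_system_def using T finIdx C(1) ptT bP dual span by simp
  have "homogeneous_coordinates (graded_tensor I V) Idx (\<lambda>\<iota>. pt (b \<iota>)) C (\<lambda>\<iota>. \<Sum>i\<in>I. dg i (\<iota> i))"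
  proof (rule homogeneous_coordinatesI)
    let ?G = "\<lambda>d. {pt x | x \<delta>. x \<in> P \<and> (\<forall>i\<in>I. x i \<in> degpart (V i) (\<delta> i)) \<and> (\<Sum>i\<in>I. \<delta> i) = d}"
    show "coordinate_system (graded_tensor I V) Idx (\<lambda>\<iota>. pt (b \<iota>)) C"
      by (rule coordinate_system_cong[OF _ _ _ _ csT]) (simp_all add: graded_tensor_def T_def)
    show "degpart (graded_tensor I V) d = vspan (graded_tensor I V) (?G d)" for d
      unfolding graded_tensor_def pt_def P_def with_grading_simps
      by (rule vspan_cong) simp_all
    show "?G d \<subseteq> carrier (graded_tensor I V)" for d
      using ptT by (auto simp: graded_tensor_def T_def)
    show "C \<iota> x = 0" if x: "x \<in> ?G d" and \<iota>: "\<iota> \<in> Idx" and d: "(\<Sum>i\<in>I. dg i (\<iota> i)) \<noteq> d" for d x \<iota>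
    proof -
      from x obtain y \<delta> where y: "x = pt y" "y \<in> P" "\<forall>i\<in>I. y i \<in> degpart (V i) (\<delta> i)" "(\<Sum>i\<in>I. \<delta> i) = d"
        by blast
      have "\<exists>i\<in>I. dg i (\<iota> i) \<noteq> \<delta> i"
      proof (rule ccontr)
        assume "\<not> ?thesis"
        then have "(\<Sum>i\<in>I. dg i (\<iota> i)) = (\<Sum>i\<in>I. \<delta> i)" by (intro sum.cong) auto
        with d y(4) show False by simp
      qed
      then obtain i where i: "i \<in> I" "dg i (\<iota> i) \<noteq> \<delta> i" by blast
      have "y i \<in> degpart (V i) (\<delta> i)" "\<iota> i \<in> J i" using y(3) i(1) \<iota> by (auto simp: Idx_def)
      then have "c i (\<iota> i) (y i) = 0" using i(2) unfolding homogeneous_degpart[OF hc[OF i(1)]] by simp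
      then have "h \<iota> y = 0" unfolding h_def by (intro prod_zero[OF I]) (use i(1) in blast)
      then show ?thesis using C(2)[OF \<iota> y(2)] y(1) by simp
    qed
    show "pt (b \<iota>) \<in> ?G (\<Sum>i\<in>I. dg i (\<iota> i))" if \<iota>: "\<iota> \<in> Idx" for \<iota>
    proof -
      have "\<forall>i\<in>I. b \<iota> i \<in> degpart (V i) (dg i (\<iota> i))"
        using \<iota> homogeneous_basis_degpart[OF hc] unfolding b_def Idx_def by auto
      then show ?thesis
        using bP[OF \<iota>] by (intro CollectI exI[of _ "b \<iota>"] exI[of _ "\<lambda>i. dg i (\<iota> i)"]) simp
    qed
  qed
  then show ?thesis unfolding Idx_def by blast
qed

section \<open>Free algebras and ideals\<close>

text \<open>
  With concatenation as addition of words, the convolution product of finitely supported functions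
  is the multiplication of the free algebra, which provides the ring laws.
\<close>

instantiation list :: (type) monoid_add
begin
definition plus_list_def: "u + v = u @ (v :: 'a list)"
definition zero_list_def: "(0 :: 'a list) = []"
instance by standard (simp_all add: plus_list_def zero_list_def)
end

lemma free_algebra_mult: "f \<otimes>\<^bsub>free_algebra S\<^esub> g = f * (g :: 's list \<Rightarrow>\<^sub>0 'k::field)"
proof -
  have "f * g = (\<Sum>u\<in>Poly_Mapping.keys f. Poly_Mapping.single u (Poly_Mapping.lookup f u))
      * (\<Sum>v\<in>Poly_Mapping.keys g. Poly_Mapping.single v (Poly_Mapping.lookup g v))"
    using poly_mapping_sum_single[of "Poly_Mapping.keys f" f]
      poly_mapping_sum_single[of "Poly_Mapping.keys g" g] by simp
  then show ?thesis
    by (simp add: free_algebra_def sum_distrib_left sum_distrib_right mult_single plus_list_def)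
      (rule sum.swap)
qed

lemma free_algebra_simps [simp]:
  "carrier (free_algebra S) = {f. Poly_Mapping.keys f \<subseteq> lists S}"
  "add (free_algebra S) = (+)" "\<zero>\<^bsub>free_algebra S\<^esub> = 0" "smult (free_algebra S) = pscale"
  "\<one>\<^bsub>free_algebra S\<^esub> = Poly_Mapping.single [] 1"
  by (simp_all add: free_algebra_def free_space_def)

lemma free_algebra_vectorspace: "vectorspace (free_algebra S :: ('k::field, 's list \<Rightarrow>\<^sub>0 'k) module)"
  by (rule vectorspace_cong[OF _ _ _ _ free_space_vectorspace[of "lists S"]])
    (simp_all add: free_algebra_def)

lemma single_Nil_eq_one: "Poly_Mapping.single [] 1 = (1 :: 's list \<Rightarrow>\<^sub>0 'k::field)"
  by (simp add: zero_list_def[symmetric])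

lemma keys_mult_lists:
  fixes f g :: "'s list \<Rightarrow>\<^sub>0 'k::field"
  assumes "Poly_Mapping.keys f \<subseteq> lists S" "Poly_Mapping.keys g \<subseteq> lists S"
  shows "Poly_Mapping.keys (f * g) \<subseteq> lists S"
  using keys_mult[of f g] assms by (fastforce simp: plus_list_def)

lemma free_algebra_ring: "ring (free_algebra S :: ('k::field, 's list \<Rightarrow>\<^sub>0 'k) module)"
proof (rule ringI)
  show "abelian_group (free_algebra S :: ('k, 's list \<Rightarrow>\<^sub>0 'k) module)"
    by (rule vs_abelian_group[OF free_algebra_vectorspace])
  show "Group.monoid (free_algebra S :: ('k, 's list \<Rightarrow>\<^sub>0 'k) module)"
  proof (rule monoidI)
    fix x y :: "'s list \<Rightarrow>\<^sub>0 'k"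
    assume "x \<in> carrier (free_algebra S)" "y \<in> carrier (free_algebra S)"
    then show "x \<otimes>\<^bsub>free_algebra S\<^esub> y \<in> carrier (free_algebra S)"
      by (simp add: free_algebra_mult keys_mult_lists)
  qed (simp_all add: free_algebra_mult mult.assoc, simp_all add: single_Nil_eq_one)
qed (simp_all add: free_algebra_mult algebra_simps)

lemma ring_cong:
  assumes R: "ring R" and eq: "carrier R = carrier S" "add R = add S" "zero R = zero S"
    "mult R = mult S" "one R = one S"
  shows "ring S"
proof -
  interpret R: ring R by (rule R)
  show ?thesis
  proof (rule ringI)
    show "abelian_group S"
      by (rule abelian_groupI)
        (use R.a_closed R.zero_closed R.a_assoc R.a_comm R.l_zero R.add.l_inv_ex in \<open>simp_all add: eq\<close>)
    show "Group.monoid S"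
      by (rule monoidI) (use R.m_closed R.one_closed R.m_assoc R.l_one R.r_one in \<open>simp_all add: eq\<close>)
  qed (use R.l_distr R.r_distr in \<open>simp_all add: eq\<close>)
qed

text \<open>
  The last condition, that scalars act through multiples of the unit, is what makes ideals into
  subspaces and passes to quotients.
\<close>

definition unital_algebra :: "('k::field, 'v, 'm) module_scheme \<Rightarrow> bool" where
  "unital_algebra A \<longleftrightarrow> vectorspace A \<and> ring A \<and> (\<forall>a. \<forall>x\<in>carrier A. a \<odot>\<^bsub>A\<^esub> x = (a \<odot>\<^bsub>A\<^esub> \<one>\<^bsub>A\<^esub>) \<otimes>\<^bsub>A\<^esub> x)"

lemma ideal_subspace:
  assumes A: "unital_algebra A" and J: "ideal J A"
  shows "subspace_of J A"
proof -
  have V: "vectorspace A" and R: "ring A" using A unfolding unital_algebra_def by blast+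
  interpret R: ring A by (rule R)
  interpret J: ideal J A by (rule J)
  show ?thesis
  proof (rule subspaceI[OF V])
    fix a x assume x: "x \<in> J"
    have "a \<odot>\<^bsub>A\<^esub> x = (a \<odot>\<^bsub>A\<^esub> \<one>\<^bsub>A\<^esub>) \<otimes>\<^bsub>A\<^esub> x"
      using A J.a_Hcarr[OF x] unfolding unital_algebra_def by blast
    then show "a \<odot>\<^bsub>A\<^esub> x \<in> J" using J.I_l_closed[OF x vs_smult_closed[OF V R.one_closed]] by simp
  qed (use J.a_subset J.zero_closed J.a_closed in auto)
qed

lemma subspace_ideal:
  assumes R: "ring A" and J: "subspace_of J A"
    and l: "\<And>a x. a \<in> J \<Longrightarrow> x \<in> carrier A \<Longrightarrow> x \<otimes>\<^bsub>A\<^esub> a \<in> J"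
    and r: "\<And>a x. a \<in> J \<Longrightarrow> x \<in> carrier A \<Longrightarrow> a \<otimes>\<^bsub>A\<^esub> x \<in> J"
  shows "ideal J A"
  using J by (intro idealI[OF R] l r) (auto simp: submodule_def)

lemma quot_mult:
  "ideal J A \<Longrightarrow> x \<in> carrier A \<Longrightarrow> y \<in> carrier A \<Longrightarrow>
    (J +>\<^bsub>A\<^esub> x) \<otimes>\<^bsub>quot A J\<^esub> (J +>\<^bsub>A\<^esub> y) = J +>\<^bsub>A\<^esub> (x \<otimes>\<^bsub>A\<^esub> y)"
  by (simp add: quot_def ideal.rcoset_mult_add)

lemma unital_algebra_quot:
  assumes A: "unital_algebra A" and J: "ideal J A"
  shows "unital_algebra (quot A J)"
proof -
  have V: "vectorspace A" and R: "ring A"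
    and sm: "\<And>a x. x \<in> carrier A \<Longrightarrow> a \<odot>\<^bsub>A\<^esub> x = (a \<odot>\<^bsub>A\<^esub> \<one>\<^bsub>A\<^esub>) \<otimes>\<^bsub>A\<^esub> x"
    using A unfolding unital_algebra_def by blast+
  interpret R: ring A by (rule R)
  have J': "subspace_of J A" by (rule ideal_subspace[OF A J])
  have one: "\<one>\<^bsub>quot A J\<^esub> = J +>\<^bsub>A\<^esub> \<one>\<^bsub>A\<^esub>" by (simp add: quot_def)
  have "ring (quot A J)"
    by (rule ring_cong[OF ideal.quotient_is_ring[OF J]]) (simp_all add: quot_def FactRing_def)
  moreover have "\<forall>x\<in>carrier A. a \<odot>\<^bsub>quot A J\<^esub> (J +>\<^bsub>A\<^esub> x)
      = (a \<odot>\<^bsub>quot A J\<^esub> \<one>\<^bsub>quot A J\<^esub>) \<otimes>\<^bsub>quot A J\<^esub> (J +>\<^bsub>A\<^esub> x)" for a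
  proof
    fix x assume x: "x \<in> carrier A"
    have "a \<odot>\<^bsub>quot A J\<^esub> (J +>\<^bsub>A\<^esub> x) = J +>\<^bsub>A\<^esub> ((a \<odot>\<^bsub>A\<^esub> \<one>\<^bsub>A\<^esub>) \<otimes>\<^bsub>A\<^esub> x)"
      using quot_smult[OF V J' x, of a] by (simp only: sm[OF x])
    also have "\<dots> = (J +>\<^bsub>A\<^esub> (a \<odot>\<^bsub>A\<^esub> \<one>\<^bsub>A\<^esub>)) \<otimes>\<^bsub>quot A J\<^esub> (J +>\<^bsub>A\<^esub> x)"
      using quot_mult[OF J vs_smult_closed[OF V R.one_closed] x] by simp
    also have "J +>\<^bsub>A\<^esub> (a \<odot>\<^bsub>A\<^esub> \<one>\<^bsub>A\<^esub>) = a \<odot>\<^bsub>quot A J\<^esub> \<one>\<^bsub>quot A J\<^esub>"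
      by (simp add: one quot_smult[OF V J' R.one_closed])
    finally show "a \<odot>\<^bsub>quot A J\<^esub> (J +>\<^bsub>A\<^esub> x)
      = (a \<odot>\<^bsub>quot A J\<^esub> \<one>\<^bsub>quot A J\<^esub>) \<otimes>\<^bsub>quot A J\<^esub> (J +>\<^bsub>A\<^esub> x)" .
  qed
  ultimately show ?thesis
    using quot_vectorspace[OF V J'] unfolding unital_algebra_def quot_carrier[OF V J'] by simp
qed

lemma pscale_conv_mult: "pscale a f = Poly_Mapping.single [] a * (f :: 's list \<Rightarrow>\<^sub>0 'k::field)"
  using mult_map_scale_conv_mult[of a f] by (simp add: zero_list_def)

lemma pscale_mult_left: "pscale a f * g = pscale a (f * (g :: 's list \<Rightarrow>\<^sub>0 'k::field))"
  by (simp add: pscale_conv_mult mult.assoc)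

lemma pscale_sum: "pscale a (sum f Y) = (\<Sum>x\<in>Y. pscale a (f x))"
  by (rule pm.scale_sum_right)

lemma pscale_mult_right: "f * pscale a g = pscale a (f * (g :: 's list \<Rightarrow>\<^sub>0 'k::field))"
proof -
  have f: "f = (\<Sum>u\<in>Poly_Mapping.keys f. Poly_Mapping.single u (Poly_Mapping.lookup f u))"
    using poly_mapping_sum_single[of "Poly_Mapping.keys f" f] by simp
  have "f * Poly_Mapping.single [] a = pscale a f"
    by (subst (1 2) f) (simp add: sum_distrib_right mult_single plus_list_def pscale_sum mult.commute)
  then show ?thesis by (simp add: pscale_conv_mult mult.assoc[symmetric])
qed

lemma free_algebra_unital: "unital_algebra (free_algebra S :: ('k::field, 's list \<Rightarrow>\<^sub>0 'k) module)"
  unfolding unital_algebra_def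
  by (simp add: free_algebra_vectorspace free_algebra_ring free_algebra_mult pscale_conv_mult mult_single plus_list_def)

lemma free_extension_zero [simp]: "free_extension g 0 = 0"
  by (simp add: free_extension_def)

lemma free_extension_sum: "free_extension g (sum f Y) = (\<Sum>x\<in>Y. free_extension g (f x))"
  by (induction Y rule: infinite_finite_induct) simp_all

text \<open>
  A linear functional on words vanishes on an ideal as soon as it vanishes on all generators
  multiplied by words on both sides: the elements with this property form an ideal.
\<close>

lemma free_extension_ideal:
  fixes h :: "'s list \<Rightarrow> 'k::field" and S :: "'s set"
  defines "A \<equiv> free_algebra S :: ('k, 's list \<Rightarrow>\<^sub>0 'k) module"
  defines "K \<equiv> {a \<in> carrier A. \<forall>x\<in>lists S. \<forall>y\<in>lists S.
       free_extension h (Poly_Mapping.single x 1 * a * Poly_Mapping.single y 1) = 0}"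
  shows "ideal K A"
proof (rule subspace_ideal)
  show "ring A" unfolding A_def by (rule free_algebra_ring)
  have V: "vectorspace A" unfolding A_def by (rule free_algebra_vectorspace)
  show "subspace_of K A"
    using vs_add_closed[OF V] vs_smult_closed[OF V]
    by (intro subspaceI[OF V])
      (auto simp: K_def A_def distrib_left distrib_right pscale_mult_left pscale_mult_right)
  have *: "free_extension h (p * a * q) = 0" if a: "a \<in> K" and pq: "p \<in> carrier A" "q \<in> carrier A" for a p q
  proof -
    have p: "(\<Sum>u\<in>Poly_Mapping.keys p. pscale (Poly_Mapping.lookup p u) (Poly_Mapping.single u 1)) = p"
      using poly_mapping_sum_single[of "Poly_Mapping.keys p" p] by simp
    have q: "(\<Sum>u\<in>Poly_Mapping.keys q. pscale (Poly_Mapping.lookup q u) (Poly_Mapping.single u 1)) = q"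
      using poly_mapping_sum_single[of "Poly_Mapping.keys q" q] by simp
    have pq': "Poly_Mapping.keys p \<subseteq> lists S" "Poly_Mapping.keys q \<subseteq> lists S"
      using pq by (simp_all add: A_def)
    have z: "free_extension h (Poly_Mapping.single x 1 * a * Poly_Mapping.single y 1) = 0"
      if "x \<in> Poly_Mapping.keys p" "y \<in> Poly_Mapping.keys q" for x y
    proof -
      have "x \<in> lists S" "y \<in> lists S" using that pq' by blast+
      then show ?thesis using a unfolding K_def by blast
    qed
    have "(\<Sum>u\<in>Poly_Mapping.keys p. pscale (Poly_Mapping.lookup p u) (Poly_Mapping.single u 1)) * a
        * (\<Sum>u\<in>Poly_Mapping.keys q. pscale (Poly_Mapping.lookup q u) (Poly_Mapping.single u 1))
      = (\<Sum>v\<in>Poly_Mapping.keys q. \<Sum>u\<in>Poly_Mapping.keys p.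
        pscale (Poly_Mapping.lookup q v) (pscale (Poly_Mapping.lookup p u)
          (Poly_Mapping.single u 1 * a * Poly_Mapping.single v 1)))"
      by (simp add: sum_distrib_left sum_distrib_right pscale_mult_left pscale_mult_right pscale_sum
          del: pscale_single map_single)
    then have "p * a * q = (\<Sum>v\<in>Poly_Mapping.keys q. \<Sum>u\<in>Poly_Mapping.keys p.
        pscale (Poly_Mapping.lookup q v) (pscale (Poly_Mapping.lookup p u)
          (Poly_Mapping.single u 1 * a * Poly_Mapping.single v 1)))"
      unfolding p q .
    then show ?thesis using z by (simp add: free_extension_sum del: pscale_single map_single)
  qed
  show "x \<otimes>\<^bsub>A\<^esub> a \<in> K" if a: "a \<in> K" and x: "x \<in> carrier A" for a x
  proof -
    have aA: "a \<in> carrier A" using a unfolding K_def by blast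
    then have "x * a \<in> carrier A" using x keys_mult_lists[of x S a] by (simp add: A_def)
    moreover have "free_extension h (Poly_Mapping.single u 1 * (x * a) * Poly_Mapping.single v 1) = 0"
      if "u \<in> lists S" "v \<in> lists S" for u v
    proof -
      have "Poly_Mapping.single u 1 * x \<in> carrier A" "Poly_Mapping.single v 1 \<in> carrier A"
        using that x keys_mult_lists[of "Poly_Mapping.single u 1" S x] by (simp_all add: A_def)
      from *[OF a this] show ?thesis by (simp add: mult.assoc)
    qed
    ultimately show ?thesis by (simp add: K_def A_def free_algebra_mult)
  qed
  show "a \<otimes>\<^bsub>A\<^esub> x \<in> K" if a: "a \<in> K" and x: "x \<in> carrier A" for a x
  proof -
    have aA: "a \<in> carrier A" using a unfolding K_def by blast
    then have "a * x \<in> carrier A" using x keys_mult_lists[of a S x] by (simp add: A_def)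
    moreover have "free_extension h (Poly_Mapping.single u 1 * (a * x) * Poly_Mapping.single v 1) = 0"
      if "u \<in> lists S" "v \<in> lists S" for u v
    proof -
      have "x * Poly_Mapping.single v 1 \<in> carrier A" "Poly_Mapping.single u 1 \<in> carrier A"
        using that x keys_mult_lists[of x S "Poly_Mapping.single v 1"] by (simp_all add: A_def)
      from *[OF a this(2,1)] show ?thesis by (simp add: mult.assoc)
    qed
    ultimately show ?thesis by (simp add: K_def A_def free_algebra_mult)
  qed
qed

lemma ideal_double_quotient:
  fixes A :: "('k::field, 'v, 'm) module_scheme" and L :: "'v set" and C :: "'v set set"
  assumes A: "unital_algebra A" and L: "ideal L A" and C: "ideal C (quot A L)"
  shows "ideal {a \<in> carrier A. L +>\<^bsub>A\<^esub> a \<in> C} A"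
proof -
  have V: "vectorspace A" and R: "ring A" using A unfolding unital_algebra_def by blast+
  have Q: "unital_algebra (quot A L)" by (rule unital_algebra_quot[OF A L])
  then have VQ: "vectorspace (quot A L)" unfolding unital_algebra_def by blast
  interpret R: ring A by (rule R)
  interpret C: ideal C "quot A L" by (rule C)
  have L': "subspace_of L A" by (rule ideal_subspace[OF A L])
  have C': "subspace_of C (quot A L)" by (rule ideal_subspace[OF Q C])
  have carr: "L +>\<^bsub>A\<^esub> x \<in> carrier (quot A L)" if "x \<in> carrier A" for x
    using that quot_carrier[OF V L'] by blast
  show ?thesis
  proof (rule subspace_ideal[OF R subspace_vimage[OF V VQ quot_linear_map[OF V L'] C']])
    fix a x assume a: "a \<in> {a \<in> carrier A. L +>\<^bsub>A\<^esub> a \<in> C}" and x: "x \<in> carrier A"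
    show "x \<otimes>\<^bsub>A\<^esub> a \<in> {a \<in> carrier A. L +>\<^bsub>A\<^esub> a \<in> C}"
      using C.I_l_closed[of "L +>\<^bsub>A\<^esub> a" "L +>\<^bsub>A\<^esub> x"] a x carr quot_mult[OF L, of x a] by simp
    show "a \<otimes>\<^bsub>A\<^esub> x \<in> {a \<in> carrier A. L +>\<^bsub>A\<^esub> a \<in> C}"
      using C.I_r_closed[of "L +>\<^bsub>A\<^esub> a" "L +>\<^bsub>A\<^esub> x"] a x carr quot_mult[OF L, of a x] by simp
  qed
qed

text \<open>
  The symmetric algebra is a quotient of a quotient. An ideal \<open>K\<close> of the original algebra that contains
  both families of relations contains every element that dies in the double quotient, so that
  functionals need only be tested upstairs.
\<close>

lemma double_quotient_minimal:
  fixes A :: "('k::field, 'v, 'm) module_scheme"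
  assumes A: "unital_algebra A" and GA: "G \<subseteq> carrier A"
    and K: "ideal K A" and G: "G \<subseteq> K" and H: "H \<subseteq> K"
    and a: "a \<in> carrier A" "genideal A G +>\<^bsub>A\<^esub> a
      \<in> genideal (quot A (genideal A G)) ((\<lambda>x. genideal A G +>\<^bsub>A\<^esub> x) ` H)"
  shows "a \<in> K"
proof -
  define L where "L = genideal A G"
  have V: "vectorspace A" and R: "ring A" using A unfolding unital_algebra_def by blast+
  interpret R: ring A by (rule R)
  interpret K: ideal K A by (rule K)
  have L: "ideal L A" unfolding L_def by (rule R.genideal_ideal[OF GA])
  have LK: "L \<subseteq> K" unfolding L_def by (rule R.genideal_minimal[OF K G])
  have Q: "unital_algebra (quot A L)" by (rule unital_algebra_quot[OF A L])
  then have VQ: "vectorspace (quot A L)" and RQ: "ring (quot A L)" unfolding unital_algebra_def by blast+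
  have L': "subspace_of L A" by (rule ideal_subspace[OF A L])
  have K': "subspace_of K A" by (rule ideal_subspace[OF A K])
  let ?\<pi> = "\<lambda>x. L +>\<^bsub>A\<^esub> x"
  have KA: "x \<in> carrier A" if "x \<in> K" for x using subspace_carrier[OF K'] that by blast
  have "subspace_of (?\<pi> ` K) (quot A L)"
  proof (rule subspaceI[OF VQ])
    show "?\<pi> ` K \<subseteq> carrier (quot A L)" using KA by (auto simp: quot_carrier[OF V L'])
    show "\<zero>\<^bsub>quot A L\<^esub> \<in> ?\<pi> ` K" using subspace_zero[OF K'] by (simp add: quot_zero[OF V L'])
    show "x \<oplus>\<^bsub>quot A L\<^esub> y \<in> ?\<pi> ` K" if xy: "x \<in> ?\<pi> ` K" "y \<in> ?\<pi> ` K" for x y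
    proof -
      from xy obtain u v where uv: "u \<in> K" "v \<in> K" "x = ?\<pi> u" "y = ?\<pi> v" by blast
      then show ?thesis using subspace_plus[OF K' uv(1,2)] quot_add[OF V L' KA KA, of u v] by simp
    qed
    show "b \<odot>\<^bsub>quot A L\<^esub> x \<in> ?\<pi> ` K" if x: "x \<in> ?\<pi> ` K" for b x
    proof -
      from x obtain u where u: "u \<in> K" "x = ?\<pi> u" by blast
      then show ?thesis using subspace_smult[OF K' u(1), of b] quot_smult[OF V L' KA, of u b] by simp
    qed
  qed
  moreover have "x \<otimes>\<^bsub>quot A L\<^esub> b \<in> ?\<pi> ` K" "b \<otimes>\<^bsub>quot A L\<^esub> x \<in> ?\<pi> ` K"
    if b: "b \<in> ?\<pi> ` K" and x: "x \<in> carrier (quot A L)" for b x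
  proof -
    from b obtain u where u: "u \<in> K" "b = ?\<pi> u" by blast
    from x obtain v where v: "v \<in> carrier A" "x = ?\<pi> v" unfolding quot_carrier[OF V L'] by blast
    show "x \<otimes>\<^bsub>quot A L\<^esub> b \<in> ?\<pi> ` K"
      using K.I_l_closed[OF u(1) v(1)] quot_mult[OF L v(1) KA[OF u(1)]] u v by simp
    show "b \<otimes>\<^bsub>quot A L\<^esub> x \<in> ?\<pi> ` K"
      using K.I_r_closed[OF u(1) v(1)] quot_mult[OF L KA[OF u(1)] v(1)] u v by simp
  qed
  ultimately have "ideal (?\<pi> ` K) (quot A L)" by (intro subspace_ideal[OF RQ])
  then have "genideal (quot A L) (?\<pi> ` H) \<subseteq> ?\<pi> ` K"
    using H by (intro ring.genideal_minimal[OF RQ]) auto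
  then obtain b where b: "b \<in> K" "?\<pi> a = ?\<pi> b" using a(2) unfolding L_def by blast
  then obtain i where i: "i \<in> L" "a = i \<oplus>\<^bsub>A\<^esub> b" using quot_eq_iff[OF V L' a(1) KA[OF b(1)]] by auto
  have "i \<in> K" using i(1) LK by blast
  then show ?thesis using subspace_plus[OF K' _ b(1)] i(2) by simp
qed

section \<open>Graded symmetric powers\<close>

text \<open>
  The index set of a basis of the symmetric power: multisets in which basis vectors of odd
  degree, whose squares vanish, occur at most once.
\<close>

definition monomials :: "'i set \<Rightarrow> ('i \<Rightarrow> int) \<Rightarrow> nat \<Rightarrow> 'i multiset set" where
  "monomials I dg N = {\<mu>. set_mset \<mu> \<subseteq> I \<and> size \<mu> = N \<and> (\<forall>i. odd (dg i) \<longrightarrow> count \<mu> i \<le> 1)}"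

lemma finite_monomials:
  assumes "finite I"
  shows "finite (monomials I dg N)"
proof (rule finite_subset)
  show "monomials I dg N \<subseteq> mset ` {\<iota>. set \<iota> \<subseteq> I \<and> length \<iota> = N}"
  proof
    fix \<mu> assume "\<mu> \<in> monomials I dg N"
    moreover obtain \<iota> where "mset \<iota> = \<mu>" using ex_mset by blast
    ultimately show "\<mu> \<in> mset ` {\<iota>. set \<iota> \<subseteq> I \<and> length \<iota> = N}" by (auto simp: monomials_def)
  qed
  show "finite (mset ` {\<iota>. set \<iota> \<subseteq> I \<and> length \<iota> = N})"
    using finite_lists_length_eq[OF assms] by blast
qed

text \<open>
  The linear order on the index set serves to select one arrangement of each monomial. Characteristic zero
  is needed to conclude from \<open>2 x = 0\<close> that the square of an odd element vanishes.
\<close>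

locale homogeneous_basis =
  fixes V :: "('k::field_char_0, 'v) graded_module" and I :: "'i::linorder set"
    and e :: "'i \<Rightarrow> 'v" and c :: "'i \<Rightarrow> 'v \<Rightarrow> 'k" and dg :: "'i \<Rightarrow> int"
  assumes hc: "homogeneous_coordinates V I e c dg"
begin

lemma cs: "coordinate_system V I e c" by (rule homogeneous_coords[OF hc])
lemma VS: "vectorspace V" by (rule coords_vectorspace[OF cs])

subsection \<open>Monomial coefficients of words\<close>

text \<open>
  \<open>koszul w\<close> is the sign that relates the word \<open>w\<close> to its sorted rearrangement: each inversion between
  odd letters contributes \<open>-1\<close>. Repeated odd letters give \<open>0\<close>.
\<close>

definition commutation_sign :: "'i \<Rightarrow> 'i \<Rightarrow> 'k" where
  "commutation_sign a b = (if odd (dg a) \<and> odd (dg b) then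
     (if a = b then 0 else if b < a then -1 else 1) else 1)"

primrec koszul :: "'i list \<Rightarrow> 'k" where
  "koszul [] = 1"
| "koszul (a # w) = (\<Prod>b\<leftarrow>w. commutation_sign a b) * koszul w"

text \<open>
  Exchanging adjacent letters leaves every pair but one in its order, so the two signs differ only
  in the factor of that pair.
\<close>

lemma koszul_swap:
  "\<exists>r. koszul (u @ i # j # w) = commutation_sign i j * r \<and> koszul (u @ j # i # w) = commutation_sign j i * r"
proof (induction u)
  case Nil
  show ?case
    by (rule exI[of _ "(\<Prod>b\<leftarrow>w. commutation_sign i b) * (\<Prod>b\<leftarrow>w. commutation_sign j b) * koszul w"]) simp
next
  case (Cons a u)
  then obtain r where r: "koszul (u @ i # j # w) = commutation_sign i j * r"
    "koszul (u @ j # i # w) = commutation_sign j i * r" by blast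
  show ?case
    by (rule exI[of _ "(\<Prod>b\<leftarrow>u @ i # j # w. commutation_sign a b) * r"]) (simp add: r)
qed

lemma commutation_sign_swap:
  "commutation_sign i j = (-1) powi (dg i * dg j) * commutation_sign j i"
  by (auto simp: commutation_sign_def power_int_minus_left)

text \<open>
  The coefficient of the word \<open>\<iota>\<close> of basis vectors in the expansion of the tensor \<open>w\<close>, and the
  coefficient of the monomial \<open>\<mu>\<close> in the product of \<open>w\<close> in the symmetric power.
\<close>

definition word_coeff :: "'i list \<Rightarrow> 'v list \<Rightarrow> 'k" where
  "word_coeff \<iota> w = (if length \<iota> = length w then prod_list (map2 c \<iota> w) else 0)"

definition monomial_coeff :: "'i multiset \<Rightarrow> 'v list \<Rightarrow> 'k" where
  "monomial_coeff \<mu> w = (\<Sum>\<iota> | mset \<iota> = \<mu>. koszul \<iota> * word_coeff \<iota> w)"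

lemma finite_mset_eq: "finite {\<iota> :: 'b list. mset \<iota> = \<mu>}"
proof (rule finite_subset)
  show "{\<iota>. mset \<iota> = \<mu>} \<subseteq> {\<iota>. set \<iota> \<subseteq> set_mset \<mu> \<and> length \<iota> = size \<mu>}" by auto
  show "finite {\<iota>. set \<iota> \<subseteq> set_mset \<mu> \<and> length \<iota> = size \<mu>}" by (rule finite_lists_length_eq) simp
qed

lemma word_coeff_append:
  "length \<iota> = length w \<Longrightarrow> word_coeff (\<iota> @ \<iota>') (w @ w') = word_coeff \<iota> w * word_coeff \<iota>' w'"
  by (simp add: word_coeff_def)

lemma word_coeff_Cons: "word_coeff (i # \<iota>) (v # w) = c i v * word_coeff \<iota> w"
  by (simp add: word_coeff_def)

text \<open>
  As a function of one letter, \<open>word_coeff\<close> is a multiple of a single coordinate; its additivity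
  and homogeneity in each letter follow.
\<close>

lemma word_coeff_slot:
  assumes "set \<iota> \<subseteq> I"
  shows "(\<forall>v. word_coeff \<iota> (x @ v # y) = 0) \<or> (\<exists>a. \<exists>i\<in>I. \<forall>v. word_coeff \<iota> (x @ v # y) = a * c i v)"
proof (cases "length \<iota> = length x + Suc (length y)")
  case True
  define n where "n = length x"
  have n: "n < length \<iota>" using True by (simp add: n_def)
  have \<iota>: "\<iota> = take n \<iota> @ \<iota> ! n # drop (Suc n) \<iota>" using n by (rule id_take_nth_drop)
  have "word_coeff \<iota> (x @ v # y) = (word_coeff (take n \<iota>) x * word_coeff (drop (Suc n) \<iota>) y) * c (\<iota> ! n) v" for v
    by (subst \<iota>, subst word_coeff_append) (use n in \<open>simp_all add: n_def word_coeff_Cons\<close>)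
  moreover have "\<iota> ! n \<in> I" using assms n by auto
  ultimately show ?thesis by blast
qed (auto simp: word_coeff_def)

lemma word_coeff_add:
  assumes "set \<iota> \<subseteq> I" "v \<in> carrier V" "w \<in> carrier V"
  shows "word_coeff \<iota> (x @ (v \<oplus>\<^bsub>V\<^esub> w) # y) = word_coeff \<iota> (x @ v # y) + word_coeff \<iota> (x @ w # y)"
  using word_coeff_slot[OF assms(1), of x y] functional_add[OF coords_functional[OF cs] assms(2,3)]
  by (auto simp: distrib_left)

lemma word_coeff_smult:
  assumes "set \<iota> \<subseteq> I" "v \<in> carrier V"
  shows "word_coeff \<iota> (x @ (a \<odot>\<^bsub>V\<^esub> v) # y) = a * word_coeff \<iota> (x @ v # y)"
  using word_coeff_slot[OF assms(1), of x y] functional_smult[OF coords_functional[OF cs] assms(2)]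
  by auto

lemma monomial_coeff_add:
  assumes "set_mset \<mu> \<subseteq> I" "v \<in> carrier V" "w \<in> carrier V"
  shows "monomial_coeff \<mu> (x @ (v \<oplus>\<^bsub>V\<^esub> w) # y) = monomial_coeff \<mu> (x @ v # y) + monomial_coeff \<mu> (x @ w # y)"
  unfolding monomial_coeff_def sum.distrib[symmetric]
  by (rule sum.cong) (use assms in \<open>auto simp: word_coeff_add distrib_left\<close>)

lemma monomial_coeff_smult:
  assumes "set_mset \<mu> \<subseteq> I" "v \<in> carrier V"
  shows "monomial_coeff \<mu> (x @ (a \<odot>\<^bsub>V\<^esub> v) # y) = a * monomial_coeff \<mu> (x @ v # y)"
  unfolding monomial_coeff_def sum_distrib_left
  by (rule sum.cong) (use assms in \<open>auto simp: word_coeff_smult\<close>)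

text \<open>
  Exchanging the two letters corresponds to exchanging the two entries of every arrangement \<open>\<iota>\<close>, a
  bijection on the arrangements of \<open>\<mu>\<close>. Only entries of degrees \<open>p\<close> and \<open>q\<close> contribute, and for these the
  Koszul signs differ by the required factor.
\<close>

lemma monomial_coeff_swap:
  assumes \<mu>: "set_mset \<mu> \<subseteq> I" and v: "v \<in> degpart V p" and w: "w \<in> degpart V q"
  shows "monomial_coeff \<mu> (x @ v # w # y) = (-1) powi (p * q) * monomial_coeff \<mu> (x @ w # v # y)"
proof (cases "size \<mu> = length x + Suc (Suc (length y))")
  case False
  have "word_coeff \<iota> (x @ a # b # y) = 0" if "mset \<iota> = \<mu>" for \<iota> a b
    using False that by (auto simp: word_coeff_def)
  then show ?thesis by (simp add: monomial_coeff_def)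
next
  case True
  define n where "n = length x"
  \<comment> \<open>Exchange of the entries at positions \<open>n\<close> and \<open>n + 1\<close>.\<close>
  define sw where "sw \<iota> = take n \<iota> @ \<iota> ! Suc n # \<iota> ! n # drop (Suc (Suc n)) \<iota>" for \<iota> :: "'i list"
  have split: "\<exists>\<alpha> i j \<beta>. \<iota> = \<alpha> @ i # j # \<beta> \<and> length \<alpha> = n \<and> length \<beta> = length y" if "mset \<iota> = \<mu>" for \<iota>
  proof (intro exI conjI)
    have len: "length \<iota> = n + Suc (Suc (length y))" using that True by (auto simp: n_def)
    show "\<iota> = take n \<iota> @ \<iota> ! n # \<iota> ! Suc n # drop (Suc (Suc n)) \<iota>"
      using len by (metis Cons_nth_drop_Suc add.commute add_Suc_right append_take_drop_id less_add_Suc1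
          less_add_Suc2 Suc_less_eq add_Suc)
    show "length (take n \<iota>) = n" "length (drop (Suc (Suc n)) \<iota>) = length y" using len by simp_all
  qed
  have sw: "sw (\<alpha> @ i # j # \<beta>) = \<alpha> @ j # i # \<beta>" if "length \<alpha> = n" for \<alpha> i j \<beta>
    using that by (simp add: sw_def nth_append)
  show ?thesis
    unfolding monomial_coeff_def sum_distrib_left
  proof (rule sum.reindex_bij_witness[of _ sw sw])
    fix \<iota> assume "\<iota> \<in> {\<iota>. mset \<iota> = \<mu>}"
    then have \<iota>: "mset \<iota> = \<mu>" by simp
    obtain \<alpha> i j \<beta> where s: "\<iota> = \<alpha> @ i # j # \<beta>" "length \<alpha> = n" "length \<beta> = length y" using split[OF \<iota>] by blast
    show "sw (sw \<iota>) = \<iota>" "sw (sw \<iota>) = \<iota>" using s by (simp_all add: sw)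
    show "sw \<iota> \<in> {\<iota>. mset \<iota> = \<mu>}" "sw \<iota> \<in> {\<iota>. mset \<iota> = \<mu>}" using s \<iota> by (auto simp: sw)
    obtain r where r: "koszul (\<alpha> @ i # j # \<beta>) = commutation_sign i j * r"
      "koszul (\<alpha> @ j # i # \<beta>) = commutation_sign j i * r" using koszul_swap by blast
    have wc: "word_coeff (\<alpha> @ i # j # \<beta>) (x @ v # w # y) = word_coeff \<alpha> x * (c i v * (c j w * word_coeff \<beta> y))"
      "word_coeff (\<alpha> @ j # i # \<beta>) (x @ w # v # y) = word_coeff \<alpha> x * (c j w * (c i v * word_coeff \<beta> y))"
      using s by (simp_all add: word_coeff_append n_def word_coeff_Cons)
    have ij: "i \<in> I" "j \<in> I" using \<mu> \<iota> s(1) by auto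
    show "(-1) powi (p * q) * (koszul (sw \<iota>) * word_coeff (sw \<iota>) (x @ w # v # y)) =
        koszul \<iota> * word_coeff \<iota> (x @ v # w # y)"
    proof (cases "c i v = 0 \<or> c j w = 0")
      case True
      then show ?thesis using s by (auto simp: sw wc)
    next
      case False
      then have "dg i = p" "dg j = q"
        using v w ij unfolding homogeneous_degpart[OF hc] by auto
      then show ?thesis
        using commutation_sign_swap[of i j] unfolding s(1) sw[OF s(2)] wc r by simp
    qed
  qed
qed

lemma word_coeff_basis:
  assumes "set \<iota> \<subseteq> I" "set \<kappa> \<subseteq> I"
  shows "word_coeff \<iota> (map e \<kappa>) = (if \<iota> = \<kappa> then 1 else 0)"
  using assms
proof (induction \<iota> arbitrary: \<kappa>)
  case Nil
  then show ?case by (auto simp: word_coeff_def)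
next
  case (Cons i \<iota>)
  then show ?case
    using coords_dual[OF cs, of i] by (cases \<kappa>) (auto simp: word_coeff_Cons, auto simp: word_coeff_def)
qed

lemma monomial_coeff_basis:
  assumes "set_mset \<mu> \<subseteq> I" "set \<kappa> \<subseteq> I"
  shows "monomial_coeff \<mu> (map e \<kappa>) = (if mset \<kappa> = \<mu> then koszul \<kappa> else 0)"
proof -
  have "monomial_coeff \<mu> (map e \<kappa>) = (\<Sum>\<iota> | mset \<iota> = \<mu>. if \<iota> = \<kappa> then koszul \<kappa> else 0)"
    unfolding monomial_coeff_def by (rule sum.cong) (use assms in \<open>auto simp: word_coeff_basis\<close>)
  then show ?thesis using finite_mset_eq[of \<mu>] by simp
qed

lemma word_coeff_degree:
  assumes "list_all2 (\<lambda>d v. v \<in> degpart V d) ds w" "set \<iota> \<subseteq> I" "word_coeff \<iota> w \<noteq> 0"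
  shows "map dg \<iota> = ds"
  using assms
proof (induction ds w arbitrary: \<iota> rule: list_all2_induct)
  case Nil
  then show ?case by (auto simp: word_coeff_def split: if_splits)
next
  case (Cons d ds v w)
  then obtain i \<iota>' where \<iota>: "\<iota> = i # \<iota>'" by (cases \<iota>) (auto simp: word_coeff_def)
  then have "c i v \<noteq> 0" "word_coeff \<iota>' w \<noteq> 0" using Cons.prems by (auto simp: word_coeff_Cons)
  then show ?case
    using Cons.IH[of \<iota>'] Cons.prems Cons.hyps(1) \<iota> unfolding homogeneous_degpart[OF hc] by auto
qed

lemma monomial_coeff_degree:
  assumes ds: "list_all2 (\<lambda>d v. v \<in> degpart V d) ds w" and \<mu>: "set_mset \<mu> \<subseteq> I"
    and nz: "monomial_coeff \<mu> w \<noteq> 0"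
  shows "(\<Sum>i\<in>#\<mu>. dg i) = sum_list ds"
proof -
  obtain \<iota> where \<iota>: "mset \<iota> = \<mu>" "word_coeff \<iota> w \<noteq> 0"
    using nz unfolding monomial_coeff_def by (metis (mono_tags, lifting) mem_Collect_eq mult_zero_right sum.neutral)
  then have "map dg \<iota> = ds" using word_coeff_degree[OF ds, of \<iota>] \<mu> by auto
  then show ?thesis using \<iota>(1) by (metis mset_map sum_mset_sum_list)
qed

text \<open>
  A sorted word has no inversions, so the coefficient functionals take the value \<open>1\<close> on sorted monomials.
\<close>

lemma koszul_sorted:
  "sorted w \<Longrightarrow> (\<And>i. odd (dg i) \<Longrightarrow> count (mset w) i \<le> 1) \<Longrightarrow> koszul w = 1"
proof (induction w)
  case (Cons a w)
  have "commutation_sign a b = 1" if b: "b \<in> set w" for b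
  proof -
    have "a \<noteq> b" if "odd (dg a)"
    proof
      assume "a = b"
      then have "count (mset w) a \<ge> 1" using b by (simp add: Suc_leI)
      then show False using Cons.prems(2)[OF that] by simp
    qed
    moreover have "a \<le> b" using Cons.prems(1) b by simp
    ultimately show ?thesis by (auto simp: commutation_sign_def)
  qed
  then have "(\<Prod>b\<leftarrow>w. commutation_sign a b) = 1"
    by (induction w) auto
  moreover have "koszul w = 1"
  proof (rule Cons.IH)
    show "sorted w" using Cons.prems(1) by simp
    show "count (mset w) i \<le> 1" if "odd (dg i)" for i
      by (rule order_trans[OF _ Cons.prems(2)[OF that]]) simp
  qed
  ultimately show ?case by simp
qed simp

subsection \<open>Relations between words\<close>

text \<open>
  The tensor and symmetric algebras are described as successive quotients of the free algebra
  \<open>FA\<close> on the vectors of \<open>V\<close>: \<open>L\<close> is the ideal of the linearity relations, \<open>TA\<close> the tensor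
  algebra, \<open>C\<close> the commutation ideal in it and \<open>SA\<close> the symmetric algebra. In the commutation
  relations the sign is moved into the coefficient of the word.
\<close>

abbreviation FA :: "('k, 'v list \<Rightarrow>\<^sub>0 'k) module" where "FA \<equiv> free_algebra (carrier V)"

abbreviation single_word :: "'v list \<Rightarrow> 'v list \<Rightarrow>\<^sub>0 'k" where
  "single_word w \<equiv> Poly_Mapping.single w 1"

definition linearity_relations :: "('v list \<Rightarrow>\<^sub>0 'k) set" where
  "linearity_relations =
     {single_word [v \<oplus>\<^bsub>V\<^esub> w] - single_word [v] - single_word [w] | v w. v \<in> carrier V \<and> w \<in> carrier V} \<union>
     {single_word [a \<odot>\<^bsub>V\<^esub> v] - Poly_Mapping.single [v] a | a v. v \<in> carrier V}"

definition commutation_relations :: "('v list \<Rightarrow>\<^sub>0 'k) set" where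
  "commutation_relations = {single_word [v, w] - Poly_Mapping.single [w, v] ((-1) powi (p * q)) | p q v w.
     v \<in> degpart V p \<and> w \<in> degpart V q}"

lemma single_word_mult: "single_word u * Poly_Mapping.single v a = Poly_Mapping.single (u @ v) a"
  "Poly_Mapping.single u a * single_word v = Poly_Mapping.single (u @ v) a"
  by (simp_all add: mult_single plus_list_def)

lemma degpart_carrier: "v \<in> degpart V d \<Longrightarrow> v \<in> carrier V"
  using homogeneous_degpart[OF hc] by auto

lemma FA_diff: "f \<in> carrier FA \<Longrightarrow> g \<in> carrier FA \<Longrightarrow> f - g \<in> carrier FA"
  using keys_diff[of f g] by auto

lemma FA_single: "u \<in> lists (carrier V) \<Longrightarrow> Poly_Mapping.single u a \<in> carrier FA"
  by simp

lemma relations_carrier: "linearity_relations \<subseteq> carrier FA" "commutation_relations \<subseteq> carrier FA"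
  unfolding linearity_relations_def commutation_relations_def
  by (auto intro!: FA_diff FA_single vs_add_closed[OF VS] vs_smult_closed[OF VS] dest: degpart_carrier
      simp del: free_algebra_simps)

definition L where "L = genideal FA linearity_relations"

lemma L_ideal: "ideal L FA"
  unfolding L_def by (rule ring.genideal_ideal[OF free_algebra_ring relations_carrier(1)])

lemma L_eq: "linearity_ideal V = L"
  unfolding L_def linearity_ideal_def linearity_relations_def ..

abbreviation TA where "TA \<equiv> quot FA L"

lemma TA_eq: "tensor_algebra V = TA" by (simp add: tensor_algebra_def L_eq)

lemma TA_unital: "unital_algebra TA" by (rule unital_algebra_quot[OF free_algebra_unital L_ideal])

lemma FAV: "vectorspace FA" by (rule free_algebra_vectorspace)

lemma TAV: "vectorspace TA" and TAR: "ring TA" using TA_unital unfolding unital_algebra_def by blast+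

lemma L_subspace: "subspace_of L FA" by (rule ideal_subspace[OF free_algebra_unital L_ideal])

abbreviation toTA where "toTA x \<equiv> L +>\<^bsub>FA\<^esub> x"

lemma toTA_carrier: "x \<in> carrier FA \<Longrightarrow> toTA x \<in> carrier TA"
  using quot_carrier[OF FAV L_subspace] by blast

definition C where "C = genideal TA (toTA ` commutation_relations)"

lemma C_ideal: "ideal C TA"
proof -
  have "toTA ` commutation_relations \<subseteq> carrier TA"
    using relations_carrier(2) toTA_carrier by blast
  then show ?thesis unfolding C_def by (rule ring.genideal_ideal[OF TAR])
qed

lemma toTA_commutation_relation:
  assumes "v \<in> carrier V" "w \<in> carrier V"
  shows "(toTA (single_word [v]) \<otimes>\<^bsub>TA\<^esub> toTA (single_word [w]))
     \<ominus>\<^bsub>TA\<^esub> (s \<odot>\<^bsub>TA\<^esub> (toTA (single_word [w]) \<otimes>\<^bsub>TA\<^esub> toTA (single_word [v])))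
   = toTA (single_word [v, w] - Poly_Mapping.single [w, v] s)"
proof -
  have 1: "toTA (single_word [v]) \<otimes>\<^bsub>TA\<^esub> toTA (single_word [w]) = toTA (single_word [v, w])"
    if "v \<in> carrier V" "w \<in> carrier V" for v w
    using quot_mult[OF L_ideal, of "single_word [v]" "single_word [w]"] that
    by (simp add: free_algebra_mult single_word_mult)
  have 2: "a \<odot>\<^bsub>TA\<^esub> toTA (Poly_Mapping.single u b) = toTA (Poly_Mapping.single u (a * b))"
    if "u \<in> lists (carrier V)" for a b u
    using quot_smult[OF FAV L_subspace FA_single[OF that], of a b] by simp
  have 3: "toTA (Poly_Mapping.single u b) \<in> carrier TA" if "u \<in> lists (carrier V)" for u b
    by (rule toTA_carrier[OF FA_single[OF that]])
  have "toTA (single_word [v, w]) \<ominus>\<^bsub>TA\<^esub> toTA (Poly_Mapping.single [w, v] s)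
      = toTA (single_word [v, w]) \<oplus>\<^bsub>TA\<^esub> toTA (Poly_Mapping.single [w, v] (- s))"
    using vs_minus[OF TAV 3, of "[w, v]" s] 2[of "[w, v]" "-1" s] assms by (simp add: a_minus_def)
  also have "\<dots> = toTA (single_word [v, w] - Poly_Mapping.single [w, v] s)"
    using quot_add[OF FAV L_subspace FA_single FA_single, of "[v, w]" "[w, v]" 1 "- s"] assms
    by (simp add: single_uminus)
  finally show ?thesis using assms by (simp add: 1 2)
qed

lemma C_eq: "commutation_ideal V = C"
proof -
  have "{(tensor_word V [v] \<otimes>\<^bsub>TA\<^esub> tensor_word V [w])
        \<ominus>\<^bsub>TA\<^esub> (((-1) powi (p * q)) \<odot>\<^bsub>TA\<^esub> (tensor_word V [w] \<otimes>\<^bsub>TA\<^esub> tensor_word V [v])) | p q v w.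
        v \<in> degpart V p \<and> w \<in> degpart V q}
      = {toTA (single_word [v, w] - Poly_Mapping.single [w, v] ((-1) powi (p * q))) | p q v w.
         v \<in> degpart V p \<and> w \<in> degpart V q}" (is "?A = ?B")
    unfolding tensor_word_def L_eq
    using toTA_commutation_relation[OF degpart_carrier degpart_carrier] by (intro Collect_cong) metis
  also have "?B = toTA ` commutation_relations"
    unfolding commutation_relations_def by blast
  finally show ?thesis unfolding commutation_ideal_def C_def TA_eq by simp
qed

abbreviation SA where "SA \<equiv> quot TA C"

lemma SA_eq: "symmetric_algebra V = SA" by (simp add: symmetric_algebra_def TA_eq C_eq)

lemma C_subspace: "subspace_of C TA" by (rule ideal_subspace[OF TA_unital C_ideal])

lemma SAV: "vectorspace SA" by (rule quot_vectorspace[OF TAV C_subspace])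

definition toSA where "toSA x = C +>\<^bsub>TA\<^esub> toTA x"

lemma symmetric_word_eq: "symmetric_word V w = toSA (single_word w)"
  by (simp add: symmetric_word_def toSA_def C_eq TA_eq tensor_word_def L_eq)

lemma toSA_add: "x \<in> carrier FA \<Longrightarrow> y \<in> carrier FA \<Longrightarrow> toSA (x + y) = toSA x \<oplus>\<^bsub>SA\<^esub> toSA y"
  using quot_add[OF FAV L_subspace, of x y] quot_add[OF TAV C_subspace toTA_carrier toTA_carrier, of x y]
  unfolding toSA_def by simp

lemma toSA_smult: "x \<in> carrier FA \<Longrightarrow> toSA (pscale a x) = a \<odot>\<^bsub>SA\<^esub> toSA x"
  using quot_smult[OF FAV L_subspace, of x a] quot_smult[OF TAV C_subspace toTA_carrier, of x a]
  unfolding toSA_def by simp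

lemma toSA_carrier: "x \<in> carrier FA \<Longrightarrow> toSA x \<in> carrier SA"
  using quot_carrier[OF TAV C_subspace] toTA_carrier unfolding toSA_def by blast

text \<open>
  The kernel of the composite map \<open>toSA\<close> from the free algebra to the symmetric algebra.
\<close>

definition relation_ideal where "relation_ideal = {x \<in> carrier FA. toTA x \<in> C}"

lemma relation_ideal_ideal: "ideal relation_ideal FA"
  unfolding relation_ideal_def by (rule ideal_double_quotient[OF free_algebra_unital L_ideal C_ideal])

lemma toSA_eqI:
  assumes "x \<in> carrier FA" "y \<in> carrier FA" "x - y \<in> relation_ideal"
  shows "toSA x = toSA y"
proof -
  have "toSA (x - y) = \<zero>\<^bsub>SA\<^esub>"
    using assms(3) quot_eq_zero_iff[OF TAV C_subspace toTA_carrier] unfolding relation_ideal_def toSA_def by blast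
  then have "toSA x = \<zero>\<^bsub>SA\<^esub> \<oplus>\<^bsub>SA\<^esub> toSA y" using toSA_add[OF FA_diff[OF assms(1,2)] assms(2)] by simp
  then show ?thesis
    using abelian_monoid.l_zero[OF abelian_group.axioms(1)[OF vs_abelian_group[OF SAV]] toSA_carrier[OF assms(2)]]
    by simp
qed

lemma relations_subset: "linearity_relations \<subseteq> relation_ideal" "commutation_relations \<subseteq> relation_ideal"
proof -
  have "linearity_relations \<subseteq> L"
    unfolding L_def by (rule ring.genideal_self[OF free_algebra_ring relations_carrier(1)])
  moreover have "toTA x \<in> C" if x: "x \<in> L" for x
  proof -
    have xF: "x \<in> carrier FA" using subspace_carrier[OF L_subspace] x by blast
    have "toTA x = \<zero>\<^bsub>TA\<^esub>" using quot_eq_zero_iff[OF FAV L_subspace xF] x by simp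
    then show ?thesis using subspace_zero[OF C_subspace] by simp
  qed
  ultimately show "linearity_relations \<subseteq> relation_ideal" using relations_carrier(1) unfolding relation_ideal_def by blast
  have "toTA ` commutation_relations \<subseteq> C"
    unfolding C_def by (rule ring.genideal_self[OF TAR]) (use relations_carrier(2) toTA_carrier in blast)
  then show "commutation_relations \<subseteq> relation_ideal" using relations_carrier(2) unfolding relation_ideal_def by blast
qed

lemma relation_ideal_sandwich:
  assumes "r \<in> relation_ideal" "x \<in> lists (carrier V)" "y \<in> lists (carrier V)"
  shows "single_word x * r * single_word y \<in> relation_ideal"
proof -
  interpret ideal relation_ideal FA by (rule relation_ideal_ideal)
  show ?thesis
    using I_r_closed[OF I_l_closed[OF assms(1) FA_single[OF assms(2), of 1]] FA_single[OF assms(3), of 1]]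
    by (simp add: free_algebra_mult)
qed

lemma toSA_word_add:
  assumes xy: "x \<in> lists (carrier V)" "y \<in> lists (carrier V)" and vw: "v \<in> carrier V" "w \<in> carrier V"
  shows "toSA (single_word (x @ (v \<oplus>\<^bsub>V\<^esub> w) # y))
    = toSA (single_word (x @ v # y)) \<oplus>\<^bsub>SA\<^esub> toSA (single_word (x @ w # y))"
proof -
  have "single_word [v \<oplus>\<^bsub>V\<^esub> w] - single_word [v] - single_word [w] \<in> linearity_relations"
    unfolding linearity_relations_def using vw by blast
  then have "single_word x * (single_word [v \<oplus>\<^bsub>V\<^esub> w] - single_word [v] - single_word [w]) * single_word y \<in> relation_ideal"
    using relations_subset(1) relation_ideal_sandwich[OF _ xy] by blast
  then have "single_word (x @ (v \<oplus>\<^bsub>V\<^esub> w) # y) - (single_word (x @ v # y) + single_word (x @ w # y)) \<in> relation_ideal"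
    by (simp add: left_diff_distrib right_diff_distrib distrib_left distrib_right single_word_mult diff_diff_eq)
  moreover have F: "single_word (x @ v # y) \<in> carrier FA" if "v \<in> carrier V" for v
    using xy that by (intro FA_single) auto
  ultimately have "toSA (single_word (x @ (v \<oplus>\<^bsub>V\<^esub> w) # y)) = toSA (single_word (x @ v # y) + single_word (x @ w # y))"
    using F[OF vs_add_closed[OF VS vw]] vs_add_closed[OF FAV F[OF vw(1)] F[OF vw(2)]] by (intro toSA_eqI) simp_all
  then show ?thesis using toSA_add[OF F[OF vw(1)] F[OF vw(2)]] by simp
qed

lemma toSA_word_smult:
  assumes xy: "x \<in> lists (carrier V)" "y \<in> lists (carrier V)" and v: "v \<in> carrier V"
  shows "toSA (single_word (x @ (a \<odot>\<^bsub>V\<^esub> v) # y)) = a \<odot>\<^bsub>SA\<^esub> toSA (single_word (x @ v # y))"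
proof -
  have "single_word [a \<odot>\<^bsub>V\<^esub> v] - Poly_Mapping.single [v] a \<in> linearity_relations"
    unfolding linearity_relations_def using v by blast
  then have "single_word x * (single_word [a \<odot>\<^bsub>V\<^esub> v] - Poly_Mapping.single [v] a) * single_word y \<in> relation_ideal"
    using relations_subset(1) relation_ideal_sandwich[OF _ xy] by blast
  then have "single_word (x @ (a \<odot>\<^bsub>V\<^esub> v) # y) - Poly_Mapping.single (x @ v # y) a \<in> relation_ideal"
    by (simp add: left_diff_distrib right_diff_distrib single_word_mult)
  moreover have F: "Poly_Mapping.single (x @ v # y) b \<in> carrier FA" if "v \<in> carrier V" for v b
    using xy that by (intro FA_single) auto
  ultimately have "toSA (single_word (x @ (a \<odot>\<^bsub>V\<^esub> v) # y)) = toSA (Poly_Mapping.single (x @ v # y) a)"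
    using F[OF vs_smult_closed[OF VS v]] F[OF v] by (intro toSA_eqI)
  then show ?thesis using toSA_smult[OF F[OF v], of a 1] by simp
qed

lemma toSA_word_swap:
  assumes xy: "x \<in> lists (carrier V)" "y \<in> lists (carrier V)"
    and v: "v \<in> degpart V p" and w: "w \<in> degpart V q"
  shows "toSA (single_word (x @ v # w # y)) = ((-1) powi (p * q)) \<odot>\<^bsub>SA\<^esub> toSA (single_word (x @ w # v # y))"
proof -
  let ?s = "(-1) powi (p * q) :: 'k"
  have "single_word [v, w] - Poly_Mapping.single [w, v] ?s \<in> commutation_relations"
    unfolding commutation_relations_def using v w by blast
  then have "single_word x * (single_word [v, w] - Poly_Mapping.single [w, v] ?s) * single_word y \<in> relation_ideal"
    using relations_subset(2) relation_ideal_sandwich[OF _ xy] by blast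
  then have "single_word (x @ v # w # y) - Poly_Mapping.single (x @ w # v # y) ?s \<in> relation_ideal"
    by (simp add: left_diff_distrib right_diff_distrib single_word_mult)
  moreover have F: "Poly_Mapping.single (x @ v # w # y) b \<in> carrier FA" if "v \<in> carrier V" "w \<in> carrier V" for v w b
    using xy that by (intro FA_single) auto
  ultimately have "toSA (single_word (x @ v # w # y)) = toSA (Poly_Mapping.single (x @ w # v # y) ?s)"
    using degpart_carrier[OF v] degpart_carrier[OF w] by (intro toSA_eqI F)
  then show ?thesis
    using toSA_smult[OF F[OF degpart_carrier[OF w] degpart_carrier[OF v]], of ?s 1] by simp
qed

text \<open>
  The linear extension of \<open>monomial_coeff \<mu>\<close> to the free algebra kills all relations, also between words:
  the linearity relations because the coefficients are multilinear, and the commutation relations by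
  \<open>monomial_coeff_swap\<close>. Hence it descends to the symmetric algebra.
\<close>

lemma monomial_functional:
  assumes \<mu>: "set_mset \<mu> \<subseteq> I"
  shows "\<exists>g. linear_functional SA g \<and> (\<forall>w\<in>lists (carrier V). g (toSA (single_word w)) = monomial_coeff \<mu> w)"
proof -
  let ?h = "free_extension (monomial_coeff \<mu>)"
  define K where "K = {a \<in> carrier FA. \<forall>x\<in>lists (carrier V). \<forall>y\<in>lists (carrier V).
       ?h (single_word x * a * single_word y) = 0}"
  have K: "ideal K FA" unfolding K_def by (rule free_extension_ideal)
  have "linearity_relations \<subseteq> K"
  proof
    fix r assume r: "r \<in> linearity_relations"
    have "?h (single_word x * r * single_word y) = 0" for x y
      using r unfolding linearity_relations_def
      by (auto simp: left_diff_distrib right_diff_distrib single_word_mult monomial_coeff_add[OF \<mu>]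
          monomial_coeff_smult[OF \<mu>])
    then show "r \<in> K" using r relations_carrier(1) unfolding K_def by blast
  qed
  moreover have "commutation_relations \<subseteq> K"
  proof
    fix r assume r: "r \<in> commutation_relations"
    then obtain p q v w where vw: "v \<in> degpart V p" "w \<in> degpart V q"
      and r_eq: "r = single_word [v, w] - Poly_Mapping.single [w, v] ((-1) powi (p * q))"
      unfolding commutation_relations_def by blast
    have "?h (single_word x * r * single_word y) = 0" for x y
      using monomial_coeff_swap[OF \<mu> vw, of x y]
      by (simp add: r_eq left_diff_distrib right_diff_distrib single_word_mult)
    then show "r \<in> K" using r relations_carrier(2) unfolding K_def by blast
  qed
  ultimately have NK: "relation_ideal \<subseteq> K"
    using double_quotient_minimal[OF free_algebra_unital relations_carrier(1) K]
    unfolding relation_ideal_def C_def L_def by (intro subsetI) simp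
  have h0: "?h x = 0" if "x \<in> relation_ideal" for x
  proof -
    have "x \<in> K" using NK that by blast
    then have "?h (single_word [] * x * single_word []) = 0" unfolding K_def by blast
    then show ?thesis by (simp add: single_Nil_eq_one)
  qed
  have lf: "linear_functional FA ?h" unfolding linear_functional_def by simp
  have LN: "L \<subseteq> relation_ideal"
  proof
    fix x assume x: "x \<in> L"
    have xF: "x \<in> carrier FA" using subspace_carrier[OF L_subspace] x by blast
    have "toTA x = \<zero>\<^bsub>TA\<^esub>" using quot_eq_zero_iff[OF FAV L_subspace xF] x by simp
    then show "x \<in> relation_ideal" using subspace_zero[OF C_subspace] xF unfolding relation_ideal_def by simp
  qed
  have ker1: "?h x = 0" if "x \<in> L" for x using h0 LN that by blast
  obtain g1 where g1: "linear_functional TA g1" "\<And>x. x \<in> carrier FA \<Longrightarrow> g1 (toTA x) = ?h x"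
    by (rule quot_functional[OF FAV L_subspace lf ker1, OF _ that]) assumption+
  have ker2: "g1 t = 0" if t: "t \<in> C" for t
  proof -
    have "t \<in> carrier TA" using subspace_carrier[OF C_subspace] t by blast
    then obtain x where x: "x \<in> carrier FA" "t = toTA x" unfolding quot_carrier[OF FAV L_subspace] by blast
    then have "x \<in> relation_ideal" using t unfolding relation_ideal_def by simp
    then show ?thesis using h0 g1(2) x by simp
  qed
  obtain g where g: "linear_functional SA g" "\<And>x. x \<in> carrier TA \<Longrightarrow> g (C +>\<^bsub>TA\<^esub> x) = g1 x"
    by (rule quot_functional[OF TAV C_subspace g1(1) ker2, OF _ that]) assumption+
  have "g (toSA (single_word w)) = monomial_coeff \<mu> w" if w: "w \<in> lists (carrier V)" for w
    using g(2)[OF toTA_carrier[OF FA_single[OF w, of 1]]] g1(2)[OF FA_single[OF w, of 1]] by (simp add: toSA_def)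
  with g(1) show ?thesis by blast
qed

subsection \<open>Monomials span\<close>

abbreviation basis_word :: "'i list \<Rightarrow> ('v list \<Rightarrow>\<^sub>0 'k) set set" where
  "basis_word \<kappa> \<equiv> toSA (single_word (map e \<kappa>))"

lemma map_e_lists: "set \<kappa> \<subseteq> I \<Longrightarrow> map e \<kappa> \<in> lists (carrier V)"
  using coords_carrier[OF cs] by (auto simp: subset_iff)

lemma basis_word_carrier: "set \<kappa> \<subseteq> I \<Longrightarrow> basis_word \<kappa> \<in> carrier SA"
  by (rule toSA_carrier[OF FA_single[OF map_e_lists]])

lemma basis_word_swap:
  assumes "set u \<subseteq> I" "set w \<subseteq> I" "i \<in> I" "j \<in> I"
  shows "basis_word (u @ i # j # w) = ((-1) powi (dg i * dg j)) \<odot>\<^bsub>SA\<^esub> basis_word (u @ j # i # w)"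
  using toSA_word_swap[OF map_e_lists[OF assms(1)] map_e_lists[OF assms(2)]
      homogeneous_basis_degpart[OF hc assms(3)] homogeneous_basis_degpart[OF hc assms(4)]] by simp

lemma basis_word_move:
  assumes "set u \<subseteq> I" "set x \<subseteq> I" "set w \<subseteq> I" "i \<in> I"
  shows "\<exists>a. basis_word (u @ i # x @ w) = a \<odot>\<^bsub>SA\<^esub> basis_word (u @ x @ i # w)"
  using assms
proof (induction x arbitrary: u)
  case Nil
  then show ?case
    using vs_smult_one[OF SAV basis_word_carrier[of "u @ i # w"]] by (intro exI[of _ 1]) simp
next
  case (Cons j x)
  obtain a where a: "basis_word ((u @ [j]) @ i # x @ w) = a \<odot>\<^bsub>SA\<^esub> basis_word ((u @ [j]) @ x @ i # w)"
    using Cons.IH[of "u @ [j]"] Cons.prems by auto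
  have "basis_word (u @ i # j # x @ w) = ((-1) powi (dg i * dg j)) \<odot>\<^bsub>SA\<^esub> basis_word (u @ j # i # x @ w)"
    using Cons.prems by (intro basis_word_swap) auto
  also have "\<dots> = ((-1) powi (dg i * dg j)) \<odot>\<^bsub>SA\<^esub> (a \<odot>\<^bsub>SA\<^esub> basis_word (u @ (j # x) @ i # w))"
    using a by simp
  also have "\<dots> = ((-1) powi (dg i * dg j) * a) \<odot>\<^bsub>SA\<^esub> basis_word (u @ (j # x) @ i # w)"
    by (rule vs_smult_assoc[OF SAV basis_word_carrier, symmetric]) (use Cons.prems in auto)
  finally show ?case by auto
qed

text \<open>
  Two arrangements of the same letters are proportional, since adjacent letters commute up to sign.
  The factor is left unspecified because only the span matters.
\<close>

lemma basis_word_permute: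
  assumes "mset \<kappa> = mset \<kappa>'" "set u \<subseteq> I" "set \<kappa> \<subseteq> I"
  shows "\<exists>a. basis_word (u @ \<kappa>) = a \<odot>\<^bsub>SA\<^esub> basis_word (u @ \<kappa>')"
  using assms
proof (induction \<kappa> arbitrary: u \<kappa>')
  case Nil
  then show ?case using vs_smult_one[OF SAV basis_word_carrier[of u]] by (intro exI[of _ 1]) simp
next
  case (Cons i \<kappa>)
  have "set \<kappa>' = set (i # \<kappa>)" using Cons.prems(1) by (metis set_mset_mset)
  then obtain x y where \<kappa>': "\<kappa>' = x @ i # y" using split_list[of i \<kappa>'] by auto
  have sets: "set x \<subseteq> I" "set y \<subseteq> I" "i \<in> I" using \<open>set \<kappa>' = set (i # \<kappa>)\<close> Cons.prems \<kappa>' by auto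
  have "mset \<kappa> = mset (x @ y)" using Cons.prems(1) \<kappa>' by simp
  then obtain a where a: "basis_word ((u @ [i]) @ \<kappa>) = a \<odot>\<^bsub>SA\<^esub> basis_word ((u @ [i]) @ x @ y)"
    using Cons.IH[of "x @ y" "u @ [i]"] Cons.prems by auto
  obtain b where b: "basis_word (u @ i # x @ y) = b \<odot>\<^bsub>SA\<^esub> basis_word (u @ x @ i # y)"
    using basis_word_move[OF Cons.prems(2) sets] by blast
  have carr: "basis_word (u @ x @ i # y) \<in> carrier SA"
    using sets Cons.prems(2) by (intro basis_word_carrier) auto
  have "basis_word (u @ i # \<kappa>) = a \<odot>\<^bsub>SA\<^esub> (b \<odot>\<^bsub>SA\<^esub> basis_word (u @ x @ i # y))"
    using a b by simp
  also have "\<dots> = (a * b) \<odot>\<^bsub>SA\<^esub> basis_word (u @ \<kappa>')"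
    unfolding \<kappa>' by (rule vs_smult_assoc[OF SAV carr, symmetric])
  finally show ?case by auto
qed

text \<open>
  Move two equal odd letters to the front. Exchanging them changes the sign, so twice the word is
  zero.
\<close>

lemma basis_word_odd_square:
  assumes i: "odd (dg i)" "count (mset \<kappa>) i \<ge> 2" and \<kappa>: "set \<kappa> \<subseteq> I"
  shows "basis_word \<kappa> = \<zero>\<^bsub>SA\<^esub>"
proof -
  have "i \<in># mset \<kappa>" using i(2) by (intro count_inI) simp
  then obtain M where M: "mset \<kappa> = add_mset i M" by (meson multi_member_split)
  then have "i \<in># M" using i(2) by (intro count_inI) simp
  then obtain M' where M': "M = add_mset i M'" by (meson multi_member_split)
  obtain r where r_eq: "mset r = M'" using ex_mset[of M'] by auto
  have m: "mset \<kappa> = mset (i # i # r)" using M M' r_eq by simp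
  then have "set (i # i # r) = set \<kappa>" by (metis set_mset_mset)
  then have r: "set r \<subseteq> I" "i \<in> I" using \<kappa> by auto
  let ?z = "basis_word (i # i # r)"
  have z: "?z \<in> carrier SA" using r by (intro basis_word_carrier) auto
  have "?z = (-1) \<odot>\<^bsub>SA\<^esub> ?z"
    using basis_word_swap[of "[]" r i i] r i(1) by (simp add: power_int_minus_left)
  then have "?z \<oplus>\<^bsub>SA\<^esub> ?z = 1 \<odot>\<^bsub>SA\<^esub> ?z \<oplus>\<^bsub>SA\<^esub> (-1) \<odot>\<^bsub>SA\<^esub> ?z" using vs_smult_one[OF SAV z] by simp
  also have "\<dots> = \<zero>\<^bsub>SA\<^esub>" using vs_smult_add_left[OF SAV z, of 1 "-1"] vs_smult_zero[OF SAV z] by simp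
  finally have "2 \<odot>\<^bsub>SA\<^esub> ?z = \<zero>\<^bsub>SA\<^esub>"
    using vs_smult_add_left[OF SAV z, of 1 1] vs_smult_one[OF SAV z] by simp
  then have "inverse 2 \<odot>\<^bsub>SA\<^esub> (2 \<odot>\<^bsub>SA\<^esub> ?z) = \<zero>\<^bsub>SA\<^esub>" using vs_smult_zero_right[OF SAV] by simp
  then have z0: "?z = \<zero>\<^bsub>SA\<^esub>"
    using vs_smult_assoc[OF SAV z, of "inverse 2" 2] vs_smult_one[OF SAV z] by simp
  obtain a where "basis_word \<kappa> = a \<odot>\<^bsub>SA\<^esub> ?z"
    using basis_word_permute[OF m, of "[]"] \<kappa> by auto
  then show ?thesis using z0 vs_smult_zero_right[OF SAV] by simp
qed

definition monomial_vector :: "'i multiset \<Rightarrow> ('v list \<Rightarrow>\<^sub>0 'k) set set" where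
  "monomial_vector \<mu> = basis_word (sorted_list_of_multiset \<mu>)"

lemma sorted_monomial: "\<mu> \<in> monomials I dg N \<Longrightarrow> set (sorted_list_of_multiset \<mu>) \<subseteq> I"
  by (simp add: monomials_def)

lemma monomial_vector_carrier: "\<mu> \<in> monomials I dg N \<Longrightarrow> monomial_vector \<mu> \<in> carrier SA"
  unfolding monomial_vector_def by (rule basis_word_carrier[OF sorted_monomial])

text \<open>
  Expand the letters one at a time into basis vectors, then sort the resulting words; those with a
  repeated odd letter vanish.
\<close>

lemma words_in_span:
  assumes "w \<in> lists (carrier V)" "length w = N"
  shows "toSA (single_word w) \<in> vspan SA (monomial_vector ` monomials I dg N)" (is "_ \<in> ?W")
proof -
  have "monomial_vector ` monomials I dg N \<subseteq> carrier SA" using monomial_vector_carrier by auto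
  then have W: "subspace_of ?W SA" by (rule subspace_vspan[OF SAV])
  have basis: "basis_word \<kappa> \<in> ?W" if \<kappa>: "set \<kappa> \<subseteq> I" "length \<kappa> = N" for \<kappa>
  proof (cases "mset \<kappa> \<in> monomials I dg N")
    case True
    obtain a where "basis_word \<kappa> = a \<odot>\<^bsub>SA\<^esub> monomial_vector (mset \<kappa>)"
      using basis_word_permute[of \<kappa> "sorted_list_of_multiset (mset \<kappa>)" "[]"] \<kappa>
      unfolding monomial_vector_def by auto
    moreover have "monomial_vector (mset \<kappa>) \<in> ?W"
      using True vspan_superset[of "monomial_vector ` monomials I dg N" SA] by blast
    ultimately show ?thesis using subspace_smult[OF W] by simp
  next
    case False
    then obtain i where "odd (dg i)" "\<not> count (mset \<kappa>) i \<le> 1" using \<kappa> by (auto simp: monomials_def)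
    then show ?thesis using basis_word_odd_square[of i \<kappa>] \<kappa>(1) subspace_zero[OF W] by simp
  qed
  \<comment> \<open>The letters already expanded are collected in \<open>\<kappa>\<close>.\<close>
  have "toSA (single_word (map e \<kappa> @ w)) \<in> ?W"
    if "set \<kappa> \<subseteq> I" "w \<in> lists (carrier V)" "length \<kappa> + length w = N" for \<kappa> w
    using that
  proof (induction w arbitrary: \<kappa>)
    case Nil
    then show ?case using basis[of \<kappa>] by simp
  next
    case (Cons v w)
    have w: "w \<in> lists (carrier V)" and v: "v \<in> carrier V" using Cons.prems(2) by auto
    note \<kappa> = map_e_lists[OF Cons.prems(1)]
    have lin: "linear_map V SA (\<lambda>v. toSA (single_word (map e \<kappa> @ v # w)))"
      unfolding linear_map_def
    proof (intro conjI ballI allI)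
      show "toSA (single_word (map e \<kappa> @ u # w)) \<in> carrier SA" if "u \<in> carrier V" for u
        using \<kappa> w that by (intro toSA_carrier FA_single) auto
    qed (use toSA_word_add[OF \<kappa> w] toSA_word_smult[OF \<kappa> w] in auto)
    show ?case
    proof (rule linear_image_in_span[OF VS SAV lin _ _ _ W])
      show "v \<in> vspan V (e ` I)" using coords_span[OF cs] v by simp
      show "e ` I \<subseteq> carrier V" using coords_carrier[OF cs] by blast
      fix s assume "s \<in> e ` I"
      then obtain i where "i \<in> I" "s = e i" by blast
      then show "toSA (single_word (map e \<kappa> @ s # w)) \<in> ?W"
        using Cons.IH[of "\<kappa> @ [i]"] Cons.prems w by simp
    qed
  qed
  from this[of "[]" w] assms show ?thesis by simp
qed

subsection \<open>Coordinates of the symmetric power\<close>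

theorem homogeneous_coordinates_symmetric_power:
  "\<exists>E C. homogeneous_coordinates (symmetric_power N V) (monomials I dg N) E C (\<lambda>\<mu>. \<Sum>i\<in>#\<mu>. dg i)"
proof -
  have "\<forall>\<mu>\<in>monomials I dg N. \<exists>g. linear_functional SA g \<and>
      (\<forall>w\<in>lists (carrier V). g (toSA (single_word w)) = monomial_coeff \<mu> w)"
    using monomial_functional by (simp add: monomials_def)
  then obtain c' where c': "\<And>\<mu>. \<mu> \<in> monomials I dg N \<Longrightarrow> linear_functional SA (c' \<mu>)"
    "\<And>\<mu> w. \<mu> \<in> monomials I dg N \<Longrightarrow> w \<in> lists (carrier V) \<Longrightarrow> c' \<mu> (toSA (single_word w)) = monomial_coeff \<mu> w"
    by metis
  define S where "S = {symmetric_word V w | w. w \<in> lists (carrier V) \<and> length w = N}"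
  define U where "U = vspan SA S"
  have S: "S \<subseteq> carrier SA"
    unfolding S_def using toSA_carrier[OF FA_single] by (auto simp: symmetric_word_eq)
  have U: "subspace_of U SA" unfolding U_def by (rule subspace_vspan[OF SAV S])
  have SU: "S \<subseteq> U" unfolding U_def by (rule vspan_superset)
  have mS: "monomial_vector \<mu> \<in> S" if "\<mu> \<in> monomials I dg N" for \<mu>
    unfolding S_def monomial_vector_def symmetric_word_eq
  proof (intro CollectI exI conjI)
    show "map e (sorted_list_of_multiset \<mu>) \<in> lists (carrier V)"
      by (rule map_e_lists[OF sorted_monomial[OF that]])
    have "length (sorted_list_of_multiset \<mu>) = size \<mu>"
      by (metis mset_sorted_list_of_multiset size_mset)
    then show "length (map e (sorted_list_of_multiset \<mu>)) = N" using that by (simp add: monomials_def)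
  qed simp
  have span: "vspan SA (monomial_vector ` monomials I dg N) = U"
  proof
    have "monomial_vector ` monomials I dg N \<subseteq> U" using mS SU by blast
    then show "vspan SA (monomial_vector ` monomials I dg N) \<subseteq> U" by (rule vspan_minimal[OF U])
    have "monomial_vector ` monomials I dg N \<subseteq> carrier SA" using mS S by blast
    from subspace_vspan[OF SAV this] show "U \<subseteq> vspan SA (monomial_vector ` monomials I dg N)"
      unfolding U_def by (rule vspan_minimal) (use words_in_span in \<open>auto simp: S_def symmetric_word_eq\<close>)
  qed
  have dual: "c' \<mu> (monomial_vector \<nu>) = (if \<mu> = \<nu> then 1 else 0)"
    if "\<mu> \<in> monomials I dg N" "\<nu> \<in> monomials I dg N" for \<mu> \<nu>
  proof -
    have "c' \<mu> (monomial_vector \<nu>) = monomial_coeff \<mu> (map e (sorted_list_of_multiset \<nu>))"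
      unfolding monomial_vector_def by (rule c'(2)[OF that(1) map_e_lists[OF sorted_monomial[OF that(2)]]])
    also have "\<dots> = (if \<nu> = \<mu> then koszul (sorted_list_of_multiset \<nu>) else 0)"
      using monomial_coeff_basis[of \<mu> "sorted_list_of_multiset \<nu>"] that by (simp add: monomials_def)
    also have "koszul (sorted_list_of_multiset \<nu>) = 1"
      using that(2) by (intro koszul_sorted) (auto simp: monomials_def)
    finally show ?thesis by auto
  qed
  have SP: "symmetric_power N V = with_grading (SA\<lparr>carrier := U\<rparr>)
     (\<lambda>d. vspan SA {symmetric_word V vs | vs ds. length vs = N \<and>
           list_all2 (\<lambda>e v. v \<in> degpart V e) ds vs \<and> sum_list ds = d})"
    unfolding symmetric_power_def SA_eq U_def S_def ..
  have csU: "coordinate_system (SA\<lparr>carrier := U\<rparr>) (monomials I dg N) monomial_vector c'"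
    unfolding coordinate_system_def
  proof (intro conjI ballI)
    show "vectorspace (SA\<lparr>carrier := U\<rparr>)" by (rule vectorspace_subspace[OF SAV U])
    show "finite (monomials I dg N)" by (rule finite_monomials[OF coords_finite[OF cs]])
    show "monomial_vector \<mu> \<in> carrier (SA\<lparr>carrier := U\<rparr>)" if "\<mu> \<in> monomials I dg N" for \<mu>
      using mS[OF that] SU by auto
    show "linear_functional (SA\<lparr>carrier := U\<rparr>) (c' \<mu>)" if "\<mu> \<in> monomials I dg N" for \<mu>
      using c'(1)[OF that] subspace_carrier[OF U] unfolding linear_functional_def by (simp add: subset_iff)
    show "c' \<mu> (monomial_vector \<nu>) = (if \<mu> = \<nu> then 1 else 0)"
      if "\<mu> \<in> monomials I dg N" "\<nu> \<in> monomials I dg N" for \<mu> \<nu>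
      using dual[OF that] .
    have "monomial_vector ` monomials I dg N \<subseteq> U" using mS SU by blast
    from vspan_in_subspace[OF SAV U this]
    show "vspan (SA\<lparr>carrier := U\<rparr>) (monomial_vector ` monomials I dg N) = carrier (SA\<lparr>carrier := U\<rparr>)"
      using span by simp
  qed
  let ?G = "\<lambda>d. {symmetric_word V vs | vs ds. length vs = N \<and>
           list_all2 (\<lambda>e v. v \<in> degpart V e) ds vs \<and> sum_list ds = d}"
  have lists: "vs \<in> lists (carrier V)" if "list_all2 (\<lambda>e v. v \<in> degpart V e) ds vs" for ds vs
    using that by (induction ds vs rule: list_all2_induct) (auto dest: degpart_carrier)
  have GS: "?G d \<subseteq> S" for d unfolding S_def using lists by blast
  have "homogeneous_coordinates (symmetric_power N V) (monomials I dg N) monomial_vector c' (\<lambda>\<mu>. \<Sum>i\<in>#\<mu>. dg i)"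
  proof (rule homogeneous_coordinatesI)
    show "coordinate_system (symmetric_power N V) (monomials I dg N) monomial_vector c'"
      by (rule coordinate_system_cong[OF _ _ _ _ csU]) (simp_all add: SP)
    fix d
    have "vspan (symmetric_power N V) (?G d) = vspan (SA\<lparr>carrier := U\<rparr>) (?G d)"
      by (rule vspan_cong) (simp_all add: SP)
    also have "\<dots> = vspan SA (?G d)"
      using GS SU by (intro vspan_in_subspace[OF SAV U]) (rule subset_trans)
    finally show "degpart (symmetric_power N V) d = vspan (symmetric_power N V) (?G d)" by (simp add: SP)
    show "?G d \<subseteq> carrier (symmetric_power N V)" using subset_trans[OF GS SU] by (simp add: SP)
  next
    fix d x \<mu> assume x: "x \<in> ?G d" and \<mu>: "\<mu> \<in> monomials I dg N" and d: "(\<Sum>i\<in>#\<mu>. dg i) \<noteq> d"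
    from x obtain vs ds where vs: "x = symmetric_word V vs"
      "list_all2 (\<lambda>e v. v \<in> degpart V e) ds vs" "sum_list ds = d" by blast
    have "monomial_coeff \<mu> vs = 0"
      using monomial_coeff_degree[OF vs(2), of \<mu>] \<mu> d vs(3) by (auto simp: monomials_def)
    then show "c' \<mu> x = 0" using c'(2)[OF \<mu> lists[OF vs(2)]] by (simp add: vs(1) symmetric_word_eq)
  next
    fix \<mu> assume \<mu>: "\<mu> \<in> monomials I dg N"
    let ?\<kappa> = "sorted_list_of_multiset \<mu>"
    have "list_all2 (\<lambda>e v. v \<in> degpart V e) (map dg ?\<kappa>) (map e ?\<kappa>)"
      unfolding list_all2_conv_all_nth
    proof (intro conjI allI impI)
      fix n assume "n < length (map dg ?\<kappa>)"
      moreover from this have "?\<kappa> ! n \<in> I" using sorted_monomial[OF \<mu>] nth_mem[of n ?\<kappa>] by auto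
      ultimately show "map e ?\<kappa> ! n \<in> degpart V (map dg ?\<kappa> ! n)"
        using homogeneous_basis_degpart[OF hc] by simp
    qed simp
    moreover have "length ?\<kappa> = size \<mu>" by (metis mset_sorted_list_of_multiset size_mset)
    then have "length (map e ?\<kappa>) = N" using \<mu> by (simp add: monomials_def)
    moreover have "sum_list (map dg ?\<kappa>) = (\<Sum>i\<in>#\<mu>. dg i)"
      by (metis mset_map mset_sorted_list_of_multiset sum_mset_sum_list)
    ultimately show "monomial_vector \<mu> \<in> ?G (\<Sum>i\<in>#\<mu>. dg i)"
      unfolding monomial_vector_def symmetric_word_eq by blast
  qed
  then show ?thesis by blast
qed

end

section \<open>Finite rank in singular homology\<close>

subsection \<open>Rational chains\<close>

text \<open>
  Steinitz exchange modulo \<open>B\<close>: if \<open>S\<close> has dimension at most \<open>card F\<close> modulo \<open>B\<close>, then as many elements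
  of \<open>S\<close> itself generate it modulo \<open>B\<close>. This turns arbitrary generators of an image in homology
  into cycles of the subspace.
\<close>

lemma (in vector_space) span_exchange_relative:
  assumes "finite F" "S \<subseteq> span (F \<union> B)"
  shows "\<exists>G. G \<subseteq> S \<and> finite G \<and> card G \<le> card F \<and> S \<subseteq> span (G \<union> B)"
  using assms
proof (induction F arbitrary: B rule: finite_induct)
  case empty
  then show ?case by (intro exI[of _ "{}"]) simp
next
  case (insert f F)
  show ?case
  proof (cases "S \<subseteq> span (F \<union> B)")
    case True
    then obtain G where "G \<subseteq> S" "finite G" "card G \<le> card F" "S \<subseteq> span (G \<union> B)"
      using insert.IH by blast
    then show ?thesis using insert.hyps by (intro exI[of _ G]) simp
  next
    case False
    then obtain s where s: "s \<in> S" "s \<notin> span (F \<union> B)" by blast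
    have "s \<in> span (insert f (F \<union> B))" using s(1) insert.prems by auto
    then have "f \<in> span (insert s (F \<union> B))" using s(2) by (rule in_span_insert)
    then have "span (insert f (F \<union> B)) \<subseteq> span (insert s (F \<union> B))"
      by (intro span_minimal subspace_span) (auto intro: span_base)
    then have "S \<subseteq> span (F \<union> insert s B)" using insert.prems by auto
    then obtain G where G: "G \<subseteq> S" "finite G" "card G \<le> card F" "S \<subseteq> span (G \<union> insert s B)"
      using insert.IH by blast
    then have "card (insert s G) \<le> card (insert f F)"
      using insert.hyps by (simp add: card_insert_if)
    then show ?thesis using G s(1) by (intro exI[of _ "insert s G"]) simp
  qed
qed

text \<open>The embedding of integral chains into rational ones.\<close>

definition rational :: "('s \<Rightarrow>\<^sub>0 int) \<Rightarrow> 's \<Rightarrow>\<^sub>0 rat" where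
  "rational c = Poly_Mapping.map of_int c"

lemma lookup_rational [simp]: "Poly_Mapping.lookup (rational c) x = of_int (Poly_Mapping.lookup c x)"
  unfolding rational_def by transfer (auto simp: when_def)

lemma rational_simps [simp]:
  "rational 0 = 0" "rational (a + b) = rational a + rational b" "rational (- a) = - rational a"
  "rational (a - b) = rational a - rational b" "rational (frag_cmul n a) = pscale (of_int n) (rational a)"
  by (auto intro!: poly_mapping_eqI simp: lookup_add lookup_minus)

lemma rational_sum: "rational (sum f A) = (\<Sum>x\<in>A. rational (f x))"
  by (induction A rule: infinite_finite_induct) simp_all

lemma rational_eq_iff [simp]: "rational a = rational b \<longleftrightarrow> a = b"
  by (auto simp: poly_mapping_eq_iff fun_eq_iff)

lemma inj_rational: "inj_on rational A"
  by (simp add: inj_on_def)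

definition subgroup_chains :: "('s \<Rightarrow>\<^sub>0 int) set \<Rightarrow> bool" where
  "subgroup_chains B \<longleftrightarrow> 0 \<in> B \<and> (\<forall>x\<in>B. \<forall>y\<in>B. x + y \<in> B) \<and> (\<forall>n. \<forall>x\<in>B. frag_cmul n x \<in> B)"

text \<open>
  Clearing denominators: the chains some nonzero multiple of which has the required form make up a rational subspace.
\<close>

lemma rational_span_multiple:
  assumes B: "subgroup_chains B" and G: "finite G"
    and c: "rational c \<in> pm.span (rational ` G \<union> rational ` B)"
  shows "\<exists>n m b. n \<noteq> 0 \<and> b \<in> B \<and> frag_cmul n c = (\<Sum>g\<in>G. frag_cmul (m g) g) + b"
proof -
  let ?P = "\<lambda>x. \<exists>n m b. n \<noteq> 0 \<and> b \<in> B \<and>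
      pscale (of_int n) x = (\<Sum>g\<in>G. pscale (of_int (m g)) (rational g)) + rational b"
  have subspace: "pm.subspace (Collect ?P)"
  proof (rule pm.subspaceI)
    have "?P 0" using B by (intro exI[of _ 1] exI[of _ "\<lambda>_. 0"] exI[of _ 0])
      (auto simp: subgroup_chains_def intro!: poly_mapping_eqI)
    then show "0 \<in> Collect ?P" by simp
  next
    fix x y assume "x \<in> Collect ?P" "y \<in> Collect ?P"
    then obtain n m b n' m' b' where
      1: "n \<noteq> 0" "b \<in> B" "pscale (of_int n) x = (\<Sum>g\<in>G. pscale (of_int (m g)) (rational g)) + rational b"
      and 2: "n' \<noteq> 0" "b' \<in> B" "pscale (of_int n') y = (\<Sum>g\<in>G. pscale (of_int (m' g)) (rational g)) + rational b'"
      by blast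
    have "pscale (of_int (n * n')) (x + y)
        = pscale (of_int n') (pscale (of_int n) x) + pscale (of_int n) (pscale (of_int n') y)"
      by (rule poly_mapping_eqI) (simp add: lookup_add algebra_simps)
    also have "\<dots> = (\<Sum>g\<in>G. pscale (of_int (n' * m g + n * m' g)) (rational g))
        + rational (frag_cmul n' b + frag_cmul n b')"
      unfolding 1(3) 2(3)
      by (rule poly_mapping_eqI) (simp add: lookup_add lookup_sum sum.distrib sum_distrib_left algebra_simps)
    finally have "?P (x + y)"
      using 1(1,2) 2(1,2) B
      by (intro exI[of _ "n * n'"] exI[of _ "\<lambda>g. n' * m g + n * m' g"] exI[of _ "frag_cmul n' b + frag_cmul n b'"])
        (simp add: subgroup_chains_def)
    then show "x + y \<in> Collect ?P" by simp
  next
    fix q :: rat and x assume "x \<in> Collect ?P"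
    then obtain n m b where
      1: "n \<noteq> 0" "b \<in> B" "pscale (of_int n) x = (\<Sum>g\<in>G. pscale (of_int (m g)) (rational g)) + rational b"
      by blast
    obtain u v where q: "q = of_int u / of_int v" "v \<noteq> 0"
      by (metis Fract_of_int_quotient Rat_cases less_irrefl)
    have "pscale (of_int (n * v)) (pscale q x) = pscale (of_int u) (pscale (of_int n) x)"
      by (rule poly_mapping_eqI) (use q in simp)
    also have "\<dots> = (\<Sum>g\<in>G. pscale (of_int (u * m g)) (rational g)) + rational (frag_cmul u b)"
      unfolding 1(3) by (rule poly_mapping_eqI) (simp add: lookup_add lookup_sum sum_distrib_left algebra_simps)
    finally have "?P (pscale q x)"
      using 1(1,2) q(2) B
      by (intro exI[of _ "n * v"] exI[of _ "\<lambda>g. u * m g"] exI[of _ "frag_cmul u b"])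
        (simp add: subgroup_chains_def)
    then show "pscale q x \<in> Collect ?P" by simp
  qed
  have G': "?P (rational g)" if g: "g \<in> G" for g
  proof (intro exI[of _ 1] exI[of _ "\<lambda>h. if h = g then 1 else 0"] exI[of _ 0] conjI)
    have "(\<Sum>h\<in>G. pscale (of_int (if h = g then 1 else 0)) (rational h)) = (\<Sum>h\<in>G. if h = g then rational g else 0)"
      by (intro sum.cong refl) (auto intro!: poly_mapping_eqI)
    then show "pscale (of_int 1) (rational g)
        = (\<Sum>h\<in>G. pscale (of_int (if h = g then 1 else 0)) (rational h)) + rational 0"
      using g G by (auto intro!: poly_mapping_eqI)
  qed (use B in \<open>auto simp: subgroup_chains_def\<close>)
  have B': "?P (rational b)" if "b \<in> B" for b
    using that by (intro exI[of _ 1] exI[of _ "\<lambda>_. 0"] exI[of _ b]) (auto intro!: poly_mapping_eqI simp: lookup_add lookup_sum)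
  have "rational ` G \<union> rational ` B \<subseteq> Collect ?P"
    by (rule Un_least; rule image_subsetI; rule CollectI) (erule G', erule B')
  from subsetD[OF pm.span_minimal[OF this subspace] c] have "?P (rational c)" by (rule CollectD)
  then obtain n m b where n: "n \<noteq> 0" "b \<in> B"
    "pscale (of_int n) (rational c) = (\<Sum>g\<in>G. pscale (of_int (m g)) (rational g)) + rational b" by blast
  then have "rational (frag_cmul n c) = rational ((\<Sum>g\<in>G. frag_cmul (m g) g) + b)"
    by (simp add: rational_sum)
  then show "\<exists>n m b. n \<noteq> 0 \<and> b \<in> B \<and> frag_cmul n c = (\<Sum>g\<in>G. frag_cmul (m g) g) + b"
    using n(1,2) unfolding rational_eq_iff by blast
qed

lemma rational_span_divide:
  assumes n: "n \<noteq> 0" and c: "rational (frag_cmul n c) \<in> pm.span S"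
  shows "rational c \<in> pm.span S"
proof -
  have "pscale (inverse (of_int n)) (rational (frag_cmul n c)) = rational c"
    by (rule poly_mapping_eqI) (use n in simp)
  then show ?thesis using pm.span_scale[OF c, of "inverse (of_int n)"] by simp
qed

subsection \<open>Finite rank of the map induced by an inclusion\<close>

abbreviation cycles_of :: "nat \<Rightarrow> 'a topology \<Rightarrow> 'a set \<Rightarrow> 'a chain set" where
  "cycles_of p T A \<equiv> {c. singular_relcycle p (subtopology T A) {} c}"

abbreviation boundaries_of :: "nat \<Rightarrow> 'a topology \<Rightarrow> 'a set \<Rightarrow> 'a chain set" where
  "boundaries_of p T A \<equiv> {c. singular_relboundary p (subtopology T A) {} c}"

lemma subgroup_boundaries: "subgroup_chains (boundaries_of p T A)"
  by (auto simp: subgroup_chains_def singular_relboundary_add singular_relboundary_cmul)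

text \<open>
  The map of rational homology induced by \<open>A \<subseteq> B\<close> has rank at most \<open>r\<close>. The elements of \<open>F\<close> are
  arbitrary chains; this avoids choosing cycles when ranks are estimated from above.
\<close>

definition rank_le :: "nat \<Rightarrow> nat \<Rightarrow> 'a topology \<Rightarrow> 'a set \<Rightarrow> 'a set \<Rightarrow> bool" where
  "rank_le p r T A B \<longleftrightarrow> (\<exists>F. finite F \<and> card F \<le> r \<and>
     rational ` cycles_of p T A \<subseteq> pm.span (rational ` F \<union> rational ` boundaries_of p T B))"

lemma boundaries_mono: "A \<subseteq> B \<Longrightarrow> boundaries_of p T A \<subseteq> boundaries_of p T B"
  using singular_boundary_mono[of A B p T] by auto

lemma rank_le_mono:
  assumes "rank_le p r T A B" "A' \<subseteq> A" "B \<subseteq> B'"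
  shows "rank_le p r T A' B'"
proof -
  obtain F where F: "finite F" "card F \<le> r"
    "rational ` cycles_of p T A \<subseteq> pm.span (rational ` F \<union> rational ` boundaries_of p T B)"
    using assms(1) unfolding rank_le_def by blast
  have "rational ` cycles_of p T A' \<subseteq> rational ` cycles_of p T A"
    using singular_cycle_mono[of p T A' _ A] assms(2) by (intro image_mono) auto
  moreover have "pm.span (rational ` F \<union> rational ` boundaries_of p T B)
      \<subseteq> pm.span (rational ` F \<union> rational ` boundaries_of p T B')"
    using boundaries_mono[OF assms(3)] by (intro pm.span_mono Un_mono image_mono) simp
  ultimately have "rational ` cycles_of p T A'
      \<subseteq> pm.span (rational ` F \<union> rational ` boundaries_of p T B')"
    using F(3) by (meson subset_trans)
  then show ?thesis using F(1,2) unfolding rank_le_def by (intro exI[of _ F]) simp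
qed

text \<open>
  By barycentric subdivision a cycle is homologous to one whose simplices lie in one of the two open
  sets.
\<close>

lemma small_cycle_split:
  assumes A: "openin (subtopology T (A \<union> B)) A" and B: "openin (subtopology T (A \<union> B)) B"
    and z: "z \<in> cycles_of p T (A \<union> B)"
  obtains z1 z2 where "singular_chain p (subtopology T A) z1" "singular_chain p (subtopology T B) z2"
    "chain_boundary p (z1 + z2) = 0" "z - (z1 + z2) \<in> boundaries_of p T (A \<union> B)"
proof -
  let ?Y = "subtopology T (A \<union> B)"
  obtain z' where z': "singular_relcycle p ?Y {} z'" "homologous_rel p ?Y {} z z'"
    "\<And>f. f \<in> Poly_Mapping.keys z' \<Longrightarrow> \<exists>V\<in>{A, B}. f \<in> standard_simplex p \<rightarrow> V"
    by (rule small_homologous_rel_relcycle_exists[of "{A, B}" ?Y p "{}" z]) (use A B z in auto)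
  have ch: "singular_chain p T z'" "chain_boundary p z' = 0"
    using z'(1) by (auto simp: singular_cycle singular_chain_subtopology)
  let ?S = "\<lambda>A. {f. singular_simplex p T f \<and> f ` standard_simplex p \<subseteq> A}"
  have "Poly_Mapping.keys z' \<subseteq> ?S A \<union> ?S B"
    using z'(3) ch(1) by (fastforce simp: singular_chain_def Pi_iff)
  then obtain z1 z2 where "Poly_Mapping.keys z1 \<subseteq> ?S A" "Poly_Mapping.keys z2 \<subseteq> ?S B" "z1 + z2 = z'"
    by (rule frag_split)
  then have "singular_chain p (subtopology T A) z1" "singular_chain p (subtopology T B) z2"
    by (auto simp: singular_chain_def singular_simplex_subtopology)
  moreover have "z - z' \<in> boundaries_of p T (A \<union> B)" using z'(2) by (simp add: homologous_rel_def)
  ultimately show thesis using ch(2) \<open>z1 + z2 = z'\<close> by (intro that) auto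
qed

lemma singular_chain_Int:
  "singular_chain p (subtopology T A) c \<Longrightarrow> singular_chain p (subtopology T B) c \<Longrightarrow>
    singular_chain p (subtopology T (A \<inter> B)) c"
  by (auto simp: singular_chain_subtopology)

text \<open>
  A cycle of \<open>A \<union> B\<close> splits as \<open>z1 + z2\<close>, and the boundary of \<open>z1\<close> is a cycle of \<open>A \<inter> B\<close>. These boundaries
  generate a space of rank at most \<open>r1\<close> in the homology of \<open>A' \<inter> B'\<close>. Choosing boundaries \<open>g\<close> of such
  splittings as generators and subtracting the chosen splittings, one is left with \<open>z1\<close> and \<open>z2\<close> whose
  boundaries bound in \<open>A' \<inter> B'\<close>; after correction they are cycles of \<open>A'\<close> and of \<open>B'\<close>, to
  which \<open>r2\<close> and \<open>r3\<close> apply. The nested triples are required since each step only controls a cycle after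
  enlarging the space.
\<close>

lemma rank_le_Mayer_Vietoris:
  assumes A: "openin (subtopology T (A \<union> B)) A" and B: "openin (subtopology T (A \<union> B)) B"
    and sub: "A \<subseteq> A'" "B \<subseteq> B'" "A' \<subseteq> A''" "B' \<subseteq> B''"
    and int: "p > 0 \<Longrightarrow> rank_le (p - 1) r1 T (A \<inter> B) (A' \<inter> B')"
    and rA: "rank_le p r2 T A' A''" and rB: "rank_le p r3 T B' B''"
  shows "rank_le p (r1 + r2 + r3) T (A \<union> B) (A'' \<union> B'')"
proof -
  obtain F2 where F2: "finite F2" "card F2 \<le> r2"
    "rational ` cycles_of p T A' \<subseteq> pm.span (rational ` F2 \<union> rational ` boundaries_of p T A'')"
    using rA unfolding rank_le_def by blast
  obtain F3 where F3: "finite F3" "card F3 \<le> r3"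
    "rational ` cycles_of p T B' \<subseteq> pm.span (rational ` F3 \<union> rational ` boundaries_of p T B'')"
    using rB unfolding rank_le_def by blast
  let ?split = "\<lambda>z1 z2. singular_chain p (subtopology T A) z1 \<and> singular_chain p (subtopology T B) z2 \<and>
     chain_boundary p (z1 + z2) = 0"
  \<comment> \<open>The images of the connecting homomorphism, as chains.\<close>
  define S where "S = {chain_boundary p z1 | z1 z2. ?split z1 z2}"
  have "\<exists>G. finite G \<and> card G \<le> r1 \<and> G \<subseteq> S \<and> (\<forall>s\<in>S. \<exists>n m y. n \<noteq> 0 \<and>
      singular_chain p (subtopology T (A' \<inter> B')) y \<and>
      frag_cmul n s = (\<Sum>g\<in>G. frag_cmul (m g) g) + chain_boundary p y)"
  proof (cases "p = 0")
    case True
    then have "frag_cmul 1 s = (\<Sum>g\<in>{}. frag_cmul 0 g) + chain_boundary p 0" if "s \<in> S" for s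
      using that unfolding S_def by (auto simp: chain_boundary_def)
    then show ?thesis
      by (intro exI[of _ "{}"] conjI ballI exI[of _ "1::int"] exI[of _ "\<lambda>_. 0::int"] exI[of _ 0]) simp_all
  next
    case False
    then obtain p' where p': "p = Suc p'" by (cases p) auto
    have "S \<subseteq> cycles_of p' T (A \<inter> B)"
    proof
      fix s assume "s \<in> S"
      then obtain z1 z2 where z: "s = chain_boundary p z1" "?split z1 z2" unfolding S_def by blast
      have s2: "s = - chain_boundary p z2" using z by (simp add: chain_boundary_add eq_neg_iff_add_eq_0)
      have "singular_chain p' (subtopology T A) s" "singular_chain p' (subtopology T B) s"
        using z(2) singular_chain_boundary[of p "subtopology T A" z1]
          singular_chain_boundary[of p "subtopology T B" z2] p'
        by (simp add: z(1), simp add: s2 singular_chain_minus)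
      moreover have "chain_boundary p' s = 0"
        using z chain_boundary_boundary[of p "subtopology T A" z1] p' by simp
      ultimately show "s \<in> cycles_of p' T (A \<inter> B)" by (auto simp: singular_cycle singular_chain_Int)
    qed
    moreover obtain F1 where F1: "finite F1" "card F1 \<le> r1"
      "rational ` cycles_of p' T (A \<inter> B) \<subseteq> pm.span (rational ` F1 \<union> rational ` boundaries_of p' T (A' \<inter> B'))"
      using int p' unfolding rank_le_def by auto
    ultimately have "rational ` S \<subseteq> pm.span (rational ` F1 \<union> rational ` boundaries_of p' T (A' \<inter> B'))" by blast
    from pm.span_exchange_relative[OF finite_imageI[OF F1(1)] this]
    obtain G' where G': "G' \<subseteq> rational ` S" "finite G'" "card G' \<le> card (rational ` F1)"
      "rational ` S \<subseteq> pm.span (G' \<union> rational ` boundaries_of p' T (A' \<inter> B'))" by blast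
    obtain G where G: "G \<subseteq> S" "G' = rational ` G" using G'(1) by (meson subset_imageE)
    have fG: "finite G" using G'(2) G(2) inj_rational by (metis finite_imageD)
    have "card G \<le> r1"
      using G'(3) F1(2) card_image[OF inj_rational, of G] card_image[OF inj_rational, of F1] G(2) by simp
    moreover have "\<exists>n m y. n \<noteq> 0 \<and> singular_chain p (subtopology T (A' \<inter> B')) y \<and>
      frag_cmul n s = (\<Sum>g\<in>G. frag_cmul (m g) g) + chain_boundary p y" if "s \<in> S" for s
    proof -
      have "rational s \<in> pm.span (rational ` G \<union> rational ` boundaries_of p' T (A' \<inter> B'))"
        using G'(4) that G(2) by blast
      then obtain n m b where n: "n \<noteq> 0" "b \<in> boundaries_of p' T (A' \<inter> B')"
        "frag_cmul n s = (\<Sum>g\<in>G. frag_cmul (m g) g) + b"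
        using rational_span_multiple[OF subgroup_boundaries fG] by blast
      then obtain y where "singular_chain p (subtopology T (A' \<inter> B')) y" "chain_boundary p y = b"
        unfolding singular_boundary p' by auto
      then show ?thesis using n by (intro exI[of _ n] exI[of _ m] exI[of _ y]) simp
    qed
    ultimately show ?thesis using fG G(1) by (intro exI[of _ G]) simp
  qed
  then obtain G where G: "finite G" "card G \<le> r1" "G \<subseteq> S"
    and red: "\<And>s. s \<in> S \<Longrightarrow> \<exists>n m y. n \<noteq> 0 \<and> singular_chain p (subtopology T (A' \<inter> B')) y \<and>
      frag_cmul n s = (\<Sum>g\<in>G. frag_cmul (m g) g) + chain_boundary p y" by (elim exE conjE) simp
  have "\<forall>g\<in>G. \<exists>y1 y2. g = chain_boundary p y1 \<and> ?split y1 y2"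
    using G(3) unfolding S_def by blast
  then obtain y1 y2 where y: "\<And>g. g \<in> G \<Longrightarrow> chain_boundary p (y1 g) = g" "\<And>g. g \<in> G \<Longrightarrow> ?split (y1 g) (y2 g)"
    by metis
  \<comment> \<open>Generators from both parts, and one split cycle for each generator of the connecting images.\<close>
  define F where "F = F2 \<union> F3 \<union> (\<lambda>g. y1 g + y2 g) ` G"
  have "card F \<le> card F2 + card F3 + card G"
    unfolding F_def
    using card_Un_le[of "F2 \<union> F3" "(\<lambda>g. y1 g + y2 g) ` G"] card_Un_le[of F2 F3]
      card_image_le[OF G(1), of "\<lambda>g. y1 g + y2 g"] by linarith
  then have cF: "card F \<le> r1 + r2 + r3" using F2(2) F3(2) G(2) by simp
  let ?W = "pm.span (rational ` F \<union> rational ` boundaries_of p T (A'' \<union> B''))"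
  have bdA: "boundaries_of p T A'' \<subseteq> boundaries_of p T (A'' \<union> B'')"
    and bdB: "boundaries_of p T B'' \<subseteq> boundaries_of p T (A'' \<union> B'')"
    and bdAB: "boundaries_of p T (A \<union> B) \<subseteq> boundaries_of p T (A'' \<union> B'')"
    using sub by (auto intro!: boundaries_mono)
  have WA: "rational a \<in> ?W" if "a \<in> cycles_of p T A'" for a
  proof -
    have "pm.span (rational ` F2 \<union> rational ` boundaries_of p T A'') \<subseteq> ?W"
      using bdA by (intro pm.span_mono) (auto simp: F_def)
    then show ?thesis using that F2(3) by blast
  qed
  have WB: "rational b \<in> ?W" if "b \<in> cycles_of p T B'" for b
  proof -
    have "pm.span (rational ` F3 \<union> rational ` boundaries_of p T B'') \<subseteq> ?W"
      using bdB by (intro pm.span_mono) (auto simp: F_def)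
    then show ?thesis using that F3(3) by blast
  qed
  have "rational z \<in> ?W" if z: "z \<in> cycles_of p T (A \<union> B)" for z
  proof -
    obtain z1 z2 where z12: "?split z1 z2" and hom: "z - (z1 + z2) \<in> boundaries_of p T (A \<union> B)"
      by (rule small_cycle_split[OF A B z]) blast
    have "chain_boundary p z1 \<in> S" unfolding S_def using z12 by blast
    then obtain n m w where n: "n \<noteq> 0" and w: "singular_chain p (subtopology T (A' \<inter> B')) w"
      and eq: "frag_cmul n (chain_boundary p z1) = (\<Sum>g\<in>G. frag_cmul (m g) g) + chain_boundary p w"
      using red[of "chain_boundary p z1"] by auto
    \<comment> \<open>Both corrected parts are cycles, and together they differ from \<open>n (z1 + z2)\<close> by a combination of elements of \<open>F\<close>.\<close>
    define a where "a = frag_cmul n z1 - (\<Sum>g\<in>G. frag_cmul (m g) (y1 g)) - w"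
    define b where "b = frag_cmul n z2 - (\<Sum>g\<in>G. frag_cmul (m g) (y2 g)) + w"
    have y2: "chain_boundary p (y2 g) = - g" if "g \<in> G" for g
      using y[OF that] by (simp add: chain_boundary_add add_eq_0_iff)
    have z2: "chain_boundary p z2 = - chain_boundary p z1"
      using z12 by (simp add: chain_boundary_add add_eq_0_iff)
    have "chain_boundary p a = 0"
      unfolding a_def using eq y(1)
      by (simp add: chain_boundary_diff chain_boundary_sum chain_boundary_cmul o_def)
    moreover have "singular_chain p (subtopology T A') a"
      unfolding a_def using singular_chain_mono[OF _ sub(1)] z12 y(2)
        singular_chain_mono[OF w, of A']
      by (intro singular_chain_diff singular_chain_sum singular_chain_cmul) simp_all
    ultimately have a: "a \<in> cycles_of p T A'" by (simp add: singular_cycle)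
    have neg: "frag_cmul k (- x) = - frag_cmul k x" for k and x :: "'a chain"
      by (rule poly_mapping_eqI) simp
    have "chain_boundary p b = 0"
      unfolding b_def using eq y2 z2
      by (simp add: chain_boundary_diff chain_boundary_add chain_boundary_sum chain_boundary_cmul o_def
          neg sum_negf del: minus_frag_cmul)
    moreover have "singular_chain p (subtopology T B') b"
      unfolding b_def using singular_chain_mono[OF _ sub(2)] z12 y(2)
        singular_chain_mono[OF w, of B']
      by (intro singular_chain_diff singular_chain_add singular_chain_sum singular_chain_cmul) simp_all
    ultimately have b: "b \<in> cycles_of p T B'" by (simp add: singular_cycle)
    have "frag_cmul n (z1 + z2) = a + b + (\<Sum>g\<in>G. frag_cmul (m g) (y1 g + y2 g))"
      by (simp add: a_def b_def frag_cmul_distrib2 sum.distrib)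
    then have "rational (frag_cmul n (z1 + z2))
        = rational a + rational b + (\<Sum>g\<in>G. pscale (of_int (m g)) (rational (y1 g + y2 g)))"
      by (simp add: rational_sum)
    also have "\<dots> \<in> ?W"
      by (intro pm.span_add WA[OF a] WB[OF b] pm.span_sum pm.span_scale pm.span_base UnI1 imageI)
        (simp add: F_def)
    finally have "rational (z1 + z2) \<in> ?W" by (rule rational_span_divide[OF n])
    moreover have "rational (z - (z1 + z2)) \<in> ?W"
      using hom bdAB by (intro pm.span_base) blast
    ultimately have "rational (z1 + z2) + rational (z - (z1 + z2)) \<in> ?W" by (rule pm.span_add)
    then show ?thesis by simp
  qed
  moreover have "finite F" using F2(1) F3(1) G(1) by (simp add: F_def)
  ultimately show ?thesis unfolding rank_le_def using cF by (intro exI[of _ F]) (simp add: image_subset_iff)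
qed

text \<open>
  Finite total rank: besides finiteness in each degree this includes vanishing in almost all
  degrees.
\<close>

definition finite_rank :: "'a topology \<Rightarrow> 'a set \<Rightarrow> 'a set \<Rightarrow> bool" where
  "finite_rank T A B \<longleftrightarrow> (\<exists>r. finite {p. r p \<noteq> 0} \<and> (\<forall>p. rank_le p (r p) T A B))"

lemma finite_rank_mono: "finite_rank T A B \<Longrightarrow> A' \<subseteq> A \<Longrightarrow> B \<subseteq> B' \<Longrightarrow> finite_rank T A' B'"
  unfolding finite_rank_def using rank_le_mono[of _ _ T A B A' B'] by metis

lemma finite_rank_Mayer_Vietoris:
  assumes A: "openin T A" and B: "openin T B"
    and sub: "A \<subseteq> A'" "B \<subseteq> B'" "A' \<subseteq> A''" "B' \<subseteq> B''"
    and int: "finite_rank T (A \<inter> B) (A' \<inter> B')"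
    and fA: "finite_rank T A' A''" and fB: "finite_rank T B' B''"
  shows "finite_rank T (A \<union> B) (A'' \<union> B'')"
proof -
  obtain r1 where r1: "finite {p. r1 p \<noteq> 0}" "\<And>p. rank_le p (r1 p) T (A \<inter> B) (A' \<inter> B')"
    using int unfolding finite_rank_def by blast
  obtain r2 where r2: "finite {p. r2 p \<noteq> 0}" "\<And>p. rank_le p (r2 p) T A' A''"
    using fA unfolding finite_rank_def by blast
  obtain r3 where r3: "finite {p. r3 p \<noteq> 0}" "\<And>p. rank_le p (r3 p) T B' B''"
    using fB unfolding finite_rank_def by blast
  define r where "r p = r1 (p - 1) + r2 p + r3 p" for p
  have op: "openin (subtopology T (A \<union> B)) A" "openin (subtopology T (A \<union> B)) B"
    using A B by (auto intro: openin_subset_topspace_eq simp: openin_open_subtopology[OF openin_Un[OF A B]])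
  have "{p. r p \<noteq> 0} \<subseteq> {0} \<union> Suc ` {p. r1 p \<noteq> 0} \<union> {p. r2 p \<noteq> 0} \<union> {p. r3 p \<noteq> 0}"
  proof
    fix p assume "p \<in> {p. r p \<noteq> 0}"
    then have "r1 (p - 1) \<noteq> 0 \<or> r2 p \<noteq> 0 \<or> r3 p \<noteq> 0" by (simp add: r_def)
    then show "p \<in> {0} \<union> Suc ` {p. r1 p \<noteq> 0} \<union> {p. r2 p \<noteq> 0} \<union> {p. r3 p \<noteq> 0}"
      by (cases p) auto
  qed
  then have "finite {p. r p \<noteq> 0}" by (rule finite_subset) (use r1(1) r2(1) r3(1) in simp)
  moreover have "rank_le p (r p) T (A \<union> B) (A'' \<union> B'')" for p
    unfolding r_def by (rule rank_le_Mayer_Vietoris[OF op sub r1(2) r2(2) r3(2)])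
  ultimately show ?thesis unfolding finite_rank_def by blast
qed

subsection \<open>Contractible sets\<close>

lemma rank_le_zeroI:
  assumes "\<And>c. c \<in> cycles_of p T A \<Longrightarrow> c \<in> boundaries_of p T B"
  shows "rank_le p 0 T A B"
  unfolding rank_le_def using assms
  by (intro exI[of _ "{}"]) (auto intro!: pm.span_base)

lemma finite_rank_empty: "finite_rank T {} B"
proof -
  have "rank_le p 0 T {} B" for p
  proof (rule rank_le_zeroI)
    fix c assume "c \<in> cycles_of p T {}"
    then have "c = 0" by (simp add: singular_relcycle singular_chain_empty)
    then show "c \<in> boundaries_of p T B" by simp
  qed
  then show ?thesis unfolding finite_rank_def by (intro exI[of _ "\<lambda>_. 0"]) simp
qed

text \<open>
  Every cycle is homologous to its image under the constant map, a chain in a point: it bounds in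
  positive degrees and is a multiple of a fixed simplex in degree \<open>0\<close>.
\<close>

lemma finite_rank_contractible:
  assumes "contractible_space (subtopology T A)"
  shows "finite_rank T A A"
proof (cases "subtopology T A = trivial_topology")
  case True
  have "rank_le p 0 T A A" for p
  proof (rule rank_le_zeroI)
    fix c assume "c \<in> cycles_of p T A"
    then have "c = 0" using True by (simp add: singular_relcycle singular_chain_empty)
    then show "c \<in> boundaries_of p T A" by simp
  qed
  then show ?thesis unfolding finite_rank_def by (intro exI[of _ "\<lambda>_. 0"]) simp
next
  case False
  let ?Y = "subtopology T A"
  obtain a where a: "a \<in> topspace ?Y" and hom: "homotopic_with (\<lambda>x. True) ?Y ?Y id (\<lambda>x. a)"
    using assms False unfolding contractible_space by blast
  have cm: "continuous_map ?Y (subtopology ?Y {a}) (\<lambda>x. a)" using a by (simp add: continuous_map_in_subtopology)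
  have ta: "topspace (subtopology ?Y {a}) = {a}" using a by auto
  have homologous: "c - chain_map p (\<lambda>x. a) c \<in> boundaries_of p T A"
    and const: "singular_relcycle p (subtopology ?Y {a}) {} (chain_map p (\<lambda>x. a) c)"
    if c: "c \<in> cycles_of p T A" for p c
  proof -
    have c': "singular_relcycle p ?Y {} c" using c by simp
    have hom': "homotopic_with (\<lambda>h. h \<in> {} \<rightarrow> {}) ?Y ?Y id (\<lambda>x. a)" using hom by simp
    have "homologous_rel p ?Y {} (chain_map p id c) (chain_map p (\<lambda>x. a) c)"
      by (rule homotopic_imp_homologous_rel_chain_maps[OF hom' c'])
    moreover have "chain_map p id c = c"
      using c' by (intro chain_map_ident[of p ?Y]) (simp add: singular_relcycle)
    ultimately show "c - chain_map p (\<lambda>x. a) c \<in> boundaries_of p T A" by (simp add: homologous_rel_def)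
    show "singular_relcycle p (subtopology ?Y {a}) {} (chain_map p (\<lambda>x. a) c)"
      by (rule singular_relcycle_chain_map[OF c' cm]) simp
  qed
  have pos: "rank_le p 0 T A A" if p: "p \<noteq> 0" for p
  proof (rule rank_le_zeroI)
    fix c assume c: "c \<in> cycles_of p T A"
    have "singular_relboundary p (subtopology ?Y {a}) {} (chain_map p (\<lambda>x. a) c)"
      using const[OF c] singular_boundary_eq_cycle_singleton[OF ta, of p] p by simp
    then have "singular_relboundary p (subtopology T (A \<inter> {a})) {} (chain_map p (\<lambda>x. a) c)"
      by (simp add: subtopology_subtopology)
    then have "chain_map p (\<lambda>x. a) c \<in> boundaries_of p T A"
      using boundaries_mono[of "A \<inter> {a}" A p T] by auto
    then show "c \<in> boundaries_of p T A"
      using homologous[OF c] singular_relboundary_add[of p ?Y "{}" "c - chain_map p (\<lambda>x. a) c" "chain_map p (\<lambda>x. a) c"]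
      by simp
  qed
  let ?s = "frag_of (restrict (\<lambda>x. a) (standard_simplex 0))"
  have "rank_le 0 1 T A A"
    unfolding rank_le_def
  proof (intro exI[of _ "{?s}"] conjI subsetI)
    fix x assume "x \<in> rational ` cycles_of 0 T A"
    then obtain c where c: "x = rational c" "c \<in> cycles_of 0 T A" by blast
    have "singular_chain 0 (subtopology ?Y {a}) (chain_map 0 (\<lambda>x. a) c)"
      using const[OF c(2)] by (simp add: singular_relcycle)
    then obtain b where b: "chain_map 0 (\<lambda>x. a) c = frag_cmul b ?s"
      using singular_chain_singleton[OF ta] by blast
    have "c = frag_cmul b ?s + (c - chain_map 0 (\<lambda>x. a) c)" by (simp add: b)
    then have "x = pscale (of_int b) (rational ?s) + rational (c - chain_map 0 (\<lambda>x. a) c)"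
      unfolding c(1) by (metis rational_simps(2) rational_simps(5))
    moreover have "\<dots> \<in> pm.span (rational ` {?s} \<union> rational ` boundaries_of 0 T A)"
    proof (rule pm.span_add)
      show "pscale (of_int b) (rational ?s) \<in> pm.span (rational ` {?s} \<union> rational ` boundaries_of 0 T A)"
        by (intro pm.span_scale pm.span_base) simp
      show "rational (c - chain_map 0 (\<lambda>x. a) c) \<in> pm.span (rational ` {?s} \<union> rational ` boundaries_of 0 T A)"
        by (intro pm.span_base UnI2 imageI homologous[OF c(2)])
    qed
    ultimately show "x \<in> pm.span (rational ` {?s} \<union> rational ` boundaries_of 0 T A)" by simp
  qed simp_all
  then have "rank_le p (if p = 0 then 1 else 0) T A A" for p using pos by simp
  moreover have "finite {p. (if p = (0::nat) then 1 else 0 :: nat) \<noteq> 0}" by simp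
  ultimately show ?thesis unfolding finite_rank_def by (intro exI[of _ "\<lambda>p. if p = 0 then 1 else 0"]) simp
qed

text \<open>
  Mayer-Vietoris without shrinking, by induction on the number of sets; the intersection of one set with
  the union of the others is again a union of fewer sets from the family.
\<close>

lemma finite_rank_Union:
  assumes op: "\<And>U. U \<in> K \<Longrightarrow> openin T U" and con: "\<And>U. U \<in> K \<Longrightarrow> finite_rank T U U"
    and int: "\<And>U V. U \<in> K \<Longrightarrow> V \<in> K \<Longrightarrow> U \<inter> V \<in> K"
    and F: "finite F" "F \<subseteq> K"
  shows "finite_rank T (\<Union>F) (\<Union>F)"
proof -
  have "\<forall>F. finite F \<and> F \<subseteq> K \<and> card F \<le> n \<longrightarrow> finite_rank T (\<Union>F) (\<Union>F)" for n
  proof (induction n)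
    case 0
    then show ?case using finite_rank_empty by auto
  next
    case (Suc n)
    show ?case
    proof (intro allI impI)
      fix F assume F: "finite F \<and> F \<subseteq> K \<and> card F \<le> Suc n"
      show "finite_rank T (\<Union>F) (\<Union>F)"
      proof (cases "F = {}")
        case True
        then show ?thesis by (simp add: finite_rank_empty)
      next
        case False
        then obtain U where U: "U \<in> F" by blast
        define F' where "F' = F - {U}"
        have F': "finite F'" "F' \<subseteq> K" "card F' \<le> n" "F = insert U F'"
          using F U by (auto simp: F'_def card_Diff_singleton)
        have UK: "U \<in> K" using F U by blast
        let ?G = "(\<lambda>V. U \<inter> V) ` F'"
        have G: "?G \<subseteq> K" using F'(2) UK int by blast
        have "card ?G \<le> n" using card_image_le[OF F'(1), of "\<lambda>V. U \<inter> V"] F'(3) by simp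
        then have "finite_rank T (\<Union>?G) (\<Union>?G)" using Suc.IH G F'(1) by blast
        moreover have "\<Union>?G = U \<inter> \<Union>F'" by blast
        ultimately have "finite_rank T (U \<inter> \<Union>F') (U \<inter> \<Union>F')" by simp
        moreover have "finite_rank T (\<Union>F') (\<Union>F')" using Suc.IH F' by blast
        moreover have "openin T (\<Union>F')" using F'(2) op by blast
        ultimately have "finite_rank T (U \<union> \<Union>F') (U \<union> \<Union>F')"
          using finite_rank_Mayer_Vietoris[OF op[OF UK], of "\<Union>F'" U "\<Union>F'" U "\<Union>F'"] con[OF UK] by simp
        then show ?thesis using F'(4) by simp
      qed
    qed
  qed
  then show ?thesis using F by blast
qed

subsection \<open>Spaces with compactly finite homology\<close>

text \<open>
  This local form of finiteness holds for Euclidean space and can be glued along open covers; for a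
  compact space it applies to the whole space as both the compact and the open set.
\<close>

definition compactly_finite :: "'a topology \<Rightarrow> bool" where
  "compactly_finite T \<longleftrightarrow> (\<forall>W C. openin T W \<and> compactin T C \<and> C \<subseteq> W \<longrightarrow> finite_rank T C W)"

lemma compactly_finite_base:
  assumes op: "\<And>U. U \<in> K \<Longrightarrow> openin T U" and con: "\<And>U. U \<in> K \<Longrightarrow> contractible_space (subtopology T U)"
    and int: "\<And>U V. U \<in> K \<Longrightarrow> V \<in> K \<Longrightarrow> U \<inter> V \<in> K"
    and base: "\<And>W x. openin T W \<Longrightarrow> x \<in> W \<Longrightarrow> \<exists>U\<in>K. x \<in> U \<and> U \<subseteq> W"
  shows "compactly_finite T"
  unfolding compactly_finite_def
proof (intro allI impI)
  fix W C assume WC: "openin T W \<and> compactin T C \<and> C \<subseteq> W"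
  let ?U = "{U \<in> K. U \<subseteq> W}"
  have "C \<subseteq> \<Union>?U" using base WC by blast
  moreover have "\<forall>U\<in>?U. openin T U" using op by blast
  moreover have "\<And>\<U>. (\<forall>U\<in>\<U>. openin T U) \<and> C \<subseteq> \<Union>\<U> \<Longrightarrow> \<exists>F. finite F \<and> F \<subseteq> \<U> \<and> C \<subseteq> \<Union>F"
    using WC unfolding compactin_def by simp
  ultimately obtain F where F: "finite F" "F \<subseteq> ?U" "C \<subseteq> \<Union>F" by meson
  have "finite_rank T (\<Union>F) (\<Union>F)"
  proof (rule finite_rank_Union[of K, OF op _ int F(1)])
    show "finite_rank T U U" if "U \<in> K" for U by (rule finite_rank_contractible[OF con[OF that]])
  qed (use F in auto)
  moreover have "\<Union>F \<subseteq> W" using F(2) by blast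
  ultimately show "finite_rank T C W" by (rule finite_rank_mono[OF _ F(3)])
qed

text \<open>
  Push cycles forward along \<open>f\<close>, where the rank is known, and pull the resulting relation back
  along \<open>g\<close>.
\<close>

lemma rank_le_homeomorphic:
  assumes f: "continuous_map T T' f" and g: "continuous_map T' T g"
    and gf: "\<And>x. x \<in> topspace T \<Longrightarrow> g (f x) = x"
    and fC: "f ` C \<subseteq> C'" and gW: "g ` W' \<subseteq> W" and C: "C \<subseteq> topspace T" and W': "W' \<subseteq> topspace T'"
    and r: "rank_le p r T' C' W'"
  shows "rank_le p r T C W"
proof -
  obtain F where F: "finite F" "card F \<le> r"
    "rational ` cycles_of p T' C' \<subseteq> pm.span (rational ` F \<union> rational ` boundaries_of p T' W')"
    using r unfolding rank_le_def by blast
  have cf: "continuous_map (subtopology T C) (subtopology T' C') f"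
    using f fC C by (auto simp: continuous_map_in_subtopology continuous_map_from_subtopology)
  have cg: "continuous_map (subtopology T' W') (subtopology T W) g"
    using g gW W' by (auto simp: continuous_map_in_subtopology continuous_map_from_subtopology)
  let ?F = "chain_map p g ` F"
  have "rational z \<in> pm.span (rational ` ?F \<union> rational ` boundaries_of p T W)" if z: "z \<in> cycles_of p T C" for z
  proof -
    have "chain_map p f z \<in> cycles_of p T' C'"
      using singular_relcycle_chain_map[of p "subtopology T C" "{}" z "subtopology T' C'" f "{}"] cf z by simp
    then have "rational (chain_map p f z) \<in> pm.span (rational ` F \<union> rational ` boundaries_of p T' W')"
      using F(3) by blast
    then obtain n m b where n: "n \<noteq> 0" "b \<in> boundaries_of p T' W'"
      "frag_cmul n (chain_map p f z) = (\<Sum>h\<in>F. frag_cmul (m h) h) + b"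
      using rational_span_multiple[OF subgroup_boundaries F(1)] by blast
    have "chain_map p g (chain_map p f z) = chain_map p (g \<circ> f) z" by (simp add: chain_map_compose)
    also have "\<dots> = z"
      using z gf by (intro chain_map_id_gen[of p "subtopology T C"]) (auto simp: singular_relcycle)
    finally have "chain_map p g (frag_cmul n (chain_map p f z)) = frag_cmul n z" by simp
    then have "frag_cmul n z = chain_map p g ((\<Sum>h\<in>F. frag_cmul (m h) h) + b)" unfolding n(3) ..
    also have "\<dots> = (\<Sum>h\<in>F. frag_cmul (m h) (chain_map p g h)) + chain_map p g b"
      by (simp add: chain_map_add chain_map_sum[OF F(1)] o_def)
    finally have eq: "frag_cmul n z = (\<Sum>h\<in>F. frag_cmul (m h) (chain_map p g h)) + chain_map p g b" .
    have b: "chain_map p g b \<in> boundaries_of p T W"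
      using singular_relboundary_chain_map[of p "subtopology T' W'" "{}" b "subtopology T W" g "{}"] cg n(2) by simp
    let ?S = "pm.span (rational ` ?F \<union> rational ` boundaries_of p T W)"
    have "rational (frag_cmul n z) \<in> ?S"
      unfolding eq rational_simps rational_sum
      by (intro pm.span_add pm.span_sum pm.span_scale pm.span_base) (use b in auto)
    then show ?thesis by (rule rational_span_divide[OF n(1)])
  qed
  then have "rational ` cycles_of p T C \<subseteq> pm.span (rational ` ?F \<union> rational ` boundaries_of p T W)"
    by (intro image_subsetI)
  moreover have "card ?F \<le> r" using F(2) card_image_le[OF F(1), of "chain_map p g"] by linarith
  ultimately show ?thesis using F(1) unfolding rank_le_def by (intro exI[of _ ?F]) simp
qed

lemma compactly_finite_homeomorphic:
  assumes hom: "T homeomorphic_space T'" and T': "compactly_finite T'"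
  shows "compactly_finite T"
  unfolding compactly_finite_def
proof (intro allI impI)
  fix W C assume WC: "openin T W \<and> compactin T C \<and> C \<subseteq> W"
  obtain f g where fg: "homeomorphic_map T T' f" "homeomorphic_map T' T g"
    and gf: "\<And>x. x \<in> topspace T \<Longrightarrow> g (f x) = x"
    by (rule homeomorphic_space_unfold[OF hom]) blast
  note cf = homeomorphic_imp_continuous_map[OF fg(1)] and cg = homeomorphic_imp_continuous_map[OF fg(2)]
  have WX: "W \<subseteq> topspace T" using WC openin_subset by blast
  have "openin T' (f ` W)" using homeomorphic_map_openness_eq[OF fg(1), of W] WC by blast
  moreover have "compactin T' (f ` C)" using image_compactin[OF _ cf] WC by blast
  ultimately have "finite_rank T' (f ` C) (f ` W)" using T' WC unfolding compactly_finite_def by blast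
  then obtain r where r: "finite {p. r p \<noteq> 0}" "\<And>p. rank_le p (r p) T' (f ` C) (f ` W)"
    unfolding finite_rank_def by blast
  have "rank_le p (r p) T C W" for p
  proof (rule rank_le_homeomorphic[OF cf cg gf _ _ _ _ r(2)])
    show "g ` f ` W \<subseteq> W" using gf WX by auto
    show "C \<subseteq> topspace T" using WC WX by blast
    show "f ` W \<subseteq> topspace T'" using openin_subset[OF \<open>openin T' (f ` W)\<close>] .
  qed simp_all
  then show "finite_rank T C W" using r(1) unfolding finite_rank_def by blast
qed

lemma finite_rank_subtopology:
  assumes "A \<subseteq> S" "B \<subseteq> S"
  shows "finite_rank (subtopology T S) A B = finite_rank T A B"
proof -
  have "S \<inter> A = A" "S \<inter> B = B" using assms by auto
  then show ?thesis by (simp add: finite_rank_def rank_le_def subtopology_subtopology)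
qed

lemma compactly_finite_open_iff:
  assumes "openin T U"
  shows "compactly_finite (subtopology T U) \<longleftrightarrow>
    (\<forall>W C. openin T W \<and> W \<subseteq> U \<and> compactin T C \<and> C \<subseteq> W \<longrightarrow> finite_rank T C W)"
  unfolding compactly_finite_def openin_open_subtopology[OF assms] compactin_subtopology
proof (intro iffI allI impI; elim conjE)
  fix W C assume *: "\<forall>W C. (openin T W \<and> W \<subseteq> U) \<and> (compactin T C \<and> C \<subseteq> U) \<and> C \<subseteq> W \<longrightarrow>
      finite_rank (subtopology T U) C W"
    and WC: "openin T W" "W \<subseteq> U" "compactin T C" "C \<subseteq> W"
  have "C \<subseteq> U" using WC by simp
  then show "finite_rank T C W"
    using *[rule_format, of W C] WC finite_rank_subtopology[of C U W T] by simp
next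
  fix W C assume *: "\<forall>W C. openin T W \<and> W \<subseteq> U \<and> compactin T C \<and> C \<subseteq> W \<longrightarrow> finite_rank T C W"
    and WC: "openin T W" "W \<subseteq> U" "compactin T C" "C \<subseteq> U" "C \<subseteq> W"
  then show "finite_rank (subtopology T U) C W"
    using *[rule_format, of W C] finite_rank_subtopology[of C U W T] by simp
qed

lemma compactly_finite_open_subset:
  assumes "compactly_finite T" "openin T U"
  shows "compactly_finite (subtopology T U)"
  unfolding compactly_finite_open_iff[OF assms(2)]
  by (intro allI impI assms(1)[unfolded compactly_finite_def, rule_format]) simp

text \<open>Open boxes form a base of contractible sets closed under intersection.\<close>

lemma compactly_finite_Euclidean_space: "compactly_finite (Euclidean_space n)"
proof (rule compactly_finite_homeomorphic[OF homeomorphic_Euclidean_space_product_topology])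
  let ?E = "product_topology (\<lambda>i. euclideanreal) {..<n}"
  let ?K = "{PiE {..<n} U | U :: nat \<Rightarrow> real set. \<forall>i. open (U i) \<and> convex (U i)}"
  show "compactly_finite ?E"
  proof (rule compactly_finite_base[of ?K])
    show "openin ?E U" if "U \<in> ?K" for U
      using that by (auto simp: openin_PiE)
    show "contractible_space (subtopology ?E U)" if "U \<in> ?K" for U
    proof -
      from that obtain B where B: "U = PiE {..<n} B" "\<And>i. convex (B i)" by blast
      show ?thesis
        unfolding B(1) subtopology_product_topology contractible_space_product_topology contractible_space_top_of_set
        using convex_imp_contractible[OF B(2)] by blast
    qed
    show "U \<inter> V \<in> ?K" if UV: "U \<in> ?K" "V \<in> ?K" for U V
    proof -
      from UV obtain B B' where B: "U = PiE {..<n} B" "\<And>i. open (B i) \<and> convex (B i)"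
        "V = PiE {..<n} B'" "\<And>i. open (B' i) \<and> convex (B' i)" by blast
      have "U \<inter> V = PiE {..<n} (\<lambda>i. B i \<inter> B' i)" unfolding B(1,3) PiE_Int ..
      moreover have "\<forall>i. open (B i \<inter> B' i) \<and> convex (B i \<inter> B' i)" using B(2,4) by (auto intro: convex_Int)
      ultimately show ?thesis by blast
    qed
    fix W x assume W: "openin ?E W" and x: "x \<in> W"
    obtain U where U': "\<forall>i\<in>{..<n}. openin euclideanreal (U i)"
      and U: "x \<in> PiE {..<n} U" "PiE {..<n} U \<subseteq> W"
      using bspec[OF iffD1[OF openin_product_topology_alt W] x] by (elim exE conjE)
    have "\<exists>r>0. ball (x i) r \<subseteq> U i" if "i < n" for i
    proof -
      have "x i \<in> U i" "open (U i)" using U(1) U' that by auto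
      then show ?thesis by (meson open_contains_ball)
    qed
    then obtain r where r: "\<And>i. i < n \<Longrightarrow> r i > 0 \<and> ball (x i) (r i) \<subseteq> U i" by metis
    let ?B = "\<lambda>i. ball (x i) (r i)"
    have "PiE {..<n} ?B \<in> ?K" by auto
    moreover have "x \<in> PiE {..<n} ?B" using U(1) r by (auto simp: PiE_iff)
    moreover have "PiE {..<n} ?B \<subseteq> W"
      using U(2) r PiE_mono[of "{..<n}" ?B U] by auto
    ultimately show "\<exists>U\<in>?K. x \<in> U \<and> U \<subseteq> W" by blast
  qed
qed

subsection \<open>Compact manifolds\<close>

lemma shrink_compact_cover:
  assumes T: "compact_space T" "Hausdorff_space T"
    and C: "compactin T C" and W: "openin T W1" "openin T W2" "C \<subseteq> W1 \<union> W2"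
  obtains P Q where "openin T P" "openin T Q" "C \<subseteq> P \<union> Q" "T closure_of P \<subseteq> W1" "T closure_of Q \<subseteq> W2"
proof -
  have normal: "\<And>S U. closedin T S \<Longrightarrow> openin T U \<Longrightarrow> S \<subseteq> U \<Longrightarrow>
      \<exists>V. openin T V \<and> S \<subseteq> V \<and> T closure_of V \<subseteq> U"
    using compact_Hausdorff_or_regular_imp_normal_space[OF T(1)] T(2) unfolding normal_space_alt by simp
  have C': "closedin T C" using compactin_imp_closedin[OF T(2) C] .
  obtain P where P: "openin T P" "C - W2 \<subseteq> P" "T closure_of P \<subseteq> W1"
    using normal[OF closedin_diff[OF C' W(2)] W(1)] W(3) by blast
  obtain Q where Q: "openin T Q" "C - P \<subseteq> Q" "T closure_of Q \<subseteq> W2"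
    using normal[OF closedin_diff[OF C' P(1)] W(2)] P(2) by blast
  show thesis by (rule that[OF P(1) Q(1) _ P(3) Q(3)]) (use Q(2) in blast)
qed

text \<open>
  A compact \<open>C\<close> inside \<open>W = W1 \<union> W2\<close> is covered by open sets \<open>P\<close>, \<open>Q\<close> that are shrunk twice:
  \<open>P \<subseteq> P' \<subseteq> W1\<close> and \<open>Q \<subseteq> Q' \<subseteq> W2\<close>, each with the closure inside the next set. The compact
  closures make all inclusions in \<open>rank_le_Mayer_Vietoris\<close> factor through an inclusion of a compact set
  into an open set lying in \<open>U\<close> or in \<open>V\<close>.
\<close>

lemma compactly_finite_Un:
  assumes T: "compact_space T" "Hausdorff_space T"
    and U: "openin T U" "compactly_finite (subtopology T U)"
    and V: "openin T V" "compactly_finite (subtopology T V)"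
  shows "compactly_finite (subtopology T (U \<union> V))"
  unfolding compactly_finite_open_iff[OF openin_Un[OF U(1) V(1)]]
proof (intro allI impI)
  fix W C assume WC: "openin T W \<and> W \<subseteq> U \<union> V \<and> compactin T C \<and> C \<subseteq> W"
  have U': "finite_rank T C W" if "openin T W" "W \<subseteq> U" "compactin T C" "C \<subseteq> W" for W C
    using that U(2)[unfolded compactly_finite_open_iff[OF U(1)], rule_format, of W C] by simp
  have V': "finite_rank T C W" if "openin T W" "W \<subseteq> V" "compactin T C" "C \<subseteq> W" for W C
    using that V(2)[unfolded compactly_finite_open_iff[OF V(1)], rule_format, of W C] by simp
  define W1 where "W1 = W \<inter> U"
  define W2 where "W2 = W \<inter> V"
  have W: "openin T W1" "openin T W2" "W = W1 \<union> W2" using WC U(1) V(1) by (auto simp: W1_def W2_def)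
  have cl: "compactin T (T closure_of S)" for S by (rule closedin_compact_space[OF T(1)]) simp
  have sub: "S \<subseteq> T closure_of S" if "openin T S" for S by (rule closure_of_subset[OF openin_subset[OF that]])
  obtain P' Q' where PQ': "openin T P'" "openin T Q'" "C \<subseteq> P' \<union> Q'" "T closure_of P' \<subseteq> W1" "T closure_of Q' \<subseteq> W2"
    by (rule shrink_compact_cover[OF T _ W(1,2), of C]) (use WC W(3) in auto)
  obtain P Q where PQ: "openin T P" "openin T Q" "C \<subseteq> P \<union> Q" "T closure_of P \<subseteq> P'" "T closure_of Q \<subseteq> Q'"
    by (rule shrink_compact_cover[OF T _ PQ'(1,2,3)]) (use WC in auto)
  have "finite_rank T (T closure_of P \<inter> T closure_of Q) (P' \<inter> Q')"
  proof (rule U')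
    show "openin T (P' \<inter> Q')" using PQ' by blast
    show "P' \<inter> Q' \<subseteq> U" using sub[OF PQ'(1)] PQ'(4) by (auto simp: W1_def)
    show "compactin T (T closure_of P \<inter> T closure_of Q)"
      by (rule compact_Int_closedin[OF cl]) simp
  qed (use PQ in blast)
  then have "finite_rank T (P \<inter> Q) (P' \<inter> Q')"
    by (rule finite_rank_mono) (use sub[OF PQ(1)] sub[OF PQ(2)] in blast)+
  moreover have "finite_rank T (T closure_of P') W1" by (rule U'[OF W(1) _ cl PQ'(4)]) (simp add: W1_def)
  then have "finite_rank T P' W1" by (rule finite_rank_mono) (use sub[OF PQ'(1)] in blast)+
  moreover have "finite_rank T (T closure_of Q') W2" by (rule V'[OF W(2) _ cl PQ'(5)]) (simp add: W2_def)
  then have "finite_rank T Q' W2" by (rule finite_rank_mono) (use sub[OF PQ'(2)] in blast)+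
  moreover have "P \<subseteq> P'" "Q \<subseteq> Q'" "P' \<subseteq> W1" "Q' \<subseteq> W2"
    using PQ(4,5) PQ'(4,5) sub[OF PQ(1)] sub[OF PQ(2)] sub[OF PQ'(1)] sub[OF PQ'(2)] by simp_all
  ultimately have "finite_rank T (P \<union> Q) (W1 \<union> W2)"
    by (intro finite_rank_Mayer_Vietoris[OF PQ(1,2)]) simp_all
  then show "finite_rank T C W" unfolding W(3) by (rule finite_rank_mono[OF _ PQ(3) subset_refl])
qed

text \<open>
  Finitely many charts cover the manifold, and their finite unions remain compactly finite.
\<close>

theorem closed_manifold_finite_rank:
  assumes "closed_manifold k T"
  shows "finite_rank T (topspace T) (topspace T)"
proof -
  have T: "compact_space T" "Hausdorff_space T" using assms by (auto simp: closed_manifold_def)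
  let ?good = "\<lambda>U. openin T U \<and> compactly_finite (subtopology T U)"
  have "\<exists>U. ?good U \<and> x \<in> U" if "x \<in> topspace T" for x
  proof -
    obtain U W where UW: "openin T U" "x \<in> U" "openin (Euclidean_space k) W"
      "subtopology T U homeomorphic_space subtopology (Euclidean_space k) W"
      using assms \<open>x \<in> topspace T\<close> unfolding closed_manifold_def by blast
    have "compactly_finite (subtopology T U)"
      by (rule compactly_finite_homeomorphic[OF UW(4)
          compactly_finite_open_subset[OF compactly_finite_Euclidean_space UW(3)]])
    then show ?thesis using UW(1,2) by blast
  qed
  then have "topspace T \<subseteq> \<Union>(Collect ?good)" by blast
  moreover have "compactin T (topspace T)" using T(1) by (simp add: compact_space_def)
  ultimately obtain F where F: "finite F" "F \<subseteq> Collect ?good" "topspace T \<subseteq> \<Union>F"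
    unfolding compactin_def by (elim conjE allE[of _ "Collect ?good"]) auto
  have "?good (\<Union>F)"
    using F(1,2)
  proof (induction F rule: finite_induct)
    case empty
    have "compactly_finite (subtopology T {})"
      unfolding compactly_finite_open_iff[OF openin_empty] by (auto simp: finite_rank_empty)
    then show ?case by simp
  next
    case (insert U F)
    then have "?good U" "?good (\<Union>F)" by auto
    then show ?case using compactly_finite_Un[OF T, of U "\<Union>F"] openin_Un[of T U "\<Union>F"] by simp
  qed
  moreover have "\<Union>F = topspace T" using F(3) openin_subset calculation by blast
  ultimately have "compactly_finite T" by simp
  then show ?thesis using \<open>compactin T (topspace T)\<close> unfolding compactly_finite_def by simp
qed

section \<open>Finite-dimensional cohomology\<close>

lemma cochain_space_simps [simp]:
  "\<zero>\<^bsub>cochain_space p Y\<^esub> = (\<lambda>c\<in>singular_chain_set p Y. 0)"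
  "u \<oplus>\<^bsub>cochain_space p Y\<^esub> v = (\<lambda>c\<in>singular_chain_set p Y. u c + v c)"
  "a \<odot>\<^bsub>cochain_space p Y\<^esub> u = (\<lambda>c\<in>singular_chain_set p Y. a * u c)"
  by (simp_all add: cochain_space_def)

lemma cochain_iff:
  fixes u :: "'a chain \<Rightarrow> 'k::field"
  shows "u \<in> carrier (cochain_space p Y) \<longleftrightarrow> u \<in> extensional (singular_chain_set p Y) \<and>
    (\<forall>c d. singular_chain p Y c \<longrightarrow> singular_chain p Y d \<longrightarrow> u (c + d) = u c + u d)"
  by (auto simp: cochain_space_def hom_def)

lemma cochain_vectorspace: "vectorspace (cochain_space p Y :: ('k::field, 'a chain \<Rightarrow> 'k) module)"
  by (rule vectorspaceI)
    (auto simp: cochain_iff singular_chain_add algebra_simps restrict_def extensional_def fun_eq_iff)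

context
  fixes p :: nat and Y :: "'a topology" and u :: "'a chain \<Rightarrow> 'k::field_char_0"
  assumes u: "u \<in> carrier (cochain_space p Y)"
begin

lemma cochain_add: "singular_chain p Y c \<Longrightarrow> singular_chain p Y d \<Longrightarrow> u (c + d) = u c + u d"
  using u by (auto simp: cochain_iff)

lemma cochain_zero: "u 0 = 0"
  using cochain_add[of 0 0] by simp

lemma cochain_cmul: "singular_chain p Y c \<Longrightarrow> u (frag_cmul n c) = of_int n * u c"
proof (induction n rule: int_induct[where k = 0])
  case base
  then show ?case by (simp add: cochain_zero)
next
  case (step1 i)
  then show ?case
    using cochain_add[of "frag_cmul i c" c] by (simp add: frag_cmul_distrib singular_chain_cmul algebra_simps)
next
  case (step2 i)
  have "frag_cmul i c = frag_cmul (i - 1) c + c" using frag_cmul_distrib[of "i - 1" 1 c] by simp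
  then show ?case
    using step2 cochain_add[of "frag_cmul (i - 1) c" c] by (simp add: singular_chain_cmul algebra_simps)
qed

lemma cochain_sum:
  "finite F \<Longrightarrow> (\<And>f. f \<in> F \<Longrightarrow> singular_chain p Y (g f)) \<Longrightarrow> u (\<Sum>f\<in>F. g f) = (\<Sum>f\<in>F. u (g f))"
  by (induction F rule: finite_induct) (simp_all add: cochain_zero cochain_add singular_chain_sum)

end

lemma coboundary_in: "singular_chain (Suc p) Y c \<Longrightarrow> coboundary p Y u c = u (chain_boundary (Suc p) c)"
  by (simp add: coboundary_def)

lemma coboundary_cochain:
  "u \<in> carrier (cochain_space p Y) \<Longrightarrow> coboundary p Y u \<in> carrier (cochain_space (Suc p) Y)"
  by (auto simp: cochain_iff coboundary_def singular_chain_add chain_boundary_add singular_chain_boundary_alt)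

lemma cocycles_iff:
  fixes u :: "'a chain \<Rightarrow> 'k::field"
  shows "u \<in> cocycles p Y \<longleftrightarrow> u \<in> carrier (cochain_space p Y) \<and>
    (\<forall>c. singular_chain (Suc p) Y c \<longrightarrow> u (chain_boundary (Suc p) c) = 0)"
  by (auto simp: cocycles_def coboundary_def fun_eq_iff restrict_def)

lemma cocycles_subspace: "subspace_of (cocycles p Y) (cochain_space p Y :: ('k::field, 'a chain \<Rightarrow> 'k) module)"
proof (rule subspaceI[OF cochain_vectorspace])
  note V = cochain_vectorspace[of p Y]
  show "cocycles p Y \<subseteq> carrier (cochain_space p Y :: ('k, 'a chain \<Rightarrow> 'k) module)" by (auto simp: cocycles_iff)
  show "\<zero>\<^bsub>cochain_space p Y\<^esub> \<in> (cocycles p Y :: ('a chain \<Rightarrow> 'k) set)"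
    using vs_zero_closed[OF V] by (auto simp: cocycles_iff singular_chain_boundary_alt)
  show "v \<oplus>\<^bsub>cochain_space p Y\<^esub> w \<in> cocycles p Y" if "v \<in> cocycles p Y" "w \<in> cocycles p Y" for v w :: "'a chain \<Rightarrow> 'k"
    using that vs_add_closed[OF V, of v w] by (auto simp: cocycles_iff singular_chain_boundary_alt)
  show "a \<odot>\<^bsub>cochain_space p Y\<^esub> v \<in> cocycles p Y" if "v \<in> cocycles p Y" for v :: "'a chain \<Rightarrow> 'k" and a
    using that vs_smult_closed[OF V, of v a] by (auto simp: cocycles_iff singular_chain_boundary_alt)
qed

lemma coboundaries_cocycles:
  fixes u :: "'a chain \<Rightarrow> 'k::field_char_0"
  assumes "u \<in> coboundaries p Y"
  shows "u \<in> cocycles p Y"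
proof (cases p)
  case 0
  then have "u = \<zero>\<^bsub>cochain_space 0 Y\<^esub>" using assms by (simp add: coboundaries_def)
  then show ?thesis using subspace_zero[OF cocycles_subspace, of 0 Y] 0 by simp
next
  case (Suc q)
  then obtain w where w: "w \<in> carrier (cochain_space q Y)" "u = coboundary q Y w"
    using assms by (auto simp: coboundaries_def)
  show ?thesis
    using coboundary_cochain[OF w(1)] cochain_zero[OF w(1)] w(2) Suc
    by (auto simp: cocycles_iff coboundary_in singular_chain_boundary_alt chain_boundary_boundary_alt)
qed

lemma coboundaries_subspace:
  "subspace_of (coboundaries p Y)
     ((cochain_space p Y :: ('k::field_char_0, 'a chain \<Rightarrow> 'k) module)\<lparr>carrier := cocycles p Y\<rparr>)"
proof (rule subspaceI[OF vectorspace_subspace[OF cochain_vectorspace cocycles_subspace]])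
  let ?Z = "(cochain_space p Y :: ('k, 'a chain \<Rightarrow> 'k) module)\<lparr>carrier := cocycles p Y\<rparr>"
  show "coboundaries p Y \<subseteq> carrier ?Z" using coboundaries_cocycles by auto
  have eq: "coboundary q Y \<zero>\<^bsub>cochain_space q Y\<^esub> = \<zero>\<^bsub>cochain_space (Suc q) Y\<^esub>"
    "coboundary q Y v \<oplus>\<^bsub>cochain_space (Suc q) Y\<^esub> coboundary q Y w = coboundary q Y (v \<oplus>\<^bsub>cochain_space q Y\<^esub> w)"
    "a \<odot>\<^bsub>cochain_space (Suc q) Y\<^esub> coboundary q Y v = coboundary q Y (a \<odot>\<^bsub>cochain_space q Y\<^esub> v)"
    for q and v w :: "'a chain \<Rightarrow> 'k" and a
    by (auto simp: coboundary_def fun_eq_iff restrict_def singular_chain_boundary_alt)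
  note V = cochain_vectorspace[where Y = Y]
  show "\<zero>\<^bsub>?Z\<^esub> \<in> coboundaries p Y"
    by (cases p) (auto simp: coboundaries_def eq(1)[symmetric] simp del: cochain_space_simps
        intro: vs_zero_closed[OF V])
  show "v \<oplus>\<^bsub>?Z\<^esub> w \<in> coboundaries p Y" if "v \<in> coboundaries p Y" "w \<in> coboundaries p Y" for v w
    using that by (cases p) (auto simp: coboundaries_def eq(2) simp del: cochain_space_simps(2,3)
        intro: vs_add_closed[OF V], auto simp: fun_eq_iff)
  show "a \<odot>\<^bsub>?Z\<^esub> v \<in> coboundaries p Y" if "v \<in> coboundaries p Y" for v a
    using that by (cases p) (auto simp: coboundaries_def eq(3) simp del: cochain_space_simps(2,3)
        intro: vs_smult_closed[OF V], auto simp: fun_eq_iff)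
qed

lemma cohomology_vectorspace: "vectorspace (cohomology p Y :: ('k::field_char_0, ('a chain \<Rightarrow> 'k) set) module)"
  unfolding cohomology_def
  by (rule quot_vectorspace[OF vectorspace_subspace[OF cochain_vectorspace cocycles_subspace] coboundaries_subspace])

text \<open>
  The case of the universal coefficient theorem that is needed: for a field of characteristic zero,
  a cochain that vanishes on cycles factors through the boundary map. The induced map on the rational
  span of the boundaries extends to all rational chains, because every independent set extends to a
  basis.
\<close>

lemma cochain_extension:
  fixes u :: "'a chain \<Rightarrow> 'k::field_char_0"
  assumes u: "u \<in> carrier (cochain_space (Suc q) Y)"
    and van: "\<And>c. singular_chain (Suc q) Y c \<Longrightarrow> chain_boundary (Suc q) c = 0 \<Longrightarrow> u c = 0"
  shows "\<exists>w\<in>carrier (cochain_space q Y). u = coboundary q Y w"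
proof -
  let ?scale = "\<lambda>(x::rat) (y::'k). of_rat x * y"
  interpret k: vector_space ?scale
    by unfold_locales (auto simp: algebra_simps of_rat_add of_rat_mult)
  interpret vsp: vector_space_pair "pscale :: rat \<Rightarrow> (((nat \<Rightarrow> real) \<Rightarrow> 'a) \<Rightarrow>\<^sub>0 rat) \<Rightarrow> _" ?scale
    by unfold_locales
  define D where "D = {rational (chain_boundary (Suc q) c) | c. singular_chain (Suc q) Y c}"
  obtain B where B: "B \<subseteq> D" "pm.independent B" "D \<subseteq> pm.span B"
    by (rule pm.maximal_independent_subset[of D])
  have "\<forall>b\<in>B. \<exists>c. singular_chain (Suc q) Y c \<and> b = rational (chain_boundary (Suc q) c)"
    using B(1) unfolding D_def by blast
  then obtain f where f: "\<And>b. b \<in> B \<Longrightarrow> singular_chain (Suc q) Y (f b)"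
    "\<And>b. b \<in> B \<Longrightarrow> rational (chain_boundary (Suc q) (f b)) = b" by metis
  obtain W where W: "Vector_Spaces.linear pscale ?scale W" "\<And>b. b \<in> B \<Longrightarrow> W b = u (f b)"
    using vsp.linear_independent_extend[OF B(2), of "\<lambda>b. u (f b)"] by auto
  note Wadd = vsp.linear_add[OF W(1)] and Wscale = vsp.linear_scale[OF W(1)]
  \<comment> \<open>\<open>W\<close> is prescribed on the basis \<open>B\<close> only; on the whole span of \<open>B\<close> it is controlled up to a denominator.\<close>
  let ?P = "\<lambda>x. \<exists>n c. n \<noteq> 0 \<and> singular_chain (Suc q) Y c \<and>
      pscale (of_int n) x = rational (chain_boundary (Suc q) c) \<and> of_int n * W x = u c"
  have "pm.subspace (Collect ?P)"
  proof (rule pm.subspaceI)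
    have "W 0 = 0" using Wscale[of 0 0] by simp
    then have "?P 0" by (intro exI[of _ 1] exI[of _ 0]) (simp add: cochain_zero[OF u])
    then show "0 \<in> Collect ?P" by simp
  next
    fix x y assume "x \<in> Collect ?P" "y \<in> Collect ?P"
    then obtain n c n' c' where
      1: "n \<noteq> 0" "singular_chain (Suc q) Y c" "pscale (of_int n) x = rational (chain_boundary (Suc q) c)"
        "of_int n * W x = u c"
      and 2: "n' \<noteq> 0" "singular_chain (Suc q) Y c'" "pscale (of_int n') y = rational (chain_boundary (Suc q) c')"
        "of_int n' * W y = u c'" by blast
    let ?c = "frag_cmul n' c + frag_cmul n c'"
    have c: "singular_chain (Suc q) Y ?c" by (intro singular_chain_add singular_chain_cmul 1 2)
    have "pscale (of_int (n * n')) (x + y)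
        = pscale (of_int n') (pscale (of_int n) x) + pscale (of_int n) (pscale (of_int n') y)"
      by (rule poly_mapping_eqI) (simp add: lookup_add algebra_simps)
    also have "\<dots> = rational (chain_boundary (Suc q) ?c)"
      unfolding 1(3) 2(3) by (simp add: chain_boundary_add chain_boundary_cmul)
    finally have "pscale (of_int (n * n')) (x + y) = rational (chain_boundary (Suc q) ?c)" .
    moreover have "u ?c = of_int n' * u c + of_int n * u c'"
      using cochain_add[OF u] cochain_cmul[OF u] 1(2) 2(2) by (simp add: singular_chain_cmul)
    then have "of_int (n * n') * W (x + y) = u ?c"
      by (simp add: Wadd 1(4)[symmetric] 2(4)[symmetric] algebra_simps)
    ultimately have "?P (x + y)" using c 1(1) 2(1) by (intro exI[of _ "n * n'"] exI[of _ ?c]) simp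
    then show "x + y \<in> Collect ?P" by simp
  next
    fix r :: rat and x assume "x \<in> Collect ?P"
    then obtain n c where
      1: "n \<noteq> 0" "singular_chain (Suc q) Y c" "pscale (of_int n) x = rational (chain_boundary (Suc q) c)"
        "of_int n * W x = u c" by blast
    obtain a v where r: "r = of_int a / of_int v" "v \<noteq> 0"
      by (metis Fract_of_int_quotient Rat_cases less_irrefl)
    have "pscale (of_int (n * v)) (pscale r x) = pscale (of_int a) (pscale (of_int n) x)"
      by (rule poly_mapping_eqI) (use r in simp)
    also have "\<dots> = rational (chain_boundary (Suc q) (frag_cmul a c))"
      unfolding 1(3) by (simp add: chain_boundary_cmul)
    finally have "pscale (of_int (n * v)) (pscale r x) = rational (chain_boundary (Suc q) (frag_cmul a c))" .
    moreover have "of_int (n * v) * W (pscale r x) = u (frag_cmul a c)"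
      using r(2) by (simp add: Wscale cochain_cmul[OF u 1(2)] 1(4)[symmetric] r(1) of_rat_divide)
    ultimately have "?P (pscale r x)"
      using 1(1,2) r(2) by (intro exI[of _ "n * v"] exI[of _ "frag_cmul a c"]) (simp add: singular_chain_cmul)
    then show "pscale r x \<in> Collect ?P" by simp
  qed
  moreover have "B \<subseteq> Collect ?P"
  proof (intro subsetI CollectI)
    fix b assume b: "b \<in> B"
    show "?P b"
      using f[OF b] W(2)[OF b] by (intro exI[of _ 1] exI[of _ "f b"]) (auto intro!: poly_mapping_eqI)
  qed
  ultimately have span: "pm.span B \<subseteq> Collect ?P" by (intro pm.span_minimal)
  have key: "W (rational (chain_boundary (Suc q) c)) = u c" if c: "singular_chain (Suc q) Y c" for c
  proof -
    have "rational (chain_boundary (Suc q) c) \<in> D" unfolding D_def using c by blast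
    then have "?P (rational (chain_boundary (Suc q) c))" using B(3) span by auto
    then obtain n c' where n: "n \<noteq> 0" "singular_chain (Suc q) Y c'"
      "pscale (of_int n) (rational (chain_boundary (Suc q) c)) = rational (chain_boundary (Suc q) c')"
      "of_int n * W (rational (chain_boundary (Suc q) c)) = u c'" by (elim exE conjE)
    have "rational (chain_boundary (Suc q) (frag_cmul n c)) = rational (chain_boundary (Suc q) c')"
      using n(3) by (simp add: chain_boundary_cmul)
    then have "chain_boundary (Suc q) (frag_cmul n c - c') = 0"
      unfolding rational_eq_iff by (simp add: chain_boundary_diff)
    moreover have ch: "singular_chain (Suc q) Y (frag_cmul n c - c')"
      using c n(2) by (intro singular_chain_diff singular_chain_cmul)
    ultimately have "u (frag_cmul n c - c') = 0" by (intro van)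
    moreover have "u (frag_cmul n c) = u (frag_cmul n c - c') + u c'"
      using cochain_add[OF u ch n(2)] by simp
    ultimately have "of_int n * u c = u c'" using cochain_cmul[OF u c] by simp
    then have "of_int n * W (rational (chain_boundary (Suc q) c)) = of_int n * u c" using n(4) by simp
    then show ?thesis using n(1) by simp
  qed
  define w where "w = (\<lambda>d\<in>singular_chain_set q Y. W (rational d))"
  have "w \<in> carrier (cochain_space q Y)"
    by (auto simp: cochain_iff w_def Wadd singular_chain_add)
  moreover have "u = coboundary q Y w"
  proof
    fix c
    show "u c = coboundary q Y w c"
      using u key by (cases "singular_chain (Suc q) Y c")
        (auto simp: coboundary_def w_def singular_chain_boundary_alt cochain_iff extensional_def)
  qed
  ultimately show ?thesis by blast
qed

text \<open>
  Evaluation on a finite set \<open>G\<close> of cycles generating the rational homology separates the cohomology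
  classes: a cocycle that vanishes on \<open>G\<close> vanishes on all cycles, hence is a coboundary by
  \<open>cochain_extension\<close>. The clause about \<open>r = 0\<close> lets the vanishing of homology in almost all degrees pass
  to cohomology.
\<close>

lemma cohomology_coordinates:
  fixes Y :: "'a topology"
  assumes r: "rank_le p r Y (topspace Y) (topspace Y)"
  shows "\<exists>n e c. (r = 0 \<longrightarrow> n = 0) \<and>
    coordinate_system (cohomology p Y :: ('k::field_char_0, ('a chain \<Rightarrow> 'k) set) module) {..<n::nat} e c"
proof -
  obtain F where F: "finite F" "card F \<le> r"
    "rational ` cycles_of p Y (topspace Y) \<subseteq> pm.span (rational ` F \<union> rational ` boundaries_of p Y (topspace Y))"
    using r unfolding rank_le_def by blast
  obtain G' where G': "G' \<subseteq> rational ` cycles_of p Y (topspace Y)" "finite G'" "card G' \<le> card (rational ` F)"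
    "rational ` cycles_of p Y (topspace Y) \<subseteq> pm.span (G' \<union> rational ` boundaries_of p Y (topspace Y))"
    using pm.span_exchange_relative[OF finite_imageI[OF F(1)] F(3)] by auto
  obtain G where G: "G \<subseteq> cycles_of p Y (topspace Y)" "G' = rational ` G" using G'(1) by (meson subset_imageE)
  have fG: "finite G" using G'(2) G(2) inj_rational by (metis finite_imageD)
  have cG: "card G \<le> r"
    using G'(3) F(2) card_image[OF inj_rational, of G] card_image[OF inj_rational, of F] G(2) by simp
  have Gc: "singular_chain p Y g" "chain_boundary p g = 0" if "g \<in> G" for g
    using G(1) that by (auto simp: singular_cycle)
  define Z where "Z = (cochain_space p Y :: ('k, 'a chain \<Rightarrow> 'k) module)\<lparr>carrier := cocycles p Y\<rparr>"
  have VZ: "vectorspace Z"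
    unfolding Z_def by (rule vectorspace_subspace[OF cochain_vectorspace cocycles_subspace])
  have BZ: "subspace_of (coboundaries p Y) Z"
    unfolding Z_def by (rule coboundaries_subspace)
  have H: "cohomology p Y = quot Z (coboundaries p Y)" by (simp add: cohomology_def Z_def)
  have "\<exists>\<phi>. linear_functional (quot Z (coboundaries p Y)) \<phi> \<and>
      (\<forall>u\<in>carrier Z. \<phi> (coboundaries p Y +>\<^bsub>Z\<^esub> u) = u g)" if g: "g \<in> G" for g
  proof -
    define ev :: "('a chain \<Rightarrow> 'k) \<Rightarrow> 'k" where "ev u = u g" for u
    have lf: "linear_functional Z ev"
      using Gc[OF g] by (auto simp: linear_functional_def Z_def ev_def)
    have ker: "ev u = 0" if u: "u \<in> coboundaries p Y" for u :: "'a chain \<Rightarrow> 'k"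
    proof (cases p)
      case 0
      then show ?thesis using u Gc[OF g] by (simp add: coboundaries_def ev_def)
    next
      case (Suc q)
      then obtain w where w: "w \<in> carrier (cochain_space q Y)" "u = coboundary q Y w"
        using u by (auto simp: coboundaries_def)
      then show ?thesis using Gc[OF g] Suc cochain_zero[OF w(1)] by (simp add: coboundary_in ev_def)
    qed
    obtain \<phi> where "linear_functional (quot Z (coboundaries p Y)) \<phi>"
      "\<And>u. u \<in> carrier Z \<Longrightarrow> \<phi> (coboundaries p Y +>\<^bsub>Z\<^esub> u) = ev u"
      by (rule quot_functional[OF VZ BZ lf ker, OF _ that]) assumption+
    then show ?thesis unfolding ev_def by blast
  qed
  then obtain \<phi> where \<phi>: "\<And>g. g \<in> G \<Longrightarrow> linear_functional (quot Z (coboundaries p Y)) (\<phi> g)"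
    "\<And>g u. g \<in> G \<Longrightarrow> u \<in> carrier Z \<Longrightarrow> \<phi> g (coboundaries p Y +>\<^bsub>Z\<^esub> u) = u g" by metis
  have inj: "\<alpha> = \<zero>\<^bsub>cohomology p Y\<^esub>"
    if \<alpha>: "\<alpha> \<in> carrier (cohomology p Y)" and zero: "\<And>g. g \<in> G \<Longrightarrow> \<phi> g \<alpha> = 0" for \<alpha>
  proof -
    obtain u where u: "u \<in> carrier Z" "\<alpha> = coboundaries p Y +>\<^bsub>Z\<^esub> u"
      using \<alpha> unfolding H quot_carrier[OF VZ BZ] by blast
    have uc: "u \<in> cocycles p Y" using u(1) by (simp add: Z_def)
    then have uco: "u \<in> carrier (cochain_space p Y)" by (simp add: cocycles_iff)
    have uG: "u g = 0" if "g \<in> G" for g using zero[OF that] \<phi>(2)[OF that u(1)] u(2) by simp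
    have van: "u c = 0" if c: "singular_chain p Y c" "chain_boundary p c = 0" for c
    proof -
      have "rational c \<in> pm.span (rational ` G \<union> rational ` boundaries_of p Y (topspace Y))"
        using G'(4) G(2) c by (auto simp: singular_cycle)
      then obtain n m b where n: "n \<noteq> 0" "b \<in> boundaries_of p Y (topspace Y)"
        "frag_cmul n c = (\<Sum>g\<in>G. frag_cmul (m g) g) + b"
        using rational_span_multiple[OF subgroup_boundaries fG] by blast
      obtain y where y: "singular_chain (Suc p) Y y" "chain_boundary (Suc p) y = b"
        using n(2) by (auto simp: singular_boundary)
      have b: "singular_chain p Y b" "u b = 0"
        using y singular_chain_boundary_alt[OF y(1)] uc by (auto simp: cocycles_iff)
      have "u (\<Sum>g\<in>G. frag_cmul (m g) g) = (\<Sum>g\<in>G. u (frag_cmul (m g) g))"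
        by (rule cochain_sum[OF uco fG singular_chain_cmul[OF Gc(1)]])
      also have "\<dots> = 0" by (rule sum.neutral) (simp add: cochain_cmul[OF uco Gc(1)] uG)
      finally have "u (frag_cmul n c) = 0"
        unfolding n(3) using b cochain_add[OF uco _ b(1)] singular_chain_sum[of G p Y "\<lambda>g. frag_cmul (m g) g"]
          singular_chain_cmul[OF Gc(1)] by simp
      then show ?thesis using cochain_cmul[OF uco c(1), of n] n(1) by simp
    qed
    have "u \<in> coboundaries p Y"
    proof (cases p)
      case 0
      have "u = \<zero>\<^bsub>cochain_space 0 Y\<^esub>"
      proof
        fix c
        show "u c = \<zero>\<^bsub>cochain_space 0 Y\<^esub> c"
          using van[of c] uco 0 by (auto simp: cochain_iff extensional_def chain_boundary_def restrict_def)
      qed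
      then show ?thesis using 0 by (simp add: coboundaries_def)
    next
      case (Suc q)
      then show ?thesis
        using cochain_extension[of u q Y] uco van by (auto simp: coboundaries_def)
    qed
    then show ?thesis using quot_eq_zero_iff[OF VZ BZ u(1)] u(2) unfolding H by simp
  qed
  have VH: "vectorspace (cohomology p Y :: ('k, ('a chain \<Rightarrow> 'k) set) module)" by (rule cohomology_vectorspace)
  have lfH: "linear_functional (cohomology p Y) (\<phi> g)" if "g \<in> G" for g
    using \<phi>(1)[OF that] unfolding H .
  obtain n e c where cs: "coordinate_system (cohomology p Y :: ('k, ('a chain \<Rightarrow> 'k) set) module) {..<n::nat} e c"
    using coordinate_system_exists[of G "cohomology p Y" \<phi>, OF fG VH lfH inj] by blast
  have "n = 0" if "r = 0"
  proof -
    have "G = {}" using cG that fG by simp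
    then have "carrier (cohomology p Y :: ('k, ('a chain \<Rightarrow> 'k) set) module) \<subseteq> {\<zero>\<^bsub>cohomology p Y\<^esub>}"
      using inj by blast
    then have e0: "e 0 = \<zero>\<^bsub>cohomology p Y\<^esub>" if "0 < n" using coords_carrier[OF cs, of 0] that by auto
    show ?thesis
    proof (rule ccontr)
      assume "n \<noteq> 0"
      then have n: "0 < n" by simp
      then show False
        using coords_dual[OF cs, of 0 0] functional_zero[OF VH coords_functional[OF cs, of 0]] e0[OF n] by simp
    qed
  qed
  with cs show ?thesis by blast
qed

section \<open>Generating functions\<close>

text \<open>
  The generating polynomial of the monomials of length \<open>N\<close> by degree, and below the power series
  in \<open>q\<^sup>l\<close> with these polynomials as coefficients.
\<close>

definition monomial_sum :: "'i set \<Rightarrow> ('i \<Rightarrow> int) \<Rightarrow> nat \<Rightarrow> rat fls" where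
  "monomial_sum I dg N = (\<Sum>\<mu>\<in>monomials I dg N. \<Prod>i\<in>#\<mu>. fls_X_intpow (dg i))"

definition monomial_series :: "'i set \<Rightarrow> ('i \<Rightarrow> int) \<Rightarrow> nat \<Rightarrow> rat fls fps" where
  "monomial_series I dg l = Abs_fps (\<lambda>n. if l dvd n then monomial_sum I dg (n div l) else 0)"

lemma monomials_zero: "monomials I dg 0 = {{#}}"
  by (auto simp: monomials_def)

lemma monomial_sum_zero [simp]: "monomial_sum I dg 0 = 1"
  by (simp add: monomial_sum_def monomials_zero)

text \<open>
  A monomial either avoids \<open>i\<close> or is \<open>i\<close> times a shorter monomial, which may contain \<open>i\<close> again exactly if
  the degree of \<open>i\<close> is even.
\<close>

lemma monomials_insert:
  fixes dg :: "'i \<Rightarrow> int"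
  assumes i: "i \<notin> I"
  defines "R \<equiv> (if odd (dg i) then I else insert i I)"
  shows "monomials (insert i I) dg (Suc N) = monomials I dg (Suc N) \<union> add_mset i ` monomials R dg N" (is "?L = ?R")
proof
  show "?L \<subseteq> ?R"
  proof
    fix \<mu> assume \<mu>: "\<mu> \<in> ?L"
    show "\<mu> \<in> ?R"
    proof (cases "i \<in># \<mu>")
      case True
      then obtain \<nu> where \<nu>: "\<mu> = add_mset i \<nu>" by (meson multi_member_split)
      have "count \<nu> j \<le> 1" if "odd (dg j)" for j
      proof -
        have "count \<mu> j \<le> 1" using \<mu> that by (auto simp: monomials_def)
        then show ?thesis unfolding \<nu> by (auto split: if_splits)
      qed
      moreover have "i \<notin># \<nu>" if "odd (dg i)"
      proof -
        have "count \<mu> i \<le> 1" using \<mu> that by (auto simp: monomials_def)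
        then show ?thesis unfolding \<nu> by (simp add: not_in_iff)
      qed
      then have "set_mset \<nu> \<subseteq> R" using \<mu> \<nu> by (auto simp: monomials_def R_def)
      ultimately have "\<nu> \<in> monomials R dg N" using \<mu> \<nu> by (simp add: monomials_def)
      then show ?thesis using \<nu> by blast
    next
      case False
      then show ?thesis using \<mu> by (auto simp: monomials_def)
    qed
  qed
  show "?R \<subseteq> ?L"
  proof
    fix \<mu> assume "\<mu> \<in> ?R"
    then show "\<mu> \<in> ?L"
    proof
      assume "\<mu> \<in> add_mset i ` monomials R dg N"
      then obtain \<nu> where \<nu>: "\<mu> = add_mset i \<nu>" "\<nu> \<in> monomials R dg N" by blast
      have "count \<mu> j \<le> 1" if j: "odd (dg j)" for j
      proof (cases "j = i")
        case True
        then have "i \<notin># \<nu>" using \<nu>(2) i j by (auto simp: monomials_def R_def)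
        then show ?thesis using True \<nu>(1) by (simp add: not_in_iff)
      next
        case False
        then show ?thesis using \<nu> j by (simp add: monomials_def)
      qed
      then show ?thesis using \<nu> by (auto simp: monomials_def R_def split: if_splits)
    qed (auto simp: monomials_def)
  qed
qed

lemma monomial_sum_insert:
  assumes I: "finite I" and i: "i \<notin> I"
  shows "monomial_sum (insert i I) dg (Suc N) = monomial_sum I dg (Suc N)
    + fls_X_intpow (dg i) * monomial_sum (if odd (dg i) then I else insert i I) dg N"
proof -
  let ?R = "if odd (dg i) then I else insert i I"
  let ?f = "\<lambda>\<mu>. \<Prod>i\<in>#\<mu>. fls_X_intpow (dg i) :: rat fls"
  have fin: "finite (monomials I dg (Suc N))" "finite (monomials ?R dg N)"
    using I by (auto intro!: finite_monomials)
  have "monomials I dg (Suc N) \<inter> add_mset i ` monomials ?R dg N = {}"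
    using i by (auto simp: monomials_def)
  then have "monomial_sum (insert i I) dg (Suc N)
      = monomial_sum I dg (Suc N) + (\<Sum>\<mu>\<in>add_mset i ` monomials ?R dg N. ?f \<mu>)"
    unfolding monomial_sum_def monomials_insert[OF i] using fin by (intro sum.union_disjoint) auto
  also have "(\<Sum>\<mu>\<in>add_mset i ` monomials ?R dg N. ?f \<mu>) = (\<Sum>\<mu>\<in>monomials ?R dg N. ?f (add_mset i \<mu>))"
    by (subst sum.reindex) (auto simp: inj_on_def)
  also have "\<dots> = fls_X_intpow (dg i) * monomial_sum ?R dg N"
    by (simp add: monomial_sum_def sum_distrib_left)
  finally show ?thesis .
qed

lemma monomial_tq_nth_0: "l > 0 \<Longrightarrow> fps_nth (monomial_tq d l) 0 = 0"
  by (simp add: monomial_tq_def fps_mult_nth_0)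

lemma monomial_series_insert:
  assumes I: "finite I" and i: "i \<notin> I" and l: "l > 0"
  shows "monomial_series (insert i I) dg l = monomial_series I dg l
    + monomial_tq (dg i) l * monomial_series (if odd (dg i) then I else insert i I) dg l"
proof (rule fps_ext)
  fix n
  let ?R = "if odd (dg i) then I else insert i I"
  have nth: "fps_nth (monomial_tq (dg i) l * f) n' = (if n' < l then 0 else fls_X_intpow (dg i) * fps_nth f (n' - l))" for f n'
    by (simp add: monomial_tq_def mult.assoc fps_X_power_mult_nth)
  show "fps_nth (monomial_series (insert i I) dg l) n
    = fps_nth (monomial_series I dg l + monomial_tq (dg i) l * monomial_series ?R dg l) n"
  proof (cases "l dvd n")
    case True
    then obtain k where k: "n = l * k" by blast
    show ?thesis
    proof (cases k)
      case 0
      then show ?thesis using k l by (simp add: monomial_tq_nth_0 monomial_series_def fps_mult_nth_0)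
    next
      case (Suc j)
      have "\<not> n < l" "n - l = l * j" using k Suc by auto
      then show ?thesis
        using k l Suc monomial_sum_insert[OF I i, of dg j]
        by (simp add: nth monomial_series_def del: mult_Suc_right)
    qed
  next
    case False
    moreover have "\<not> l dvd n - l" if "\<not> n < l" using False that by (simp add: dvd_minus_self)
    ultimately show ?thesis by (simp add: nth monomial_series_def)
  qed
qed

lemma monomial_series_empty:
  assumes "l > 0"
  shows "monomial_series {} dg l = 1"
proof (rule fps_ext)
  fix n
  have "monomial_sum {} dg (n div l) = 0" if "l dvd n" "n \<noteq> 0"
  proof -
    have "n div l \<noteq> 0" using that assms by (auto elim!: dvdE)
    then have "monomials {} dg (n div l) = {}" by (auto simp: monomials_def)
    then show ?thesis by (simp add: monomial_sum_def)
  qed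
  then show "fps_nth (monomial_series {} dg l) n = fps_nth 1 n"
    by (cases "n = 0") (simp_all add: monomial_series_def)
qed

text \<open>
  By \<open>monomial_series_insert\<close> a further basis vector of odd degree multiplies the series by
  \<open>1 + t\<^sup>d q\<^sup>l\<close>, and one of even degree satisfies \<open>S' = S + t\<^sup>d q\<^sup>l S'\<close>, that is, it divides the series by
  \<open>1 - t\<^sup>d q\<^sup>l\<close>.
\<close>

lemma monomial_series_product:
  assumes I: "finite I" and l: "l > 0"
  shows "monomial_series I dg l * (\<Prod>i\<in>{i \<in> I. even (dg i)}. 1 - monomial_tq (dg i) l)
    = (\<Prod>i\<in>{i \<in> I. odd (dg i)}. 1 + monomial_tq (dg i) l)"
  using I
proof (induction I rule: finite_induct)
  case empty
  then show ?case by (simp add: monomial_series_empty[OF l])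
next
  case (insert i I)
  let ?E = "\<lambda>I. \<Prod>i\<in>{i \<in> I. even (dg i)}. 1 - monomial_tq (dg i) l"
  let ?O = "\<lambda>I. \<Prod>i\<in>{i \<in> I. odd (dg i)}. 1 + monomial_tq (dg i) l"
  note rec = monomial_series_insert[OF insert.hyps l, of dg]
  show ?case
  proof (cases "odd (dg i)")
    case True
    have sets: "{j \<in> insert i I. even (dg j)} = {j \<in> I. even (dg j)}"
      "{j \<in> insert i I. odd (dg j)} = insert i {j \<in> I. odd (dg j)}" using True by auto
    have "monomial_series (insert i I) dg l = (1 + monomial_tq (dg i) l) * monomial_series I dg l"
      using rec True by (simp add: algebra_simps)
    moreover have "?O (insert i I) = (1 + monomial_tq (dg i) l) * ?O I"
      unfolding sets using insert.hyps by (subst prod.insert) auto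
    ultimately show ?thesis using insert.IH unfolding sets(1) by (simp add: mult.assoc)
  next
    case False
    have sets: "{j \<in> insert i I. even (dg j)} = insert i {j \<in> I. even (dg j)}"
      "{j \<in> insert i I. odd (dg j)} = {j \<in> I. odd (dg j)}" using False by auto
    have "monomial_series (insert i I) dg l * (1 - monomial_tq (dg i) l) = monomial_series I dg l"
      using rec False by (simp add: algebra_simps)
    moreover have "?E (insert i I) = (1 - monomial_tq (dg i) l) * ?E I"
      unfolding sets using insert.hyps by (subst prod.insert) auto
    ultimately show ?thesis using insert.IH unfolding sets(2) by (simp flip: mult.assoc)
  qed
qed

lemma prod_by_degree:
  fixes f :: "int \<Rightarrow> 'b::comm_monoid_mult"
  assumes I: "finite I"
  shows "(\<Prod>d | P d \<and> card {i \<in> I. dg i = d} \<noteq> 0. f d ^ card {i \<in> I. dg i = d})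
    = (\<Prod>i\<in>{i \<in> I. P (dg i)}. f (dg i))"
proof -
  let ?J = "{i \<in> I. P (dg i)}"
  have J: "finite ?J" using I by simp
  have "{d. P d \<and> card {i \<in> I. dg i = d} \<noteq> 0} = dg ` ?J" using I by (auto simp: card_eq_0_iff)
  moreover have "(\<Prod>i\<in>?J. f (dg i)) = (\<Prod>d\<in>dg ` ?J. \<Prod>i\<in>{i \<in> ?J. dg i = d}. f (dg i))"
    using prod.image_gen[OF J] .
  moreover have "(\<Prod>i\<in>{i \<in> ?J. dg i = d}. f (dg i)) = f d ^ card {i \<in> I. dg i = d}" if "d \<in> dg ` ?J" for d
  proof -
    have "{i \<in> ?J. dg i = d} = {i \<in> I. dg i = d}" using that by auto
    then show ?thesis by (simp add: prod_constant)
  qed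
  ultimately show ?thesis by simp
qed

lemma fps_prod_nth_0:
  fixes f :: "'i \<Rightarrow> 'b::comm_ring_1 fps"
  assumes "finite A" "\<And>i. i \<in> A \<Longrightarrow> fps_nth (f i) 0 = 1"
  shows "fps_nth (prod f A) 0 = 1"
  using assms by (induction A rule: finite_induct) (simp_all add: fps_mult_nth_0)

lemma product_factor_eq:
  assumes I: "finite I" and l: "l > 0" and b: "\<And>d. b d = card {i \<in> I. dg i = d}"
  shows "product_factor b m l = monomial_series I (\<lambda>i. dg i + int m * (int l - 1)) l"
proof -
  let ?dg = "\<lambda>i. dg i + int m * (int l - 1)"
  have e: "b (d - int m * (int l - 1)) = card {i \<in> I. ?dg i = d}" for d
    unfolding b by (rule arg_cong[of _ _ card]) auto
  let ?E = "\<Prod>i\<in>{i \<in> I. even (?dg i)}. 1 - monomial_tq (?dg i) l"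
  have "fps_nth ?E 0 = 1"
    using l I by (intro fps_prod_nth_0) (simp_all add: monomial_tq_nth_0)
  then have "?E \<noteq> 0" by (metis fps_zero_nth zero_neq_one)
  have "product_factor b m l = (\<Prod>i\<in>{i \<in> I. odd (?dg i)}. 1 + monomial_tq (?dg i) l) / ?E"
    unfolding product_factor_def Let_def e prod_by_degree[OF I] ..
  also have "\<dots> = monomial_series I ?dg l * ?E / ?E" unfolding monomial_series_product[OF I l] ..
  also have "\<dots> = monomial_series I ?dg l" using \<open>?E \<noteq> 0\<close> by (rule nonzero_mult_div_cancel_right)
  finally show ?thesis .
qed

subsection \<open>Cycle types\<close>

text \<open>
  Cycle types of \<open>n\<close> with cycles of length at most \<open>L\<close>, which index the terms of a finite product of series.
\<close>

definition bounded_cycle_types :: "nat \<Rightarrow> nat \<Rightarrow> (nat \<Rightarrow> nat) set" where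
  "bounded_cycle_types L n = {N. (\<forall>l. l \<notin> {1..L} \<longrightarrow> N l = 0) \<and> (\<Sum>l\<in>{1..L}. l * N l) = n}"

lemma bounded_cycle_types_finite: "finite (bounded_cycle_types L n)"
proof -
  have "N l \<le> n" if N: "N \<in> bounded_cycle_types L n" and l: "l \<in> {1..L}" for N l
  proof -
    have "l * N l \<le> (\<Sum>l\<in>{1..L}. l * N l)" using l by (intro member_le_sum) auto
    also have "\<dots> = n" using N by (simp add: bounded_cycle_types_def)
    finally have "l * N l \<le> n" .
    moreover have "N l \<le> l * N l" using l by (cases l) auto
    ultimately show ?thesis by (rule order_trans[rotated])
  qed
  then have "bounded_cycle_types L n \<subseteq> {N. \<forall>l. (l \<in> {1..L} \<longrightarrow> N l \<in> {..n}) \<and> (l \<notin> {1..L} \<longrightarrow> N l = 0)}"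
    unfolding bounded_cycle_types_def by auto
  moreover have "finite {N. \<forall>l. (l \<in> {1..L} \<longrightarrow> N l \<in> {..n}) \<and> (l \<notin> {1..L} \<longrightarrow> N l = 0)}"
    by (rule finite_set_of_finite_funs) auto
  ultimately show ?thesis by (rule finite_subset)
qed

lemma bounded_cycle_types_eq: "bounded_cycle_types n n = cycle_types n"
proof (intro subset_antisym subsetI)
  fix N assume N: "N \<in> bounded_cycle_types n n"
  then have sub: "{l. N l \<noteq> 0} \<subseteq> {1..n}" by (auto simp: bounded_cycle_types_def)
  have "(\<Sum>l | N l \<noteq> 0. l * N l) = (\<Sum>l\<in>{1..n}. l * N l)"
    by (rule sum.mono_neutral_left) (use sub in auto)
  then show "N \<in> cycle_types n"
    using N finite_subset[OF sub] by (auto simp: bounded_cycle_types_def cycle_types_def)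
next
  fix N assume N: "N \<in> cycle_types n"
  have fin: "finite {l. N l \<noteq> 0}" and s: "(\<Sum>l | N l \<noteq> 0. l * N l) = n" and N0: "N 0 = 0"
    using N by (auto simp: cycle_types_def)
  have "l \<in> {1..n}" if "N l \<noteq> 0" for l
  proof -
    have "l * N l \<le> n" unfolding s[symmetric] using that fin by (intro member_le_sum) auto
    moreover have "l \<le> l * N l" using that by simp
    ultimately have "l \<le> n" by linarith
    moreover have "l \<noteq> 0" using that N0 by metis
    ultimately show ?thesis by simp
  qed
  then have sub: "{l. N l \<noteq> 0} \<subseteq> {1..n}" by blast
  have "(\<Sum>l | N l \<noteq> 0. l * N l) = (\<Sum>l\<in>{1..n}. l * N l)"
    by (rule sum.mono_neutral_left) (use sub in auto)
  then show "N \<in> bounded_cycle_types n n" using s sub by (auto simp: bounded_cycle_types_def)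
qed

text \<open>
  Induction on \<open>L\<close>: in the coefficient of the product with the last factor, the index \<open>k\<close> of that
  factor is the number of cycles of length \<open>L + 1\<close>.
\<close>

lemma prod_series_nth:
  fixes h :: "nat \<Rightarrow> nat \<Rightarrow> 'b::comm_ring_1"
  shows "fps_nth (\<Prod>l\<in>{1..L}. Abs_fps (\<lambda>n. if l dvd n then h l (n div l) else 0)) n
    = (\<Sum>N\<in>bounded_cycle_types L n. \<Prod>l\<in>{1..L}. h l (N l))"
proof (induction L arbitrary: n)
  case 0
  have "bounded_cycle_types 0 n = (if n = 0 then {\<lambda>_. 0} else {})" by (auto simp: bounded_cycle_types_def)
  then show ?case by simp
next
  case (Suc L)
  let ?F = "\<lambda>l. Abs_fps (\<lambda>n. if l dvd n then h l (n div l) else 0)"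
  let ?K = "{k. Suc L * k \<le> n}"
  let ?c = "\<lambda>N. \<Prod>l\<in>{1..L}. h l (N l)"
  have finK: "finite ?K" by (rule finite_subset[of _ "{..n}"]) auto
  have "(\<Prod>l\<in>{1..Suc L}. ?F l) = ?F (Suc L) * (\<Prod>l\<in>{1..L}. ?F l)"
    by (simp add: prod.nat_ivl_Suc' mult.commute)
  then have "fps_nth (\<Prod>l\<in>{1..Suc L}. ?F l) n
      = (\<Sum>i=0..n. (if Suc L dvd i then h (Suc L) (i div Suc L) else 0) * sum ?c (bounded_cycle_types L (n - i)))"
    by (simp only: fps_mult_nth Suc.IH fps_nth_Abs_fps)
  also have "\<dots> = (\<Sum>i\<in>(\<lambda>k. Suc L * k) ` ?K.
      (if Suc L dvd i then h (Suc L) (i div Suc L) else 0) * sum ?c (bounded_cycle_types L (n - i)))"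
    by (rule sum.mono_neutral_right) (auto elim!: dvdE simp del: mult_Suc)
  also have "\<dots> = (\<Sum>k\<in>?K. h (Suc L) k * sum ?c (bounded_cycle_types L (n - Suc L * k)))"
    by (subst sum.reindex) (auto simp: inj_on_def simp del: mult_Suc)
  also have "\<dots> = (\<Sum>(k, N)\<in>Sigma ?K (\<lambda>k. bounded_cycle_types L (n - Suc L * k)). h (Suc L) k * ?c N)"
    using finK bounded_cycle_types_finite by (subst sum.Sigma[symmetric]) (auto simp: sum_distrib_left)
  also have "\<dots> = (\<Sum>N\<in>bounded_cycle_types (Suc L) n. \<Prod>l\<in>{1..Suc L}. h l (N l))"
  proof (rule sum.reindex_bij_witness[of _ "\<lambda>N. (N (Suc L), N(Suc L := 0))" "\<lambda>(k, N). N(Suc L := k)"])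
    fix a assume a: "a \<in> Sigma ?K (\<lambda>k. bounded_cycle_types L (n - Suc L * k))"
    obtain k N where kN: "a = (k, N)" "Suc L * k \<le> n" "N \<in> bounded_cycle_types L (n - Suc L * k)" using a by auto
    have N0: "N (Suc L) = 0" using kN(3) by (simp add: bounded_cycle_types_def)
    have "(\<Sum>l\<in>{1..L}. l * (N(Suc L := k)) l) = (\<Sum>l\<in>{1..L}. l * N l)"
      by (rule sum.cong) auto
    then have "N(Suc L := k) \<in> bounded_cycle_types (Suc L) n"
      using kN(2,3) by (auto simp: bounded_cycle_types_def sum.nat_ivl_Suc' simp del: mult_Suc)
    then show "(case a of (k, N) \<Rightarrow> N(Suc L := k)) \<in> bounded_cycle_types (Suc L) n" using kN(1) by simp
    show "((case a of (k, N) \<Rightarrow> N(Suc L := k)) (Suc L), (case a of (k, N) \<Rightarrow> N(Suc L := k))(Suc L := 0)) = a"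
      using kN(1) N0 by (auto simp: fun_eq_iff)
    have "(\<Prod>l\<in>{1..L}. h l ((N(Suc L := k)) l)) = ?c N" by (rule prod.cong) auto
    then show "(\<Prod>l\<in>{1..Suc L}. h l ((case a of (k, N) \<Rightarrow> N(Suc L := k)) l))
        = (case a of (k, N) \<Rightarrow> h (Suc L) k * ?c N)"
      using kN(1) by (simp add: prod.nat_ivl_Suc')
  next
    fix N assume N: "N \<in> bounded_cycle_types (Suc L) n"
    show "(case (N (Suc L), N(Suc L := 0)) of (k, N) \<Rightarrow> N(Suc L := k)) = N" by simp
    have "(\<Sum>l\<in>{1..L}. l * (N(Suc L := 0)) l) = (\<Sum>l\<in>{1..L}. l * N l)"
      by (rule sum.cong) auto
    moreover have "Suc L * N (Suc L) + (\<Sum>l\<in>{1..L}. l * N l) = n"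
      using N by (simp add: bounded_cycle_types_def sum.nat_ivl_Suc' del: mult_Suc)
    moreover have "N l = 0" if "l \<notin> {1..Suc L}" for l using N that unfolding bounded_cycle_types_def by blast
    ultimately show "(N (Suc L), N(Suc L := 0)) \<in> Sigma ?K (\<lambda>k. bounded_cycle_types L (n - Suc L * k))"
      by (auto simp: bounded_cycle_types_def simp del: mult_Suc)
  qed
  finally show ?case .
qed

text \<open>
  The coefficient of \<open>q\<^sup>n\<close> in the partial products is constant once the bound on the cycle length
  reaches \<open>n\<close>, because longer cycles do not occur. This is convergence of formal power series, and
  the limit is nonzero since its constant term is \<open>1\<close>.
\<close>

lemma has_prod_cycle_types:
  fixes h :: "nat \<Rightarrow> nat \<Rightarrow> rat fls"
  assumes h0: "\<And>l. h l 0 = 1"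
    and S: "\<And>n. fps_nth S n = (\<Sum>N\<in>cycle_types n. \<Prod>l\<in>{1..n}. h l (N l))"
  shows "(\<lambda>l. Abs_fps (\<lambda>n. if Suc l dvd n then h (Suc l) (n div Suc l) else 0)) has_prod S"
proof -
  let ?F = "\<lambda>l. Abs_fps (\<lambda>n. if l dvd n then h l (n div l) else 0)"
  \<comment> \<open>The factors are indexed from \<open>0\<close>, the cycle lengths from \<open>1\<close>.\<close>
  have partial: "(\<Prod>i\<le>L. ?F (Suc i)) = (\<Prod>l\<in>{1..Suc L}. ?F l)" for L
    by (rule prod.reindex_bij_witness[of _ "\<lambda>l. l - 1" Suc]) auto
  have stable: "fps_nth (\<Prod>l\<in>{1..L}. ?F l) n = fps_nth S n" if "n \<le> L" for n L
  proof -
    have "bounded_cycle_types L n = bounded_cycle_types n n"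
    proof (intro subset_antisym subsetI)
      fix N assume N: "N \<in> bounded_cycle_types L n"
      have big: "N l = 0" if l: "l \<in> {1..L}" "n < l" for l
      proof (rule ccontr)
        assume "N l \<noteq> 0"
        then have "l \<le> l * N l" by simp
        also have "\<dots> \<le> (\<Sum>l\<in>{1..L}. l * N l)" using l(1) by (intro member_le_sum) auto
        finally show False using N l(2) by (simp add: bounded_cycle_types_def)
      qed
      have "(\<Sum>l\<in>{1..n}. l * N l) = (\<Sum>l\<in>{1..L}. l * N l)"
        by (rule sum.mono_neutral_left) (use \<open>n \<le> L\<close> big in auto)
      moreover have "N l = 0" if "l \<notin> {1..n}" for l
        using big[of l] N that by (cases "l \<in> {1..L}") (auto simp: bounded_cycle_types_def)
      ultimately show "N \<in> bounded_cycle_types n n" using N by (simp add: bounded_cycle_types_def)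
    next
      fix N assume N: "N \<in> bounded_cycle_types n n"
      have "(\<Sum>l\<in>{1..n}. l * N l) = (\<Sum>l\<in>{1..L}. l * N l)"
        by (rule sum.mono_neutral_left) (use \<open>n \<le> L\<close> N in \<open>auto simp: bounded_cycle_types_def\<close>)
      then show "N \<in> bounded_cycle_types L n" using N \<open>n \<le> L\<close> by (auto simp: bounded_cycle_types_def)
    qed
    then have "fps_nth (\<Prod>l\<in>{1..L}. ?F l) n = (\<Sum>N\<in>bounded_cycle_types n n. \<Prod>l\<in>{1..L}. h l (N l))"
      using prod_series_nth[where h = h and L = L and n = n] by simp
    also have "\<dots> = (\<Sum>N\<in>bounded_cycle_types n n. \<Prod>l\<in>{1..n}. h l (N l))"
    proof (rule sum.cong[OF refl])
      fix N assume "N \<in> bounded_cycle_types n n"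
      then show "(\<Prod>l\<in>{1..L}. h l (N l)) = (\<Prod>l\<in>{1..n}. h l (N l))"
        by (intro prod.mono_neutral_right) (use \<open>n \<le> L\<close> h0 in \<open>auto simp: bounded_cycle_types_def\<close>)
    qed
    finally show ?thesis unfolding S bounded_cycle_types_eq .
  qed
  have "(\<lambda>L. \<Prod>i\<le>L. ?F (Suc i)) \<longlonglongrightarrow> S"
    unfolding partial
  proof (rule tendsto_fpsI)
    fix n
    show "\<forall>\<^sub>F L in sequentially. fps_nth (\<Prod>l\<in>{1..Suc L}. ?F l) n = fps_nth S n"
      using eventually_ge_at_top[of n] by eventually_elim (rule stable, simp)
  qed
  moreover have "S \<noteq> 0"
  proof -
    have "cycle_types 0 = {\<lambda>_. 0}"
      unfolding bounded_cycle_types_eq[symmetric] by (auto simp: bounded_cycle_types_def)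
    then have "fps_nth S 0 = 1" using S[of 0] by simp
    then show ?thesis by (metis fps_zero_nth zero_neq_one)
  qed
  ultimately show ?thesis unfolding has_prod_def raw_has_prod_def add_0_right by blast
qed

section \<open>The generating function of the delocalized cohomology\<close>

text \<open>Used to pass to natural numbers as indices, which are linearly ordered.\<close>

lemma homogeneous_coordinates_reindex:
  assumes hc: "homogeneous_coordinates V I e c dg" and f: "bij_betw f I' I"
  shows "homogeneous_coordinates V I' (e \<circ> f) (c \<circ> f) (dg \<circ> f)"
proof -
  note cs = homogeneous_coords[OF hc]
  have im: "f ` I' = I" and inj: "inj_on f I'" using f by (auto simp: bij_betw_def)
  have "coordinate_system V I' (e \<circ> f) (c \<circ> f)"
    unfolding coordinate_system_def
  proof (intro conjI ballI)
    show "vectorspace V" by (rule coords_vectorspace[OF cs])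
    show "finite I'" using bij_betw_finite[OF f] coords_finite[OF cs] by simp
    show "vspan V ((e \<circ> f) ` I') = carrier V" unfolding image_comp[symmetric] im by (rule coords_span[OF cs])
    fix i assume i: "i \<in> I'"
    then have fi: "f i \<in> I" using im by blast
    show "(e \<circ> f) i \<in> carrier V" using coords_carrier[OF cs fi] by simp
    show "linear_functional V ((c \<circ> f) i)" using coords_functional[OF cs fi] by simp
    fix j assume j: "j \<in> I'"
    then have "f j \<in> I" using im by blast
    then show "(c \<circ> f) i ((e \<circ> f) j) = (if i = j then 1 else 0)"
      using coords_dual[OF cs fi] inj_on_eq_iff[OF inj i j] by simp
  qed
  moreover have "degpart V d = {v \<in> carrier V. \<forall>i\<in>I'. (dg \<circ> f) i \<noteq> d \<longrightarrow> (c \<circ> f) i v = 0}" for d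
    unfolding homogeneous_degpart[OF hc] im[symmetric] by simp
  ultimately show ?thesis unfolding homogeneous_coordinates_def by blast
qed

text \<open>
  The coordinates of the separate groups \<open>H\<^sup>p\<close> together form homogeneous coordinates of the direct sum
  over all \<open>p\<close>; the index set is finite because almost all \<open>H\<^sup>p\<close> vanish.
\<close>

lemma graded_cohomology_coordinates:
  fixes Y :: "'a topology"
  assumes fr: "finite_rank Y (topspace Y) (topspace Y)"
  obtains I :: "nat set" and e c dg where
    "homogeneous_coordinates
      (graded_cohomology Y :: ('k::field_char_0, nat \<Rightarrow> ('a chain \<Rightarrow> 'k) set) graded_module) I e c dg"
    "\<And>d. betti TYPE('k) Y d = card {i \<in> I. dg i = d}"
proof -
  let ?H = "\<lambda>p. cohomology p Y :: ('k, ('a chain \<Rightarrow> 'k) set) module"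
  let ?T = "graded_cohomology Y :: ('k, nat \<Rightarrow> ('a chain \<Rightarrow> 'k) set) graded_module"
  obtain r where r: "finite {p. r p \<noteq> 0}" "\<And>p. rank_le p (r p) Y (topspace Y) (topspace Y)"
    using fr unfolding finite_rank_def by blast
  have "\<forall>p. \<exists>n e c. (r p = 0 \<longrightarrow> n = 0) \<and> coordinate_system (?H p) {..<n::nat} e c"
  proof
    show "\<exists>n e c. (r p = 0 \<longrightarrow> n = 0) \<and> coordinate_system (?H p) {..<n::nat} e c" for p
      by (rule cohomology_coordinates[OF r(2)])
  qed
  from choice[OF this] obtain n :: "nat \<Rightarrow> nat" where
    "\<forall>p. \<exists>e c. (r p = 0 \<longrightarrow> n p = 0) \<and> coordinate_system (?H p) {..<n p} e c" ..
  from choice[OF this] obtain e where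
    "\<forall>p. \<exists>c. (r p = 0 \<longrightarrow> n p = 0) \<and> coordinate_system (?H p) {..<n p} (e p) c" ..
  from choice[OF this] obtain c where
    c: "\<forall>p. (r p = 0 \<longrightarrow> n p = 0) \<and> coordinate_system (?H p) {..<n p} (e p) (c p)" ..
  have n0: "r p = 0 \<Longrightarrow> n p = 0" and cs: "coordinate_system (?H p) {..<n p} (e p) (c p)" for p
    using c by auto
  define S where "S = Sigma UNIV (\<lambda>p. {..<n p})"
  define E where "E = (\<lambda>(p, j). \<lambda>k\<in>UNIV. if k = p then e p j else \<zero>\<^bsub>?H k\<^esub>)"
  define C where "C = (\<lambda>(p, j) \<alpha>. c p j (\<alpha> p))"
  have fin: "finite S"
  proof (rule finite_subset)
    show "S \<subseteq> Sigma {p. r p \<noteq> 0} (\<lambda>p. {..<n p})"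
      using n0 by (fastforce simp: S_def)
  qed (use r(1) in \<open>intro finite_SigmaI, auto\<close>)
  have "coordinate_system (direct_sum UNIV ?H) S E C"
    unfolding S_def E_def C_def
    by (rule coordinate_system_direct_sum[where V = ?H and I = UNIV and J = "\<lambda>p. {..<n p}" and e = e and c = c])
      (use cs fin S_def in auto)
  then have csT: "coordinate_system ?T S E C"
    by (rule coordinate_system_cong[rotated 4]) (simp_all add: graded_cohomology_def total_cohomology_def)
  have zero_iff: "\<alpha> p = \<zero>\<^bsub>?H p\<^esub> \<longleftrightarrow> (\<forall>j<n p. c p j (\<alpha> p) = 0)"
    if \<alpha>: "\<alpha> \<in> carrier (direct_sum UNIV ?H)" for \<alpha> p
  proof
    note V = coords_vectorspace[OF cs[of p]]
    have z: "c p j \<zero>\<^bsub>?H p\<^esub> = 0" if "j < n p" for j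
      using functional_zero[OF V coords_functional[OF cs]] that by simp
    then show "\<forall>j<n p. c p j (\<alpha> p) = 0" if "\<alpha> p = \<zero>\<^bsub>?H p\<^esub>" unfolding that by blast
    assume "\<forall>j<n p. c p j (\<alpha> p) = 0"
    then have "c p j (\<alpha> p) = c p j \<zero>\<^bsub>?H p\<^esub>" if "j \<in> {..<n p}" for j using that z by simp
    moreover have "\<alpha> p \<in> carrier (?H p)" using \<alpha> by (auto simp: direct_sum_def)
    ultimately show "\<alpha> p = \<zero>\<^bsub>?H p\<^esub>" using coords_eqI[OF cs[of p]] vs_zero_closed[OF V] by blast
  qed
  have hcS: "homogeneous_coordinates ?T S E C (\<lambda>(p, j). int p)"
    unfolding homogeneous_coordinates_def
  proof (intro conjI allI csT)
    fix d
    have "(\<forall>p. int p \<noteq> d \<longrightarrow> \<alpha> p = \<zero>\<^bsub>?H p\<^esub>) \<longleftrightarrow> (\<forall>s\<in>S. (case s of (p, j) \<Rightarrow> int p) \<noteq> d \<longrightarrow> C s \<alpha> = 0)"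
      if "\<alpha> \<in> carrier (direct_sum UNIV ?H)" for \<alpha>
      using zero_iff[OF that] by (auto simp: S_def C_def)
    then show "degpart ?T d = {\<alpha> \<in> carrier ?T. \<forall>s\<in>S. (case s of (p, j) \<Rightarrow> int p) \<noteq> d \<longrightarrow> C s \<alpha> = 0}"
      by (auto simp: graded_cohomology_def total_cohomology_def)
  qed
  obtain f where f: "bij_betw f {0..<card S} S" using ex_bij_betw_nat_finite[OF fin] by blast
  let ?dg = "(\<lambda>(p, j). int p) \<circ> f"
  have hc: "homogeneous_coordinates ?T {0..<card S} (E \<circ> f) (C \<circ> f) ?dg"
    using homogeneous_coordinates_reindex[OF hcS f] .
  have "betti TYPE('k) Y d = card {i \<in> {0..<card S}. ?dg i = d}" for d
  proof -
    have "card {i \<in> {0..<card S}. ?dg i = d} = card {s \<in> S. (case s of (p, j) \<Rightarrow> int p) = d}"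
      using graded_dim_homogeneous[OF hc, of d] graded_dim_homogeneous[OF hcS, of d] by simp
    also have "\<dots> = betti TYPE('k) Y d"
    proof (cases "d < 0")
      case True
      then have empty: "{s \<in> S. (case s of (p, j) \<Rightarrow> int p) = d} = {}" by auto
      show ?thesis unfolding empty using True by (simp add: betti_def)
    next
      case False
      then have "{s \<in> S. (case s of (p, j) \<Rightarrow> int p) = d} = {nat d} \<times> {..<n (nat d)}"
        by (auto simp: S_def)
      then show ?thesis using False vdim_coordinate_system[OF cs[of "nat d"]]
        by (simp add: betti_def card_cartesian_product)
    qed
    finally show ?thesis ..
  qed
  then show ?thesis using that[OF hc] by blast
qed

lemma symmetric_product_sum_coordinates:
  fixes V :: "('k::field_char_0, 'v) graded_module" and I :: "'i::linorder set" and m n :: nat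
  assumes hc: "homogeneous_coordinates V I e c dg"
  defines "sdg \<equiv> \<lambda>l i. dg i + int m * (int l - 1)"
  shows "\<exists>E C. homogeneous_coordinates (symmetric_product_sum m V n)
    (Sigma (cycle_types n) (\<lambda>N. \<Pi>\<^sub>E l\<in>{1..n}. monomials I (sdg l) (N l))) E C
    (\<lambda>(N, \<iota>). \<Sum>l\<in>{1..n}. \<Sum>i\<in>#\<iota> l. sdg l i)"
proof -
  let ?S = "\<lambda>N l. symmetric_power (N l) (shift V (int m * (int l - 1)))"
  let ?J = "\<lambda>N. \<Pi>\<^sub>E l\<in>{1..n}. monomials I (sdg l) (N l)"
  have I: "finite I" using coords_finite[OF homogeneous_coords[OF hc]] .
  have sym: "\<exists>E C. homogeneous_coordinates (?S N l) (monomials I (sdg l) (N l)) E C (\<lambda>\<mu>. \<Sum>i\<in>#\<mu>. sdg l i)" for N l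
    unfolding sdg_def
    by (rule homogeneous_basis.homogeneous_coordinates_symmetric_power[OF
          homogeneous_basis.intro[OF homogeneous_coordinates_shift[OF hc]]])
  have tensor: "\<exists>E C. homogeneous_coordinates (graded_tensor {1..n} (?S N)) (?J N) E C
      (\<lambda>\<iota>. \<Sum>l\<in>{1..n}. \<Sum>i\<in>#\<iota> l. sdg l i)" for N
  proof -
    have "\<forall>l. \<exists>E C. homogeneous_coordinates (?S N l) (monomials I (sdg l) (N l)) E C (\<lambda>\<mu>. \<Sum>i\<in>#\<mu>. sdg l i)"
      by (intro allI sym)
    from choice[OF this] obtain E where
      "\<forall>l. \<exists>C. homogeneous_coordinates (?S N l) (monomials I (sdg l) (N l)) (E l) C (\<lambda>\<mu>. \<Sum>i\<in>#\<mu>. sdg l i)" ..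
    from choice[OF this] obtain C where
      C: "\<forall>l. homogeneous_coordinates (?S N l) (monomials I (sdg l) (N l)) (E l) (C l) (\<lambda>\<mu>. \<Sum>i\<in>#\<mu>. sdg l i)" ..
    show ?thesis
      by (rule homogeneous_coordinates_tensor[where V = "?S N" and e = E and c = C
            and dg = "\<lambda>l \<mu>. \<Sum>i\<in>#\<mu>. sdg l i", OF spec[OF C] finite_atLeastAtMost])
  qed
  have "\<forall>N. \<exists>E C. homogeneous_coordinates (graded_tensor {1..n} (?S N)) (?J N) E C
      (\<lambda>\<iota>. \<Sum>l\<in>{1..n}. \<Sum>i\<in>#\<iota> l. sdg l i)" by (intro allI tensor)
  from choice[OF this] obtain E where
    "\<forall>N. \<exists>C. homogeneous_coordinates (graded_tensor {1..n} (?S N)) (?J N) (E N) C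
      (\<lambda>\<iota>. \<Sum>l\<in>{1..n}. \<Sum>i\<in>#\<iota> l. sdg l i)" ..
  from choice[OF this] obtain C where
    C: "\<forall>N. homogeneous_coordinates (graded_tensor {1..n} (?S N)) (?J N) (E N) (C N)
      (\<lambda>\<iota>. \<Sum>l\<in>{1..n}. \<Sum>i\<in>#\<iota> l. sdg l i)" ..
  have "finite (cycle_types n)" using bounded_cycle_types_finite[of n n] unfolding bounded_cycle_types_eq .
  then have fin: "finite (Sigma (cycle_types n) ?J)"
    by (intro finite_SigmaI finite_PiE finite_monomials I) auto
  show ?thesis
    unfolding symmetric_product_sum_def
    by (intro exI, rule homogeneous_coordinates_direct_sum[where V = "\<lambda>N. graded_tensor {1..n} (?S N)"
        and dg = "\<lambda>N \<iota>. \<Sum>l\<in>{1..n}. \<Sum>i\<in>#\<iota> l. sdg l i", OF spec[OF C] fin])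
qed

lemma fls_X_intpow_add: "fls_X_intpow (a + b) = (fls_X_intpow a * fls_X_intpow b :: 'b::comm_ring_1 fls)"
  by (simp add: fls_X_intpow_times_fls_X_intpow)

lemma fls_X_intpow_sum: "finite A \<Longrightarrow> fls_X_intpow (\<Sum>x\<in>A. f x) = (\<Prod>x\<in>A. fls_X_intpow (f x) :: 'b::comm_ring_1 fls)"
proof (induction A rule: finite_induct)
  case (insert x A)
  show ?case
    unfolding sum.insert[OF insert.hyps] prod.insert[OF insert.hyps] fls_X_intpow_add insert.IH ..
qed simp

lemma fls_X_intpow_sum_mset: "fls_X_intpow (\<Sum>x\<in>#\<mu>. f x) = (\<Prod>x\<in>#\<mu>. fls_X_intpow (f x) :: 'b::comm_ring_1 fls)"
proof (induction \<mu>)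
  case (add x \<mu>)
  then show ?case by (simp only: image_mset_add_mset sum_mset.add_mset prod_mset.add_mset fls_X_intpow_add)
qed simp

text \<open>
  Distributivity: a product of sums over monomials is a sum over families of monomials, whose degrees add up.
\<close>

lemma cycle_type_sum:
  assumes I: "finite I"
  shows "(\<Sum>(N, \<iota>)\<in>Sigma (cycle_types n) (\<lambda>N. \<Pi>\<^sub>E l\<in>{1..n}. monomials I (dg l) (N l)).
      fls_X_intpow (\<Sum>l\<in>{1..n}. \<Sum>i\<in>#\<iota> l. dg l i))
    = (\<Sum>N\<in>cycle_types n. \<Prod>l\<in>{1..n}. monomial_sum I (dg l) (N l))"
proof -
  have fin: "finite (cycle_types n)" using bounded_cycle_types_finite[of n n] unfolding bounded_cycle_types_eq .
  have fin': "finite (\<Pi>\<^sub>E l\<in>{1..n}. monomials I (dg l) (N l))" for N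
    by (intro finite_PiE finite_monomials I) auto
  have "(\<Sum>\<iota>\<in>(\<Pi>\<^sub>E l\<in>{1..n}. monomials I (dg l) (N l)). fls_X_intpow (\<Sum>l\<in>{1..n}. \<Sum>i\<in>#\<iota> l. dg l i))
      = (\<Prod>l\<in>{1..n}. monomial_sum I (dg l) (N l))" for N
  proof -
    have "(\<Prod>l\<in>{1..n}. monomial_sum I (dg l) (N l))
        = (\<Sum>\<iota>\<in>(\<Pi>\<^sub>E l\<in>{1..n}. monomials I (dg l) (N l)). \<Prod>l\<in>{1..n}. \<Prod>i\<in>#\<iota> l. fls_X_intpow (dg l i))"
      unfolding monomial_sum_def by (rule prod_sum_PiE) (auto intro: finite_monomials I)
    then show ?thesis by (simp add: fls_X_intpow_sum fls_X_intpow_sum_mset)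
  qed
  then show ?thesis using fin fin' by (subst sum.Sigma[symmetric]) auto
qed

text \<open>
  The invariants are a subset of a direct sum of vector spaces, the form required by \<open>poincare_polynomial_isomorphic\<close>.
\<close>

lemma symmetric_delocalized_cohomology_subspace:
  obtains T :: "('k::field_char_0, (nat \<Rightarrow> nat) \<Rightarrow> nat \<Rightarrow> ((nat \<Rightarrow> 'a) chain \<Rightarrow> 'k) set) module" and U
  where "vectorspace T" "U \<subseteq> carrier T" "symmetric_delocalized_cohomology M n = T\<lparr>carrier := U\<rparr>"
proof -
  let ?T = "direct_sum (carrier (sym_group n))
    (\<lambda>g. total_cohomology (fixed_space (power_space M n) permute_factors g))
    :: ('k, (nat \<Rightarrow> nat) \<Rightarrow> nat \<Rightarrow> ((nat \<Rightarrow> 'a) chain \<Rightarrow> 'k) set) module"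
  show ?thesis
  proof (rule that[of ?T])
    show "vectorspace ?T"
      unfolding total_cohomology_def by (intro direct_sum_vectorspace cohomology_vectorspace)
    show "symmetric_delocalized_cohomology M n = ?T\<lparr>carrier := {\<alpha> \<in> carrier ?T. \<forall>h\<in>carrier (sym_group n).
        delocalized_action (sym_group n) permute_factors (power_space M n) h \<alpha> = \<alpha>}\<rparr>"
      unfolding symmetric_delocalized_cohomology_def delocalized_cohomology_def Let_def ..
  qed blast
qed

theorem theorem4p1:
  fixes M :: "'a topology" and m :: nat
    and D :: "nat \<Rightarrow> int \<Rightarrow>
      ((nat \<Rightarrow> nat) \<Rightarrow> nat \<Rightarrow> ((nat \<Rightarrow> 'a) chain \<Rightarrow> 'k::real_normed_field) set) set"
  assumes "closed_manifold (2 * m) M"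
    and "\<And>n. is_grading (symmetric_delocalized_cohomology M n) (D n)"
    and "\<And>n. graded_isomorphic
           (with_grading (symmetric_delocalized_cohomology M n) (D n))
           (symmetric_product_sum m (graded_cohomology M) n)"
  shows "(\<lambda>l. product_factor (betti TYPE('k) M) m (Suc l)) has_prod
     Abs_fps (\<lambda>n. poincare_polynomial
       (with_grading (symmetric_delocalized_cohomology M n) (D n)))"
proof -
  obtain I :: "nat set" and e c dg where
    hc: "homogeneous_coordinates
      (graded_cohomology M :: ('k, nat \<Rightarrow> ('a chain \<Rightarrow> 'k) set) graded_module) I e c dg"
    and betti: "\<And>d. betti TYPE('k) M d = card {i \<in> I. dg i = d}"
    using graded_cohomology_coordinates[OF closed_manifold_finite_rank[OF assms(1)]] by metis
  have I: "finite I" using coords_finite[OF homogeneous_coords[OF hc]] .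
  let ?dg = "\<lambda>l i. dg i + int m * (int l - 1)"
  let ?h = "\<lambda>l. monomial_sum I (?dg l)"
  have "poincare_polynomial (with_grading (symmetric_delocalized_cohomology M n) (D n))
      = (\<Sum>N\<in>cycle_types n. \<Prod>l\<in>{1..n}. ?h l (N l))" for n
  proof -
    obtain T :: "('k, (nat \<Rightarrow> nat) \<Rightarrow> nat \<Rightarrow> ((nat \<Rightarrow> 'a) chain \<Rightarrow> 'k) set) module" and U
      where T: "vectorspace T" "U \<subseteq> carrier T" "symmetric_delocalized_cohomology M n = T\<lparr>carrier := U\<rparr>"
      by (rule symmetric_delocalized_cohomology_subspace)
    obtain E C where E: "homogeneous_coordinates
        (symmetric_product_sum m (graded_cohomology M :: ('k, nat \<Rightarrow> ('a chain \<Rightarrow> 'k) set) graded_module) n)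
        (Sigma (cycle_types n) (\<lambda>N. \<Pi>\<^sub>E l\<in>{1..n}. monomials I (?dg l) (N l))) E C
        (\<lambda>(N, \<iota>). \<Sum>l\<in>{1..n}. \<Sum>i\<in>#\<iota> l. ?dg l i)"
      using symmetric_product_sum_coordinates[OF hc, of m n] by blast
    have "poincare_polynomial (with_grading (symmetric_delocalized_cohomology M n) (D n))
        = (\<Sum>s\<in>Sigma (cycle_types n) (\<lambda>N. \<Pi>\<^sub>E l\<in>{1..n}. monomials I (?dg l) (N l)).
            fls_X_intpow (case s of (N, \<iota>) \<Rightarrow> \<Sum>l\<in>{1..n}. \<Sum>i\<in>#\<iota> l. ?dg l i))"
      using poincare_polynomial_isomorphic[OF T(1,2) assms(2)[of n, unfolded T(3)] assms(3)[of n, unfolded T(3)] E]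
      unfolding T(3) .
    also have "\<dots> = (\<Sum>N\<in>cycle_types n. \<Prod>l\<in>{1..n}. ?h l (N l))"
      using cycle_type_sum[OF I, where dg = ?dg and n = n] by (simp add: case_prod_beta)
    finally show ?thesis .
  qed
  moreover have "product_factor (betti TYPE('k) M) m (Suc l)
      = Abs_fps (\<lambda>n. if Suc l dvd n then ?h (Suc l) (n div Suc l) else 0)" for l
    unfolding product_factor_eq[OF I zero_less_Suc betti] monomial_series_def ..
  ultimately show ?thesis
    using has_prod_cycle_types[where h = ?h and S = "Abs_fps (\<lambda>n. poincare_polynomial
       (with_grading (symmetric_delocalized_cohomology M n) (D n)))"] by simp
qed

end
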